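(* Let $\mathbf P$ be a finite poset and $A=\Bbbk[\mathbf P]$. For any $M\in\operatorname{mod}A$ the following are equivalent: (1) $M$ is interval-decomposable. (2) $\underline{\dim}\,M=\sum_{I\in\mathbb I}d_M(V_I)\cdot\underline{\dim}\,V_I=\sum_{I\in\operatorname{crt}_1(M)}d_M(V_I)\cdot\underline{\dim}\,V_I$. (3) $\dim M=\sum_{I\in\mathbb I}d_M(V_I)\cdot\dim V_I=\sum_{I\in\operatorname{crt}_1(M)}d_M(V_I)\cdot\dim V_I$.
   Context: $\Bbbk$ is a field; $A=\Bbbk[\mathbf P]$ is the incidence category (the $\Bbbk$-linearization of $\mathbf P$ viewed as a category) and $\operatorname{mod}A$ is the category of $\Bbbk$-linear functors from $A$ to finite-dimensional $\Bbbk$-vector spaces. $\mathbb I$ is the set of intervals of $\mathbf P$, i.e. nonempty connected convex full subposets. $V_I$ has $V_I(x)=\Bbbk$ for $x\in I$, $0$ otherwise, with identity structure maps inside $I$ and zero otherwise. $M$ is interval-decomposable if it is isomorphic to a finite direct sum of modules of the form $V_I$, $I\in\mathbb I$ ($0$ included). $d_M(V_I)$ is the multiplicity of the indecomposable $V_I$ in a decomposition of $M$ into indecomposables. $\underline{\dim}\,M=(\dim M(x))_{x\in\mathbf P}$ is the dimension vector and $\dim M=\sum_{x\in\mathbf P}\dim M(x)$. For $N\in\operatorname{mod}A$: $\operatorname{supp}N=\{x\mid N(x)\ne0\}$, $\operatorname{top}N=N/\operatorname{rad}N$, $\operatorname{soc}N$ is the socle, $P_j(N)$ and $Q^j(N)$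 are the degree-$j$ terms of a minimal projective resolution and a minimal injective coresolution of $N$. $\operatorname{crt}_1(M)$ is the set of $I\in\mathbb I$ such that for $j=0,1$: $\operatorname{supp}(\operatorname{top}P_j(V_I))\subseteq\operatorname{supp}(\operatorname{top}P_j(M))$ and $\operatorname{supp}(\operatorname{soc}Q^j(V_I))\subseteq\operatorname{supp}(\operatorname{soc}Q^j(M))$. *)

theory Defs
  imports Complex_Main "HOL-Library.Function_Algebras" "HOL-Library.Set_Algebras"
begin

text \<open>
  The finite poset is a type \<open>'p :: {finite, order}\<close> and the field is a type \<open>'k :: field\<close>.  Vector
  spaces are subspaces of a type \<open>'v\<close> that carries a \<open>'k\<close>-vector space structure given by a scalar
  multiplication \<open>s :: 'k \<Rightarrow> 'v \<Rightarrow> 'v\<close> with \<^prop>\<open>vector_space s\<close>.  A \<open>'k\<close>-linear functor on the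
  linearization of \<open>'p\<close> is determined by its values on the basis morphisms, that is, on the unique
  morphism \<open>x \<rightarrow> y\<close> for each \<open>x \<le> y\<close>.  The values of \<open>tr M x y\<close> for \<open>\<not> x \<le> y\<close> or off the
  subspace \<open>sp M x\<close> carry
  no information.
\<close>

record ('p, 'v) rep =
  sp :: "'p \<Rightarrow> 'v set"
  tr :: "'p \<Rightarrow> 'p \<Rightarrow> 'v \<Rightarrow> 'v"

definition fin_dim_subspace :: "('k::field \<Rightarrow> 'v::ab_group_add \<Rightarrow> 'v) \<Rightarrow> 'v set \<Rightarrow> bool" where
  "fin_dim_subspace s V \<longleftrightarrow> module.subspace s V \<and> (\<exists>B. finite B \<and> V = module.span s B)"

definition linear_between ::
  "('k::field \<Rightarrow> 'v::ab_group_add \<Rightarrow> 'v) \<Rightarrow> 'v set \<Rightarrow>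
   ('k \<Rightarrow> 'w::ab_group_add \<Rightarrow> 'w) \<Rightarrow> 'w set \<Rightarrow> ('v \<Rightarrow> 'w) \<Rightarrow> bool" where
  "linear_between s V t W f \<longleftrightarrow>
     f ` V \<subseteq> W \<and>
     (\<forall>u\<in>V. \<forall>v\<in>V. f (u + v) = f u + f v) \<and>
     (\<forall>c. \<forall>v\<in>V. f (s c v) = t c (f v))"

definition is_rep :: "('k::field \<Rightarrow> 'v::ab_group_add \<Rightarrow> 'v) \<Rightarrow> ('p::order, 'v) rep \<Rightarrow> bool" where
  "is_rep s M \<longleftrightarrow>
     (\<forall>x. fin_dim_subspace s (sp M x)) \<and>
     (\<forall>x y. x \<le> y \<longrightarrow> linear_between s (sp M x) s (sp M y) (tr M x y)) \<and>
     (\<forall>x. \<forall>v\<in>sp M x. tr M x x v = v) \<and>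
     (\<forall>x y z. x \<le> y \<and> y \<le> z \<longrightarrow> (\<forall>v\<in>sp M x. tr M x z v = tr M y z (tr M x y v)))"

definition rep_hom ::
  "('k::field \<Rightarrow> 'v::ab_group_add \<Rightarrow> 'v) \<Rightarrow> ('p::order, 'v) rep \<Rightarrow>
   ('k \<Rightarrow> 'w::ab_group_add \<Rightarrow> 'w) \<Rightarrow> ('p, 'w) rep \<Rightarrow> ('p \<Rightarrow> 'v \<Rightarrow> 'w) \<Rightarrow> bool" where
  "rep_hom s M t N f \<longleftrightarrow>
     (\<forall>x. linear_between s (sp M x) t (sp N x) (f x)) \<and>
     (\<forall>x y. x \<le> y \<longrightarrow> (\<forall>v\<in>sp M x. f y (tr M x y v) = tr N x y (f x v)))"

definition rep_isomorphic ::
  "('k::field \<Rightarrow> 'v::ab_group_add \<Rightarrow> 'v) \<Rightarrow> ('p::order, 'v) rep \<Rightarrow>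
   ('k \<Rightarrow> 'w::ab_group_add \<Rightarrow> 'w) \<Rightarrow> ('p, 'w) rep \<Rightarrow> bool" where
  "rep_isomorphic s M t N \<longleftrightarrow>
     (\<exists>f. rep_hom s M t N f \<and> (\<forall>x. bij_betw (f x) (sp M x) (sp N x)))"

definition rep_inj :: "('p, 'v) rep \<Rightarrow> ('p \<Rightarrow> 'v \<Rightarrow> 'w) \<Rightarrow> bool" where
  "rep_inj M f \<longleftrightarrow> (\<forall>x. inj_on (f x) (sp M x))"

definition rep_im :: "('p, 'v) rep \<Rightarrow> ('p \<Rightarrow> 'v \<Rightarrow> 'w) \<Rightarrow> 'p \<Rightarrow> 'w set" where
  "rep_im M f = (\<lambda>x. f x ` sp M x)"

definition rep_ker :: "('p, 'v) rep \<Rightarrow> ('p \<Rightarrow> 'v \<Rightarrow> 'w::zero) \<Rightarrow> 'p \<Rightarrow> 'v set" where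
  "rep_ker M f = (\<lambda>x. {v \<in> sp M x. f x v = 0})"

definition zero_rep :: "('p, 'v::zero) rep \<Rightarrow> bool" where
  "zero_rep M \<longleftrightarrow> (\<forall>x. sp M x = {0})"

definition dim_vec ::
  "('k::field \<Rightarrow> 'v::ab_group_add \<Rightarrow> 'v) \<Rightarrow> ('p, 'v) rep \<Rightarrow> 'p \<Rightarrow> nat" where
  "dim_vec s M = (\<lambda>x. vector_space.dim s (sp M x))"

definition total_dim ::
  "('k::field \<Rightarrow> 'v::ab_group_add \<Rightarrow> 'v) \<Rightarrow> ('p::finite, 'v) rep \<Rightarrow> nat" where
  "total_dim s M = (\<Sum>x\<in>UNIV. dim_vec s M x)"

text \<open>
  The external direct sum of a list of modules: its elements at \<open>x\<close> are the families
  \<open>(f i)\<^sub>i\<close> with \<open>f i\<close> in the \<open>i\<close>-th module, extended by \<open>0\<close> beyond the length of the list.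
\<close>

definition fun_scale :: "('k \<Rightarrow> 'v \<Rightarrow> 'v) \<Rightarrow> 'k \<Rightarrow> ('b \<Rightarrow> 'v) \<Rightarrow> ('b \<Rightarrow> 'v)" where
  "fun_scale s c f = (\<lambda>i. s c (f i))"

definition dsum :: "('p, 'v::zero) rep list \<Rightarrow> ('p, nat \<Rightarrow> 'v) rep" where
  "dsum Ns =
     \<lparr>sp = (\<lambda>x. {f. (\<forall>i<length Ns. f i \<in> sp (Ns ! i) x) \<and> (\<forall>i\<ge>length Ns. f i = 0)}),
      tr = (\<lambda>x y f i. if i < length Ns then tr (Ns ! i) x y (f i) else 0)\<rparr>"

text \<open>
  HOL cannot quantify over all types inside a formula.  Whenever a notion refers to arbitrary
  modules, these range over the modules whose spaces are finite-dimensional subspaces of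
  \<open>nat \<Rightarrow> 'k\<close>.  Every finite-dimensional vector space is isomorphic to such a subspace, so every
  module is isomorphic to one of these.
\<close>

type_synonym ('p, 'k) urep = "('p, nat \<Rightarrow> 'k) rep"

abbreviation uscale :: "'k::field \<Rightarrow> (nat \<Rightarrow> 'k) \<Rightarrow> (nat \<Rightarrow> 'k)" where
  "uscale \<equiv> fun_scale (*)"

definition poset_interval :: "'p::order set \<Rightarrow> bool" where
  "poset_interval I \<longleftrightarrow>
     I \<noteq> {} \<and>
     (\<forall>x\<in>I. \<forall>y\<in>I. (x, y) \<in> {(a, b). a \<in> I \<and> b \<in> I \<and> (a \<le> b \<or> b \<le> a)}\<^sup>*) \<and>
     (\<forall>x\<in>I. \<forall>y\<in>I. \<forall>z. x \<le> z \<and> z \<le> y \<longrightarrow> z \<in> I)"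

definition intervals :: "'p::order set set" where
  "intervals = {I. poset_interval I}"

definition interval_rep :: "'p set \<Rightarrow> ('p, 'k::field) rep" where
  "interval_rep I =
     \<lparr>sp = (\<lambda>x. if x \<in> I then UNIV else {0}),
      tr = (\<lambda>x y v. if x \<in> I \<and> y \<in> I then v else 0)\<rparr>"

definition interval_decomposable ::
  "('k::field \<Rightarrow> 'v::ab_group_add \<Rightarrow> 'v) \<Rightarrow> ('p::order, 'v) rep \<Rightarrow> bool" where
  "interval_decomposable s M \<longleftrightarrow>
     (\<exists>Is. set Is \<subseteq> intervals \<and>
           rep_isomorphic s M uscale (dsum (map interval_rep Is)))"

definition indecomposable ::
  "('k::field \<Rightarrow> 'v::ab_group_add \<Rightarrow> 'v) \<Rightarrow> ('p::order, 'v) rep \<Rightarrow> bool" where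
  "indecomposable s N \<longleftrightarrow>
     \<not> zero_rep N \<and>
     (\<forall>X Y :: ('p, 'k) urep.
        is_rep uscale X \<and> is_rep uscale Y \<and> rep_isomorphic s N (fun_scale uscale) (dsum [X, Y])
        \<longrightarrow> zero_rep X \<or> zero_rep Y)"

definition indec_decomposition ::
  "('k::field \<Rightarrow> 'v::ab_group_add \<Rightarrow> 'v) \<Rightarrow> ('p::order, 'v) rep \<Rightarrow> ('p, 'k) urep list \<Rightarrow> bool" where
  "indec_decomposition s M Ns \<longleftrightarrow>
     (\<forall>N\<in>set Ns. is_rep uscale N \<and> indecomposable uscale N) \<and>
     rep_isomorphic s M (fun_scale uscale) (dsum Ns)"

text \<open>The multiplicity \<open>d\<^sub>M(L)\<close>; it is well defined by the Krull--Schmidt theorem.\<close>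

definition multiplicity_in ::
  "('k::field \<Rightarrow> 'v::ab_group_add \<Rightarrow> 'v) \<Rightarrow> ('p::order, 'v) rep \<Rightarrow>
   ('k \<Rightarrow> 'w::ab_group_add \<Rightarrow> 'w) \<Rightarrow> ('p, 'w) rep \<Rightarrow> nat" where
  "multiplicity_in s M t L =
     (THE m. \<exists>Ns. indec_decomposition s M Ns \<and>
                  m = length (filter (\<lambda>N. rep_isomorphic uscale N t L) Ns))"

abbreviation interval_mult ::
  "('k::field \<Rightarrow> 'v::ab_group_add \<Rightarrow> 'v) \<Rightarrow> ('p::order, 'v) rep \<Rightarrow> 'p set \<Rightarrow> nat" where
  "interval_mult s M I \<equiv> multiplicity_in s M ((*) :: 'k \<Rightarrow> 'k \<Rightarrow> 'k) (interval_rep I)"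

text \<open>
  A submodule is given by its family of subspaces; families are compared by the pointwise order
  on functions.
\<close>

definition subrep ::
  "('k::field \<Rightarrow> 'v::ab_group_add \<Rightarrow> 'v) \<Rightarrow> ('p::order, 'v) rep \<Rightarrow> ('p \<Rightarrow> 'v set) \<Rightarrow> bool" where
  "subrep s M X \<longleftrightarrow>
     (\<forall>x. module.subspace s (X x) \<and> X x \<subseteq> sp M x) \<and>
     (\<forall>x y. x \<le> y \<longrightarrow> tr M x y ` X x \<subseteq> X y)"

definition maximal_subrep ::
  "('k::field \<Rightarrow> 'v::ab_group_add \<Rightarrow> 'v) \<Rightarrow> ('p::order, 'v) rep \<Rightarrow> ('p \<Rightarrow> 'v set) \<Rightarrow> bool" where
  "maximal_subrep s M X \<longleftrightarrow>
     subrep s M X \<and> X \<noteq> sp M \<and> (\<forall>Y. subrep s M Y \<and> X \<le> Y \<longrightarrow> Y = X \<or> Y = sp M)"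

definition simple_subrep ::
  "('k::field \<Rightarrow> 'v::ab_group_add \<Rightarrow> 'v) \<Rightarrow> ('p::order, 'v) rep \<Rightarrow> ('p \<Rightarrow> 'v set) \<Rightarrow> bool" where
  "simple_subrep s M X \<longleftrightarrow>
     subrep s M X \<and> X \<noteq> (\<lambda>x. {0}) \<and>
     (\<forall>Y. subrep s M Y \<and> Y \<le> X \<longrightarrow> Y = (\<lambda>x. {0}) \<or> Y = X)"

definition rad ::
  "('k::field \<Rightarrow> 'v::ab_group_add \<Rightarrow> 'v) \<Rightarrow> ('p::order, 'v) rep \<Rightarrow> 'p \<Rightarrow> 'v set" where
  "rad s M = (\<lambda>x. {v \<in> sp M x. \<forall>X. maximal_subrep s M X \<longrightarrow> v \<in> X x})"

definition soc ::
  "('k::field \<Rightarrow> 'v::ab_group_add \<Rightarrow> 'v) \<Rightarrow> ('p::order, 'v) rep \<Rightarrow> ('p, 'v) rep" where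
  "soc s M = M\<lparr>sp := (\<lambda>x. module.span s (\<Union>X\<in>Collect (simple_subrep s M). X x))\<rparr>"

definition quot_rep :: "('p, 'v::plus) rep \<Rightarrow> ('p \<Rightarrow> 'v set) \<Rightarrow> ('p, 'v set) rep" where
  "quot_rep M X =
     \<lparr>sp = (\<lambda>x. (\<lambda>v. v +o X x) ` sp M x),
      tr = (\<lambda>x y C. tr M x y ` C + X y)\<rparr>"

definition top_rep ::
  "('k::field \<Rightarrow> 'v::ab_group_add \<Rightarrow> 'v) \<Rightarrow> ('p::order, 'v) rep \<Rightarrow> ('p, 'v set) rep" where
  "top_rep s M = quot_rep M (rad s M)"

text \<open>
  A vector space is nonzero iff it has two distinct elements.  This form also applies to a quotient,
  whose elements are cosets and whose zero is the submodule itself, not \<open>0 :: 'v set\<close>.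
\<close>

definition supp :: "('p, 'v) rep \<Rightarrow> 'p set" where
  "supp N = {x. \<exists>u\<in>sp N x. \<exists>v\<in>sp N x. u \<noteq> v}"

definition rep_projective ::
  "('k::field \<Rightarrow> 'v::ab_group_add \<Rightarrow> 'v) \<Rightarrow> ('p::order, 'v) rep \<Rightarrow> bool" where
  "rep_projective s P \<longleftrightarrow>
     (\<forall>(X :: ('p, 'k) urep) (Y :: ('p, 'k) urep) g f.
        is_rep uscale X \<and> is_rep uscale Y \<and>
        rep_hom uscale X uscale Y g \<and> rep_im X g = sp Y \<and> rep_hom s P uscale Y f
        \<longrightarrow> (\<exists>h. rep_hom s P uscale X h \<and> (\<forall>x. \<forall>v\<in>sp P x. g x (h x v) = f x v)))"

definition rep_injective ::
  "('k::field \<Rightarrow> 'v::ab_group_add \<Rightarrow> 'v) \<Rightarrow> ('p::order, 'v) rep \<Rightarrow> bool" where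
  "rep_injective s Q \<longleftrightarrow>
     (\<forall>(X :: ('p, 'k) urep) (Y :: ('p, 'k) urep) g f.
        is_rep uscale X \<and> is_rep uscale Y \<and>
        rep_hom uscale X uscale Y g \<and> rep_inj X g \<and> rep_hom uscale X s Q f
        \<longrightarrow> (\<exists>h. rep_hom uscale Y s Q h \<and> (\<forall>x. \<forall>v\<in>sp X x. h x (g x v) = f x v)))"

definition superfluous ::
  "('k::field \<Rightarrow> 'v::ab_group_add \<Rightarrow> 'v) \<Rightarrow> ('p::order, 'v) rep \<Rightarrow> ('p \<Rightarrow> 'v set) \<Rightarrow> bool" where
  "superfluous s M K \<longleftrightarrow>
     (\<forall>X. subrep s M X \<and> (\<forall>x. X x + K x = sp M x) \<longrightarrow> X = sp M)"

definition essential ::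
  "('k::field \<Rightarrow> 'v::ab_group_add \<Rightarrow> 'v) \<Rightarrow> ('p::order, 'v) rep \<Rightarrow> ('p \<Rightarrow> 'v set) \<Rightarrow> bool" where
  "essential s M K \<longleftrightarrow>
     (\<forall>X. subrep s M X \<and> (\<forall>x. X x \<inter> K x = {0}) \<longrightarrow> X = (\<lambda>x. {0}))"

text \<open>
  A minimal projective resolution is an exact sequence
  \<open>\<dots> \<rightarrow> P 1 \<rightarrow> P 0 \<rightarrow> N \<rightarrow> 0\<close> with augmentation \<open>e : P 0 \<rightarrow> N\<close> and differentials
  \<open>d j : P (j + 1) \<rightarrow> P j\<close>, in which every \<open>P j\<close> is a projective cover of the image of the map
  leaving it: \<open>P j\<close> is projective and the kernel of that map is superfluous.  Dually, in a minimal
  injective coresolution \<open>0 \<rightarrow> N \<rightarrow> Q 0 \<rightarrow> Q 1 \<rightarrow> \<dots>\<close> every \<open>Q j\<close> is an injective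
  envelope of the image of the map entering it.
\<close>

definition min_proj_res ::
  "('k::field \<Rightarrow> 'v::ab_group_add \<Rightarrow> 'v) \<Rightarrow> ('p::order, 'v) rep \<Rightarrow> (nat \<Rightarrow> ('p, 'k) urep) \<Rightarrow>
   ('p \<Rightarrow> (nat \<Rightarrow> 'k) \<Rightarrow> 'v) \<Rightarrow> (nat \<Rightarrow> 'p \<Rightarrow> (nat \<Rightarrow> 'k) \<Rightarrow> (nat \<Rightarrow> 'k)) \<Rightarrow> bool" where
  "min_proj_res s N P e d \<longleftrightarrow>
     (\<forall>j. is_rep uscale (P j) \<and> rep_projective uscale (P j)) \<and>
     rep_hom uscale (P 0) s N e \<and>
     (\<forall>j. rep_hom uscale (P (Suc j)) uscale (P j) (d j)) \<and>
     rep_im (P 0) e = sp N \<and>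
     rep_im (P 1) (d 0) = rep_ker (P 0) e \<and>
     (\<forall>j. rep_im (P (Suc (Suc j))) (d (Suc j)) = rep_ker (P (Suc j)) (d j)) \<and>
     superfluous uscale (P 0) (rep_ker (P 0) e) \<and>
     (\<forall>j. superfluous uscale (P (Suc j)) (rep_ker (P (Suc j)) (d j)))"

definition min_inj_cores ::
  "('k::field \<Rightarrow> 'v::ab_group_add \<Rightarrow> 'v) \<Rightarrow> ('p::order, 'v) rep \<Rightarrow> (nat \<Rightarrow> ('p, 'k) urep) \<Rightarrow>
   ('p \<Rightarrow> 'v \<Rightarrow> (nat \<Rightarrow> 'k)) \<Rightarrow> (nat \<Rightarrow> 'p \<Rightarrow> (nat \<Rightarrow> 'k) \<Rightarrow> (nat \<Rightarrow> 'k)) \<Rightarrow> bool" where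
  "min_inj_cores s N Q e d \<longleftrightarrow>
     (\<forall>j. is_rep uscale (Q j) \<and> rep_injective uscale (Q j)) \<and>
     rep_hom s N uscale (Q 0) e \<and>
     (\<forall>j. rep_hom uscale (Q j) uscale (Q (Suc j)) (d j)) \<and>
     rep_inj N e \<and>
     rep_ker (Q 0) (d 0) = rep_im N e \<and>
     (\<forall>j. rep_ker (Q (Suc j)) (d (Suc j)) = rep_im (Q j) (d j)) \<and>
     essential uscale (Q 0) (rep_im N e) \<and>
     (\<forall>j. essential uscale (Q (Suc j)) (rep_im (Q j) (d j)))"

text \<open>The terms \<open>P\<^sub>j(N)\<close> and \<open>Q\<^sup>j(N)\<close> of a chosen minimal (co)resolution.\<close>

definition proj_term ::
  "('k::field \<Rightarrow> 'v::ab_group_add \<Rightarrow> 'v) \<Rightarrow> ('p::order, 'v) rep \<Rightarrow> nat \<Rightarrow> ('p, 'k) urep" where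
  "proj_term s N = (SOME P. \<exists>e d. min_proj_res s N P e d)"

definition inj_term ::
  "('k::field \<Rightarrow> 'v::ab_group_add \<Rightarrow> 'v) \<Rightarrow> ('p::order, 'v) rep \<Rightarrow> nat \<Rightarrow> ('p, 'k) urep" where
  "inj_term s N = (SOME Q. \<exists>e d. min_inj_cores s N Q e d)"

definition crt1 ::
  "('k::field \<Rightarrow> 'v::ab_group_add \<Rightarrow> 'v) \<Rightarrow> ('p::order, 'v) rep \<Rightarrow> 'p set set" where
  "crt1 s M =
     {I \<in> intervals. \<forall>j\<in>{0, 1}.
        supp (top_rep uscale (proj_term ((*) :: 'k \<Rightarrow> 'k \<Rightarrow> 'k) (interval_rep I) j))
          \<subseteq> supp (top_rep uscale (proj_term s M j)) \<and>
        supp (soc uscale (inj_term ((*) :: 'k \<Rightarrow> 'k \<Rightarrow> 'k) (interval_rep I) j))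
          \<subseteq> supp (soc uscale (inj_term s M j))}"

end

theory Submission
  imports Defs
begin

text \<open>
  An interval module \<open>V\<^sub>I\<close> is a brick: its endomorphisms are scalars because \<open>I\<close> is connected.
  Hence a composite \<open>V\<^sub>I \<rightarrow> N \<rightarrow> V\<^sub>I\<close> through an indecomposable \<open>N\<close> not isomorphic to \<open>V\<^sub>I\<close>
  vanishes, and the multiplicity of \<open>V\<^sub>I\<close> in \<open>M\<close> is the rank of the composition pairing of
  \<open>Hom(V\<^sub>I, M)\<close> with \<open>Hom(M, V\<^sub>I)\<close>; no general Krull--Schmidt theorem is needed.  Comparing
  dimensions along one indecomposable decomposition shows that \<open>M\<close> is interval-decomposable iff the
  interval summands exhaust its total dimension.

  If \<open>V\<^sub>I\<close> is a summand of \<open>M\<close>, the inclusion and the projection lift to minimal resolutions, and by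
  minimality the composite is surjective on each term.  So \<open>P\<^sub>j(M)\<close> maps onto \<open>P\<^sub>j(V\<^sub>I)\<close> and,
  dually, \<open>Q\<^sup>j(V\<^sub>I)\<close> embeds into \<open>Q\<^sup>j(M)\<close>; surjections preserve radicals and
  injections preserve socles, hence \<open>I \<in> crt\<^sub>1(M)\<close>.  Restricting the sums to \<open>crt\<^sub>1(M)\<close> thus
  drops only zero terms.
\<close>

subsection \<open>Linear algebra on subspaces\<close>

text \<open>Two features of the encoding shape the argument. Maps are total functions that mean
  something only on subspaces, so splittings come from extending a map on a subspace to a globally
  linear one. And modules live on several carriers (the given one, \<open>'k\<close> for interval
  modules, functions on the poset for projectives and injectives), while
  \<open>indecomposable\<close>, \<open>rep_projective\<close> and \<open>rep_injective\<close> test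
  only against modules on \<open>nat \<Rightarrow> 'k\<close>. Copies on that carrier bridge the
  gap, and direct sums are handled through inclusions and projections (\<open>biprod\<close>), which
  fix no carrier. The multiplicity is a definite description and the terms of the resolutions are
  \<open>SOME\<close> choices. They carry information only once the count is known to be independent
  of the decomposition and a full minimal (co)resolution is known to exist; the comparison maps are
  then built in degrees 0 and 1 only. No uniqueness of minimal resolutions enters: whichever one was
  chosen, its endomorphisms over the identity are surjective in these degrees (injective for
  coresolutions).\<close>

lemma linear_between_in: "linear_between s V t W f \<Longrightarrow> v \<in> V \<Longrightarrow> f v \<in> W"
  by (auto simp: linear_between_def)

lemma linear_between_add:
  "linear_between s V t W f \<Longrightarrow> u \<in> V \<Longrightarrow> v \<in> V \<Longrightarrow> f (u + v) = f u + f v"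
  by (auto simp: linear_between_def)

lemma linear_between_scale: "linear_between s V t W f \<Longrightarrow> v \<in> V \<Longrightarrow> f (s c v) = t c (f v)"
  by (auto simp: linear_between_def)

lemma linear_between_zero: "linear_between s V t W f \<Longrightarrow> 0 \<in> V \<Longrightarrow> f 0 = 0"
  using linear_between_add[of s V t W f 0 0] by simp

lemma linear_betweenI:
  assumes "\<And>v. v \<in> V \<Longrightarrow> f v \<in> W"
    and "\<And>u v. u \<in> V \<Longrightarrow> v \<in> V \<Longrightarrow> f (u + v) = f u + f v"
    and "\<And>c v. v \<in> V \<Longrightarrow> f (s c v) = t c (f v)"
  shows "linear_between s V t W f"
  using assms by (auto simp: linear_between_def)

lemma linear_between_compose:
  "linear_between s V t W f \<Longrightarrow> linear_between t W u Z g \<Longrightarrow>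
   linear_between s V u Z (\<lambda>v. g (f v))" by (intro linear_betweenI)
    (auto simp: linear_between_add linear_between_scale linear_between_in)

lemma linear_between_cong:
  assumes "module.subspace s V" "vector_space s" "linear_between s V t W f" "\<And>v. v \<in> V \<Longrightarrow> g v = f v"
  shows "linear_between s V t W g"
proof -
  interpret vector_space s by fact
  show ?thesis by (intro linear_betweenI)
      (simp_all add: assms(4) subspace_add[OF assms(1)] subspace_scale[OF assms(1)]
        linear_between_in[OF assms(3)] linear_between_add[OF assms(3)] linear_between_scale[OF assms(3)])
qed

lemma linear_between_mono:
  "linear_between s V t W f \<Longrightarrow> V' \<subseteq> V \<Longrightarrow> f ` V' \<subseteq> W' \<Longrightarrow> linear_between s V' t W' f"
  unfolding linear_between_def by blast

lemma linear_between_diff: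
  assumes "vector_space s" "module.subspace s V" "linear_between s V t W f" "u \<in> V" "v \<in> V"
  shows "f (u - v) = f u - f v"
proof -
  interpret vector_space s by fact
  have "f (u - v + v) = f (u - v) + f v"
    using assms by (intro linear_between_add[OF assms(3)]) (auto intro: subspace_diff)
  then show ?thesis by simp
qed

lemma linear_between_sum:
  assumes "vector_space s" "module.subspace s V" "linear_between s V t W f" "\<And>i. i \<in> A \<Longrightarrow> g i \<in> V"
  shows "f (sum g A) = (\<Sum>i\<in>A. f (g i))"
proof -
  interpret vector_space s by fact
  have 0: "f 0 = 0" by (rule linear_between_zero[OF assms(3)]) (rule subspace_0[OF assms(2)])
  show ?thesis using assms(4) by (induction A rule: infinite_finite_induct)
      (auto simp: 0 linear_between_add[OF assms(3)] subspace_sum[OF assms(2)])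
qed

lemma linear_between_scale_fun:
  assumes "vector_space t" "module.subspace t W" "linear_between s V t W f"
  shows "linear_between s V t W (\<lambda>v. t c (f v))"
proof -
  interpret vector_space t by fact
  show ?thesis using assms(2,3) by (intro linear_betweenI)
      (auto simp: linear_between_add linear_between_scale linear_between_in subspace_scale
        scale_right_distrib scale_left_commute)
qed

lemma linear_between_diff_fun:
  assumes "vector_space t" "module.subspace t W" "linear_between s V t W f" "linear_between s V t W g"
  shows "linear_between s V t W (\<lambda>v. f v - g v)"
proof -
  interpret vector_space t by fact
  show ?thesis using assms(2-) by (intro linear_betweenI)
      (auto simp: linear_between_add[of _ _ _ _ f] linear_between_add[of _ _ _ _ g]
        linear_between_scale[of _ _ _ _ f] linear_between_scale[of _ _ _ _ g]
        linear_between_in subspace_diff scale_right_diff_distrib)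
qed

lemma linear_between_sum_fun:
  assumes "vector_space t" "module.subspace t W" "\<And>i. i \<in> A \<Longrightarrow> linear_between s V t W (f i)"
  shows "linear_between s V t W (\<lambda>v. \<Sum>i\<in>A. f i v)"
proof -
  interpret vector_space t by fact
  show ?thesis
  proof (rule linear_betweenI)
    show "(\<Sum>i\<in>A. f i v) \<in> W" if "v \<in> V" for v
      using that assms by (intro subspace_sum) (auto dest: linear_between_in)
    show "(\<Sum>i\<in>A. f i (u + v)) = (\<Sum>i\<in>A. f i u) + (\<Sum>i\<in>A. f i v)" if "u \<in> V" "v \<in> V" for u v
      using that by (auto simp: sum.distrib[symmetric] intro!: sum.cong linear_between_add[OF assms(3)])
    show "(\<Sum>i\<in>A. f i (s c v)) = t c (\<Sum>i\<in>A. f i v)" if "v \<in> V" for c v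
      using that by (auto simp: scale_sum_right intro!: sum.cong linear_between_scale[OF assms(3)])
  qed
qed

lemma linear_between_if_linear:
  assumes "Vector_Spaces.linear s t f" "f ` V \<subseteq> W"
  shows "linear_between s V t W f"
proof -
  interpret Vector_Spaces.linear s t f by fact
  show ?thesis using assms(2) by (auto simp: linear_between_def add scale)
qed

lemma linear_between_image_subspace:
  assumes "vector_space s" "vector_space t" "module.subspace s U" "U \<subseteq> V" "linear_between s V t W f"
  shows "module.subspace t (f ` U)"
proof -
  interpret s: vector_space s by fact
  interpret t: vector_space t by fact
  show ?thesis
  proof (rule t.subspaceI)
    show "0 \<in> f ` U"
      using assms s.subspace_0[of U] linear_between_zero[OF assms(5)] by (auto intro: rev_image_eqI)
    show "x + y \<in> f ` U" if xy: "x \<in> f ` U" "y \<in> f ` U" for x y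
    proof -
      from xy obtain u v where "u \<in> U" "v \<in> U" "x = f u" "y = f v" by blast
      then show ?thesis using assms by (intro image_eqI[of _ _ "u + v"])
          (auto intro: s.subspace_add simp: linear_between_add[OF assms(5)] subset_iff)
    qed
    show "t c x \<in> f ` U" if "x \<in> f ` U" for c x
    proof -
      from that obtain u where "u \<in> U" "x = f u" by blast
      then show ?thesis using assms by (intro image_eqI[of _ _ "s c u"])
          (auto intro: s.subspace_scale simp: linear_between_scale[OF assms(5)] subset_iff)
    qed
  qed
qed

lemma linear_between_vimage_subspace:
  assumes "vector_space s" "vector_space t" "module.subspace s V" "module.subspace t U"
    "linear_between s V t W f"
  shows "module.subspace s {v \<in> V. f v \<in> U}"
proof -
  interpret s: vector_space s by fact
  interpret t: vector_space t by fact
  show ?thesis using assms(3-) s.subspace_0[OF assms(3)] t.subspace_0[OF assms(4)]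
    by (intro s.subspaceI)
      (auto intro: s.subspace_add s.subspace_scale t.subspace_add t.subspace_scale
        simp: linear_between_add linear_between_scale linear_between_zero)
qed

lemma linear_between_kernel_subspace:
  assumes "vector_space s" "vector_space t" "module.subspace s V" "linear_between s V t W f"
  shows "module.subspace s {v \<in> V. f v = 0}"
proof -
  interpret t: vector_space t by fact
  show ?thesis
    using linear_between_vimage_subspace[OF assms(1,2,3) t.subspace_single_0 assms(4)] by simp
qed

text \<open>A basis of \<open>V\<close> is mapped by \<open>f\<close> and the remaining vectors of a
  basis of the whole space go to 0, so the range stays in \<open>W\<close>. This makes results about
  globally linear maps available for maps on subspaces.\<close>

lemma linear_between_extend:
  assumes "vector_space s" "vector_space t" "module.subspace s V" "module.subspace t W"
    "linear_between s V t W f"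
  obtains F where "Vector_Spaces.linear s t F" "\<And>v. v \<in> V \<Longrightarrow> F v = f v" "range F \<subseteq> W"
proof -
  interpret vector_space_pair s t using assms by (simp add: vector_space_pair_def)
  obtain B where B: "B \<subseteq> V" "vs1.independent B" "V \<subseteq> vs1.span B"
    using vs1.maximal_independent_subset .
  interpret F: Vector_Spaces.linear s t "construct B f" by (rule linear_construct[OF B(2)])
  have "construct B f v = f v" if "v \<in> V" for v
  proof -
    \<comment> \<open>The agreement set is cut down to \<open>V\<close> because \<open>f\<close> is
      additive only there; it is a subspace containing the basis \<open>B\<close>, hence all of
      \<open>V\<close>.\<close>
    have "vs1.subspace {v \<in> V. construct B f v = f v}"
    proof (rule vs1.subspaceI)
      show "0 \<in> {v \<in> V. construct B f v = f v}"
        using linear_between_zero[OF assms(5)] vs1.subspace_0[OF assms(3)] by auto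
    qed (use assms(3) in \<open>auto simp: F.add F.scale linear_between_add[OF assms(5)]
      linear_between_scale[OF assms(5)] intro: vs1.subspace_add vs1.subspace_scale\<close>)
    moreover have "B \<subseteq> {v \<in> V. construct B f v = f v}" using B construct_basis[OF B(2)] by auto
    ultimately have "vs1.span B \<subseteq> {v \<in> V. construct B f v = f v}" by (intro vs1.span_minimal)
    then show ?thesis using that B(3) by auto
  qed
  moreover have "range (construct B f) \<subseteq> W"
  proof -
    have "f ` B \<subseteq> W" using B(1) linear_between_in[OF assms(5)] by auto
    then show ?thesis using vs2.span_minimal[OF _ assms(4)] range_construct_eq_span[OF B(2)] by auto
  qed
  ultimately show ?thesis using that[of "construct B f"] F.linear_axioms by blast
qed

text \<open>The kernel of such a retraction, or the image of the identity minus it, serves below as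
  a complement of \<open>U\<close>. Tops and cokernels can thus be modelled without cosets.\<close>

lemma subspace_retraction:
  assumes "vector_space s" "module.subspace s U"
  obtains r where "Vector_Spaces.linear s s r" "\<And>u. u \<in> U \<Longrightarrow> r u = u" "range r \<subseteq> U"
proof -
  have "linear_between s U s U (\<lambda>v. v)" by (auto simp: linear_between_def)
  from linear_between_extend[OF assms(1,1,2,2) this] show ?thesis using that by blast
qed

lemma linear_between_section:
  assumes "vector_space s" "vector_space t" "module.subspace s V" "module.subspace t W"
    "linear_between s V t W g" "g ` V = W"
  obtains h where "linear_between t W s V h" "\<And>w. w \<in> W \<Longrightarrow> g (h w) = w"
proof -
  interpret vector_space_pair s t using assms by (simp add: vector_space_pair_def)
  obtain G where G: "Vector_Spaces.linear s t G" "\<And>v. v \<in> V \<Longrightarrow> G v = g v"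
    using linear_between_extend[OF assms(1-5)] by blast
  obtain h where h: "h ` UNIV \<subseteq> V" "Vector_Spaces.linear t s h" "\<And>v. v \<in> G ` V \<Longrightarrow> G (h v) = v"
    using linear_exists_right_inverse_on[OF G(1) assms(3)] by blast
  have "linear_between t W s V h" using h by (intro linear_between_if_linear) auto
  moreover have "g (h w) = w" if "w \<in> W" for w
    using that h G(2) assms(6) by (metis image_cong rangeI subset_iff)
  ultimately show ?thesis using that by blast
qed

lemma linear_between_left_inverse:
  assumes "vector_space s" "vector_space t" "module.subspace s V" "module.subspace t W"
    "linear_between s V t W g" "inj_on g V"
  obtains h where "linear_between t W s V h" "\<And>v. v \<in> V \<Longrightarrow> h (g v) = v"
proof -
  interpret vector_space_pair s t using assms by (simp add: vector_space_pair_def)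
  obtain G where G: "Vector_Spaces.linear s t G" "\<And>v. v \<in> V \<Longrightarrow> G v = g v"
    using linear_between_extend[OF assms(1-5)] by blast
  have "inj_on G V" using assms(6) G(2) by (simp add: inj_on_def)
  then obtain h where h: "h ` UNIV \<subseteq> V" "Vector_Spaces.linear t s h" "\<And>v. v \<in> V \<Longrightarrow> h (G v) = v"
    using linear_exists_left_inverse_on[OF G(1) assms(3)] by blast
  have "linear_between t W s V h" using h by (intro linear_between_if_linear) auto
  moreover have "h (g v) = v" if "v \<in> V" for v using that h G by metis
  ultimately show ?thesis using that by blast
qed

lemma linear_between_inj_onI:
  assumes "vector_space s" "module.subspace s V" "linear_between s V t W f"
    "\<And>v. v \<in> V \<Longrightarrow> f v = 0 \<Longrightarrow> v = 0"
  shows "inj_on f V"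
proof (rule inj_onI)
  interpret vector_space s by fact
  fix u v assume "u \<in> V" "v \<in> V" "f u = f v"
  then have "u - v = 0"
    using linear_between_diff[OF assms(1-3)] by (intro assms(4)) (auto intro: subspace_diff[OF assms(2)])
  then show "u = v" by simp
qed

lemma vector_space_fun_scale:
  assumes "vector_space s" shows "vector_space (fun_scale s)"
proof -
  interpret vector_space s by fact
  show ?thesis by unfold_locales
      (auto simp: fun_scale_def fun_eq_iff plus_fun_def scale_right_distrib scale_left_distrib)
qed

lemma vector_space_field: "vector_space ((*) :: 'k::field \<Rightarrow> 'k \<Rightarrow> 'k)"
  by unfold_locales (auto simp: algebra_simps)

lemma vector_space_uscale: "vector_space (uscale :: 'k::field \<Rightarrow> (nat \<Rightarrow> 'k) \<Rightarrow> nat \<Rightarrow> 'k)"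
  by (rule vector_space_fun_scale[OF vector_space_field])

section \<open>Finite-dimensional subspaces\<close>

lemma fin_dim_subspace_basis:
  assumes "vector_space s" "fin_dim_subspace s V"
  obtains B where "finite B" "\<not> module.dependent s B" "module.span s B = V"
proof -
  interpret vector_space s by fact
  obtain S where S: "finite S" "V = span S" "subspace V" using assms(2) by (auto simp: fin_dim_subspace_def)
  obtain B where B: "B \<subseteq> V" "independent B" "V \<subseteq> span B" using maximal_independent_subset .
  have "finite B" using independent_span_bound[OF S(1) B(2)] B S by auto
  moreover have "span B = V" using B S by (intro span_subspace) auto
  ultimately show ?thesis using that B by blast
qed

lemma fin_dim_subspace_subset:
  assumes "vector_space s" "fin_dim_subspace s V" "module.subspace s U" "U \<subseteq> V"
  shows "fin_dim_subspace s U"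
proof -
  interpret vector_space s by fact
  obtain S where S: "finite S" "V = span S" using assms(2) by (auto simp: fin_dim_subspace_def)
  obtain B where B: "B \<subseteq> U" "independent B" "U \<subseteq> span B" using maximal_independent_subset .
  have "finite B" using independent_span_bound[OF S(1) B(2)] B S assms(4) by auto
  moreover have "span B = U" using B assms(3) by (intro span_subspace) auto
  ultimately show ?thesis using assms(3) by (auto simp: fin_dim_subspace_def)
qed

lemma fin_dim_subspace_subspace: "fin_dim_subspace s V \<Longrightarrow> module.subspace s V"
  by (simp add: fin_dim_subspace_def)

lemma fin_dim_subspace_image:
  assumes "vector_space s" "vector_space t" "fin_dim_subspace s V" "module.subspace t W"
    "linear_between s V t W f"
  shows "fin_dim_subspace t (f ` V)"
proof -
  have sub: "module.subspace s V" using assms(3) by (rule fin_dim_subspace_subspace)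
  obtain F where F: "Vector_Spaces.linear s t F" "\<And>v. v \<in> V \<Longrightarrow> F v = f v"
    using linear_between_extend[OF assms(1,2) sub assms(4,5)] by blast
  interpret F: Vector_Spaces.linear s t F by fact
  obtain S where S: "finite S" "V = F.vs1.span S" using assms(3) by (auto simp: fin_dim_subspace_def)
  have "f ` V = F ` V" using F(2) by auto
  also have "\<dots> = F.vs2.span (F ` S)" unfolding S(2) by (rule F.span_image[symmetric])
  finally show ?thesis
    using linear_between_image_subspace[OF assms(1,2) sub subset_refl assms(5)] S(1)
    by (auto simp: fin_dim_subspace_def)
qed

lemma sum_fun_apply: "(\<Sum>i\<in>A. f i) x = (\<Sum>i\<in>A. f i x)"
  by (induction A rule: infinite_finite_induct) auto

lemma unit_vectors_independent:
  "\<not> module.dependent uscale ((\<lambda>i j. if j = i then 1 else (0::'k::field)) ` (A::nat set))"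
proof -
  interpret vector_space "uscale :: 'k \<Rightarrow> _" by (rule vector_space_uscale)
  define e :: "nat \<Rightarrow> nat \<Rightarrow> 'k" where "e = (\<lambda>i j. if j = i then 1 else 0)"
  have inj: "inj_on e X" for X by (rule inj_onI) (metis (full_types) e_def zero_neq_one)
  have "independent (e ` A)"
  proof -
    have "\<forall>S\<subseteq>e ` A. finite S \<longrightarrow> (\<forall>u. (\<Sum>v\<in>S. fun_scale (*) (u v) v) = 0 \<longrightarrow> (\<forall>v\<in>S. u v = 0))"
    proof (intro allI impI ballI)
      fix S u v
      assume S: "S \<subseteq> e ` A" "finite S" and 0: "(\<Sum>v\<in>S. fun_scale (*) (u v) v) = 0" and v: "v \<in> S"
      from S v obtain i where i: "v = e i" by auto
      have "0 = (\<Sum>w\<in>S. fun_scale (*) (u w) w) i" by (simp add: 0)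
      also have "\<dots> = (\<Sum>w\<in>S. u w * w i)" by (simp add: sum_fun_apply fun_scale_def)
      also have "\<dots> = (\<Sum>w\<in>S. if w = v then u v else 0)"
      proof (rule sum.cong)
        fix w assume "w \<in> S"
        then obtain j where j: "w = e j" using S by auto
        show "u w * w i = (if w = v then u v else 0)"
          using inj[of UNIV] by (auto simp: i j inj_eq) (auto simp: e_def)
      qed simp
      also have "\<dots> = u v" using S(2) v by simp
      finally show "u v = 0" by simp
    qed
    then show ?thesis unfolding independent_explicit_finite_subsets .
  qed
  then show ?thesis by (simp add: e_def)
qed

subsection \<open>Representations and direct sums\<close>

text \<open>A finite basis is numbered injectively by naturals and sent to the corresponding unit
  vectors; these are independent, so the linear extension is injective on the span.\<close>

lemma fin_dim_subspace_embed:
  fixes s :: "'k::field \<Rightarrow> 'v::ab_group_add \<Rightarrow> 'v"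
  assumes "vector_space s" "fin_dim_subspace s V"
  obtains \<phi> :: "'v \<Rightarrow> nat \<Rightarrow> 'k" where "Vector_Spaces.linear s uscale \<phi>" "inj_on \<phi> V"
proof -
  obtain B where B: "finite B" "\<not> module.dependent s B" "module.span s B = V"
    using fin_dim_subspace_basis[OF assms] .
  interpret vector_space_pair s "uscale :: 'k \<Rightarrow> _"
    using assms vector_space_uscale by (simp add: vector_space_pair_def)
  obtain h :: "'v \<Rightarrow> nat" where h: "inj_on h B" using B(1) finite_imp_inj_to_nat_seg by blast
  define e :: "nat \<Rightarrow> nat \<Rightarrow> 'k" where "e = (\<lambda>i j. if j = i then 1 else 0)"
  have e: "inj e" by (rule injI) (metis (full_types) e_def zero_neq_one)
  define \<phi> where "\<phi> = construct B (\<lambda>b. e (h b))"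
  interpret p: Vector_Spaces.linear s "uscale :: 'k \<Rightarrow> _" \<phi>
    unfolding \<phi>_def by (rule linear_construct[OF B(2)])
  have eq: "\<phi> b = e (h b)" if "b \<in> B" for b unfolding \<phi>_def by (rule construct_basis[OF B(2) that])
  have "inj_on \<phi> B" by (rule inj_onI) (metis eq h e inj_onD UNIV_I)
  moreover have "\<phi> ` B = e ` (h ` B)" using eq by auto
  then have "\<not> vs2.dependent (\<phi> ` B)"
    using unit_vectors_independent[of "h ` B"] by (simp add: e_def)
  ultimately have "inj_on \<phi> (vs1.span B)" by (rule p.inj_on_span_independent_image[rotated])
  then show ?thesis using that p.linear_axioms B(3) by blast
qed

text \<open>The families concentrated at one index, with value in a finite spanning set there, span
  everything. This gives finite dimension for \<open>free_rep\<close> and \<open>cofree_rep\<close>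
  at each vertex.\<close>

lemma fin_dim_subspace_functions:
  fixes W :: "'b::finite \<Rightarrow> 'v::ab_group_add set"
  assumes "vector_space s" "\<And>i. fin_dim_subspace s (W i)"
  shows "fin_dim_subspace (fun_scale s) {\<phi>. \<forall>i. \<phi> i \<in> W i}"
proof -
  interpret vector_space s by fact
  interpret F: vector_space "fun_scale s" by (rule vector_space_fun_scale) fact
  have "\<exists>B. finite B \<and> W i = span B" for i using assms(2) by (auto simp: fin_dim_subspace_def)
  then obtain B where B: "\<And>i. finite (B i)" "\<And>i. W i = span (B i)" by metis
  have sub: "subspace (W i)" for i using assms(2) by (rule fin_dim_subspace_subspace)
  define e where "e = (\<lambda>i (v::'v) (j::'b). if j = i then v else 0)"
  define S where "S = (\<Union>i. e i ` B i)"
  have lin: "Vector_Spaces.linear s (fun_scale s) (e i)" for i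
    by unfold_locales (auto simp: e_def fun_eq_iff fun_scale_def)
  have "{\<phi>. \<forall>i. \<phi> i \<in> W i} = F.span S"
  proof
    show "F.span S \<subseteq> {\<phi>. \<forall>i. \<phi> i \<in> W i}"
    proof (rule F.span_minimal)
      show "S \<subseteq> {\<phi>. \<forall>i. \<phi> i \<in> W i}" using sub by (auto simp: S_def e_def B(2) span_base subspace_0)
      show "F.subspace {\<phi>. \<forall>i. \<phi> i \<in> W i}"
        using sub by (intro F.subspaceI) (auto simp: subspace_0 subspace_add subspace_scale fun_scale_def)
    qed
    show "{\<phi>. \<forall>i. \<phi> i \<in> W i} \<subseteq> F.span S"
    proof
      fix \<phi> assume "\<phi> \<in> {\<phi>. \<forall>i. \<phi> i \<in> W i}"
      then have \<phi>: "\<phi> i \<in> span (B i)" for i by (auto simp: B(2))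
      have eq: "\<phi> = (\<Sum>i\<in>UNIV. e i (\<phi> i))" by (rule ext) (simp add: sum_fun_apply e_def)
      have "e i (\<phi> i) \<in> F.span S" for i
      proof -
        interpret l: Vector_Spaces.linear s "fun_scale s" "e i" by (rule lin)
        have "e i (\<phi> i) \<in> F.span (e i ` B i)" using \<phi>[of i] by (simp add: l.span_image)
        also have "\<dots> \<subseteq> F.span S" by (rule F.span_mono) (auto simp: S_def)
        finally show ?thesis .
      qed
      then show "\<phi> \<in> F.span S" by (subst eq) (rule F.span_sum)
    qed
  qed
  moreover have "finite S" using B(1) by (auto simp: S_def)
  ultimately show ?thesis unfolding fin_dim_subspace_def using F.subspace_span by metis
qed

lemma is_rep_subspace: "is_rep s M \<Longrightarrow> module.subspace s (sp M x)"
  by (auto simp: is_rep_def fin_dim_subspace_def)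

lemma is_rep_fin_dim: "is_rep s M \<Longrightarrow> fin_dim_subspace s (sp M x)"
  by (auto simp: is_rep_def)

lemma is_rep_linear: "is_rep s M \<Longrightarrow> x \<le> y \<Longrightarrow> linear_between s (sp M x) s (sp M y) (tr M x y)"
  by (auto simp: is_rep_def)

lemma is_rep_tr_refl: "is_rep s M \<Longrightarrow> v \<in> sp M x \<Longrightarrow> tr M x x v = v"
  by (auto simp: is_rep_def)

lemma is_rep_tr_trans:
  "is_rep s M \<Longrightarrow> x \<le> y \<Longrightarrow> y \<le> z \<Longrightarrow> v \<in> sp M x \<Longrightarrow> tr M y z (tr M x y v) = tr M x z v"
  by (auto simp: is_rep_def)

lemma is_rep_tr_in: "is_rep s M \<Longrightarrow> x \<le> y \<Longrightarrow> v \<in> sp M x \<Longrightarrow> tr M x y v \<in> sp M y"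
  by (rule linear_between_in[OF is_rep_linear])

lemma is_rep_0: "vector_space s \<Longrightarrow> is_rep s M \<Longrightarrow> 0 \<in> sp M x"
  using module.subspace_0[of s] is_rep_subspace by (auto simp: module_iff_vector_space)

lemma is_rep_tr_0: "vector_space s \<Longrightarrow> is_rep s M \<Longrightarrow> x \<le> y \<Longrightarrow> tr M x y 0 = 0"
  by (rule linear_between_zero[OF is_rep_linear is_rep_0])

lemma rep_hom_linear: "rep_hom s M t N f \<Longrightarrow> linear_between s (sp M x) t (sp N x) (f x)"
  by (auto simp: rep_hom_def)

lemma rep_hom_in: "rep_hom s M t N f \<Longrightarrow> v \<in> sp M x \<Longrightarrow> f x v \<in> sp N x"
  by (rule linear_between_in[OF rep_hom_linear])

lemma rep_hom_tr:
  "rep_hom s M t N f \<Longrightarrow> x \<le> y \<Longrightarrow> v \<in> sp M x \<Longrightarrow> f y (tr M x y v) = tr N x y (f x v)"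
  by (auto simp: rep_hom_def)

lemma rep_hom_0: "vector_space s \<Longrightarrow> is_rep s M \<Longrightarrow> rep_hom s M t N f \<Longrightarrow> f x 0 = 0"
  by (rule linear_between_zero[OF rep_hom_linear is_rep_0])

lemma rep_homI:
  assumes "\<And>x. linear_between s (sp M x) t (sp N x) (f x)"
    and "\<And>x y v. x \<le> y \<Longrightarrow> v \<in> sp M x \<Longrightarrow> f y (tr M x y v) = tr N x y (f x v)"
  shows "rep_hom s M t N f"
  using assms by (auto simp: rep_hom_def)

lemma rep_hom_compose:
  assumes "rep_hom s M t N f" "rep_hom t N u L g"
  shows "rep_hom s M u L (\<lambda>x v. g x (f x v))"
  by (rule rep_homI, rule linear_between_compose[OF rep_hom_linear[OF assms(1)] rep_hom_linear[OF assms(2)]])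
    (simp add: rep_hom_tr[OF assms(1)] rep_hom_tr[OF assms(2)] rep_hom_in[OF assms(1)])

lemma rep_hom_id: "rep_hom s M s M (\<lambda>x v. v)"
  by (intro rep_homI linear_betweenI) auto

lemma rep_hom_scale:
  assumes "vector_space t" "is_rep t N" "rep_hom s M t N f"
  shows "rep_hom s M t N (\<lambda>x v. t c (f x v))"
  by (intro rep_homI linear_between_scale_fun[OF assms(1) is_rep_subspace[OF assms(2)] rep_hom_linear[OF assms(3)]])
    (auto simp: rep_hom_tr[OF assms(3)] linear_between_scale[OF is_rep_linear[OF assms(2)]] rep_hom_in[OF assms(3)])

lemma rep_hom_diff:
  assumes "vector_space t" "is_rep t N" "rep_hom s M t N f" "rep_hom s M t N g"
  shows "rep_hom s M t N (\<lambda>x v. f x v - g x v)"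
  by (intro rep_homI linear_between_diff_fun[OF assms(1) is_rep_subspace[OF assms(2)]
      rep_hom_linear[OF assms(3)] rep_hom_linear[OF assms(4)]])
    (simp add: rep_hom_tr[OF assms(3)] rep_hom_tr[OF assms(4)] rep_hom_in[OF assms(3)] rep_hom_in[OF assms(4)]
      linear_between_diff[OF assms(1) is_rep_subspace[OF assms(2)] is_rep_linear[OF assms(2)]])

text \<open>Keeps the inverse as explicit data, so that isomorphisms can be composed and reversed
  without choosing preimages again.\<close>

definition iso_pair where
  "iso_pair s M t N f g \<longleftrightarrow> rep_hom s M t N f \<and> rep_hom t N s M g \<and>
     (\<forall>x. \<forall>v\<in>sp M x. g x (f x v) = v) \<and> (\<forall>x. \<forall>w\<in>sp N x. f x (g x w) = w)"

lemma iso_pair_rep_isomorphic: "iso_pair s M t N f g \<Longrightarrow> rep_isomorphic s M t N"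
  unfolding rep_isomorphic_def iso_pair_def
  by (intro exI[of _ f] conjI allI bij_betw_byWitness[of _ "g _"]) (auto intro: rep_hom_in)

lemma iso_pair_sym: "iso_pair s M t N f g \<Longrightarrow> iso_pair t N s M g f"
  by (auto simp: iso_pair_def)

lemma rep_isomorphic_iso_pair:
  assumes "vector_space s" "is_rep s M" "rep_isomorphic s M t N"
  obtains f g where "iso_pair s M t N f g"
proof -
  interpret vector_space s by fact
  obtain f where f: "rep_hom s M t N f" "\<And>x. bij_betw (f x) (sp M x) (sp N x)"
    using assms(3) by (auto simp: rep_isomorphic_def)
  define g where "g = (\<lambda>x. inv_into (sp M x) (f x))"
  have gf: "g x (f x v) = v" if "v \<in> sp M x" for x v
    using that f(2)[of x] by (simp add: g_def bij_betw_def)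
  have fg: "f x (g x w) = w" and g_in: "g x w \<in> sp M x" if "w \<in> sp N x" for x w
    using that f(2)[of x] by (auto simp: g_def bij_betw_def f_inv_into_f inv_into_into)
  note lf = rep_hom_linear[OF f(1)]
  have "rep_hom t N s M g"
  proof (intro rep_homI linear_betweenI)
    show "g x w \<in> sp M x" if "w \<in> sp N x" for x w using g_in that .
    show "g x (u + v) = g x u + g x v" if "u \<in> sp N x" "v \<in> sp N x" for x u v
      using that linear_between_add[OF lf g_in g_in, of u x v] gf[of "g x u + g x v" x]
      by (simp add: fg g_in subspace_add[OF is_rep_subspace[OF assms(2)]])
    show "g x (t c v) = s c (g x v)" if "v \<in> sp N x" for x c v
      using that linear_between_scale[OF lf g_in, of v x c] gf[of "s c (g x v)" x]
      by (simp add: fg g_in subspace_scale[OF is_rep_subspace[OF assms(2)]])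
    show "g y (tr N x y v) = tr M x y (g x v)" if "x \<le> y" "v \<in> sp N x" for x y v
      using that rep_hom_tr[OF f(1), of x y "g x v"] gf[of "tr M x y (g x v)" y]
      by (simp add: fg g_in is_rep_tr_in[OF assms(2)])
  qed
  then show ?thesis using f(1) gf fg by (intro that[of f g]) (simp add: iso_pair_def)
qed

lemma rep_isomorphic_sym:
  "vector_space s \<Longrightarrow> is_rep s M \<Longrightarrow> rep_isomorphic s M t N \<Longrightarrow> rep_isomorphic t N s M"
  by (meson rep_isomorphic_iso_pair iso_pair_sym iso_pair_rep_isomorphic)

lemma rep_isomorphic_trans:
  assumes "rep_isomorphic s M t N" "rep_isomorphic t N u L"
  shows "rep_isomorphic s M u L"
proof -
  obtain f where f: "rep_hom s M t N f" "\<And>x. bij_betw (f x) (sp M x) (sp N x)"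
    using assms(1) by (auto simp: rep_isomorphic_def)
  obtain g where g: "rep_hom t N u L g" "\<And>x. bij_betw (g x) (sp N x) (sp L x)"
    using assms(2) by (auto simp: rep_isomorphic_def)
  have "bij_betw (\<lambda>v. g x (f x v)) (sp M x) (sp L x)" for x
    using bij_betw_trans[OF f(2) g(2)] by (simp add: comp_def)
  then show ?thesis unfolding rep_isomorphic_def using rep_hom_compose[OF f(1) g(1)] by fastforce
qed

lemma is_rep_restrict:
  assumes "vector_space s" "is_rep s M" "subrep s M X"
  shows "is_rep s (M\<lparr>sp := X\<rparr>)"
proof -
  have X: "module.subspace s (X x)" "X x \<subseteq> sp M x" "x \<le> y \<Longrightarrow> tr M x y ` X x \<subseteq> X y" for x y
    using assms(3) by (auto simp: subrep_def)
  show ?thesis unfolding is_rep_def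
  proof (intro conjI allI impI ballI)
    show "fin_dim_subspace s (sp (M\<lparr>sp := X\<rparr>) x)" for x
      using fin_dim_subspace_subset[OF assms(1) is_rep_fin_dim[OF assms(2)] X(1,2)] by simp
    show "linear_between s (sp (M\<lparr>sp := X\<rparr>) x) s (sp (M\<lparr>sp := X\<rparr>) y) (tr (M\<lparr>sp := X\<rparr>) x y)"
      if "x \<le> y" for x y
      using linear_between_mono[OF is_rep_linear[OF assms(2) that] X(2) X(3)[OF that]] by simp
    show "tr (M\<lparr>sp := X\<rparr>) x x v = v" if "v \<in> sp (M\<lparr>sp := X\<rparr>) x" for x v
      using that X(2)[of x] is_rep_tr_refl[OF assms(2), of v x] by auto
    show "tr (M\<lparr>sp := X\<rparr>) x z v = tr (M\<lparr>sp := X\<rparr>) y z (tr (M\<lparr>sp := X\<rparr>) x y v)"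
      if "x \<le> y \<and> y \<le> z" "v \<in> sp (M\<lparr>sp := X\<rparr>) x" for x y z v
      using that X(2)[of x] is_rep_tr_trans[OF assms(2), of x y z v] by auto
  qed
qed

text \<open>The injections \<phi> at different vertices need not be related: the structure maps of
  the copy are obtained by conjugation.\<close>

lemma is_rep_transport:
  assumes "vector_space s" "vector_space t" "is_rep s M"
    and "\<And>x. Vector_Spaces.linear s t (\<phi> x)" "\<And>x. inj_on (\<phi> x) (sp M x)"
  obtains N f g where "is_rep t N" "iso_pair s M t N f g"
proof -
  define g where "g = (\<lambda>x. inv_into (sp M x) (\<phi> x))"
  have g\<phi>: "g x (\<phi> x v) = v" if "v \<in> sp M x" for x v using that assms(5) by (simp add: g_def)
  define N where "N = \<lparr>sp = (\<lambda>x. \<phi> x ` sp M x), tr = (\<lambda>x y w. \<phi> y (tr M x y (g x w)))\<rparr>"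
  have l: "linear_between s (sp M x) t (sp N x) (\<phi> x)" for x
    by (rule linear_between_if_linear[OF assms(4)]) (simp add: N_def)
  have iso: "rep_isomorphic s M t N" unfolding rep_isomorphic_def
    by (intro exI[of _ \<phi>] conjI rep_homI l) (auto simp: N_def g\<phi> bij_betw_def assms(5))
  \<comment> \<open>The homomorphic inverse \<open>g'\<close> is available before \<open>N\<close>
    is known to be a module; through it \<open>tr N x y\<close> becomes a composite of linear
    maps.\<close>
  obtain f g' where fg: "iso_pair s M t N f g'" using rep_isomorphic_iso_pair[OF assms(1,3) iso] .
  have "is_rep t N" unfolding is_rep_def
  proof (intro conjI allI impI ballI)
    show "fin_dim_subspace t (sp N x)" for x
    proof -
      interpret vector_space t by fact
      have "linear_between s (sp M x) t UNIV (\<phi> x)"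
        by (rule linear_between_if_linear[OF assms(4)]) auto
      then show ?thesis
        using fin_dim_subspace_image[OF assms(1,2) is_rep_fin_dim[OF assms(3)] subspace_UNIV]
        by (simp add: N_def)
    qed
    show "tr N x x v = v" if "v \<in> sp N x" for x v
      using that by (auto simp: N_def g\<phi> is_rep_tr_refl[OF assms(3)])
    show "tr N x z v = tr N y z (tr N x y v)" if "x \<le> y \<and> y \<le> z" "v \<in> sp N x" for x y z v
      using that by (auto simp: N_def g\<phi> is_rep_tr_trans[OF assms(3)] is_rep_tr_in[OF assms(3)])
    show "linear_between t (sp N x) t (sp N y) (tr N x y)" if "x \<le> y" for x y
    proof -
      have g': "rep_hom t N s M g'" "\<And>x w. w \<in> sp N x \<Longrightarrow> g' x w \<in> sp M x"
        and f: "\<And>x w. w \<in> sp N x \<Longrightarrow> f x (g' x w) = w" and hf: "rep_hom s M t N f"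
        using fg by (auto simp: iso_pair_def rep_hom_in)
      have "linear_between t (sp N x) t (sp N y) (\<lambda>w. f y (tr M x y (g' x w)))"
        by (rule linear_between_compose[OF linear_between_compose[OF rep_hom_linear[OF g'(1)]
          is_rep_linear[OF assms(3) that]] rep_hom_linear[OF hf]])
      moreover have "tr N x y w = f y (tr M x y (g' x w))" if "w \<in> sp N x" for w
        using rep_hom_tr[OF hf \<open>x \<le> y\<close> g'(2)[OF that]] f[OF that] by simp
      moreover have "module.subspace t (sp N x)"
        using linear_between_image_subspace[OF assms(1,2) is_rep_subspace[OF assms(3)] subset_refl l, of x]
        by (simp add: N_def)
      ultimately show ?thesis using linear_between_cong[OF _ assms(2)] by blast
    qed
  qed
  then show ?thesis using that fg by blast
qed

text \<open>Every module has an isomorphic copy on the carrier over which the definitions of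
  indecomposable, projective and injective quantify.\<close>

lemma ex_urep:
  fixes s :: "'k::field \<Rightarrow> 'v::ab_group_add \<Rightarrow> 'v" and M :: "('p::order, 'v) rep"
  assumes "vector_space s" "is_rep s M"
  obtains N :: "('p, 'k) urep" and f g where "is_rep uscale N" "iso_pair s M uscale N f g"
proof -
  have "\<exists>\<phi> :: 'v \<Rightarrow> nat \<Rightarrow> 'k. Vector_Spaces.linear s uscale \<phi> \<and> inj_on \<phi> (sp M x)" for x
    using fin_dim_subspace_embed[OF assms(1) is_rep_fin_dim[OF assms(2)]] by blast
  then obtain \<phi> :: "'p \<Rightarrow> 'v \<Rightarrow> nat \<Rightarrow> 'k"
    where "\<And>x. Vector_Spaces.linear s uscale (\<phi> x)" "\<And>x. inj_on (\<phi> x) (sp M x)" by metis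
  from is_rep_transport[OF assms(1) vector_space_uscale assms(2) this] show ?thesis using that .
qed

text \<open>The equational description of a direct sum: orthogonal inclusions and projections with
  \<Sum> \<open>i k \<circ> p k\<close> the identity. Unlike an isomorphism with
  \<open>dsum\<close>, it restricts to single summands and refines without changing the carrier of
  \<open>M\<close>.\<close>

definition biprod where
  "biprod s M t Ns i p \<longleftrightarrow>
     (\<forall>k<length Ns. rep_hom t (Ns ! k) s M (i k) \<and> rep_hom s M t (Ns ! k) (p k)) \<and>
     (\<forall>k<length Ns. \<forall>l<length Ns. \<forall>x. \<forall>v\<in>sp (Ns ! l) x. p k x (i l x v) = (if k = l then v else 0)) \<and>
     (\<forall>x. \<forall>v\<in>sp M x. (\<Sum>k<length Ns. i k x (p k x v)) = v)"

lemma biprod_of_iso: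
  fixes t :: "'k::field \<Rightarrow> 'w::ab_group_add \<Rightarrow> 'w"
  assumes "vector_space s" "is_rep s M" "vector_space t" "\<forall>N\<in>set Ns. is_rep t N"
    and "rep_isomorphic s M (fun_scale t) (dsum Ns)"
  obtains i p where "biprod s M t Ns i p"
proof -
  obtain f g where fg: "iso_pair s M (fun_scale t) (dsum Ns) f g"
    using rep_isomorphic_iso_pair[OF assms(1,2,5)] .
  then have hf: "rep_hom s M (fun_scale t) (dsum Ns) f" and hg: "rep_hom (fun_scale t) (dsum Ns) s M g"
    and gf: "\<And>x v. v \<in> sp M x \<Longrightarrow> g x (f x v) = v"
    and fgi: "\<And>x w. w \<in> sp (dsum Ns) x \<Longrightarrow> f x (g x w) = w"
    by (auto simp: iso_pair_def)
  define e where "e = (\<lambda>k w (j::nat). if j = k then w else (0::'w))"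
  have N: "is_rep t (Ns ! k)" if "k < length Ns" for k using assms(4) that by simp
  have 0: "0 \<in> sp (Ns ! k) x" if "k < length Ns" for k x by (rule is_rep_0[OF assms(3) N[OF that]])
  interpret t: vector_space t by fact
  interpret T: vector_space "fun_scale t" by (rule vector_space_fun_scale) fact
  have e_in: "e k w \<in> sp (dsum Ns) x" if "k < length Ns" "w \<in> sp (Ns ! k) x" for k w x
    using that 0 by (auto simp: dsum_def e_def)
  have e_add: "e k (u + v) = e k u + e k v" for k u v by (auto simp: e_def fun_eq_iff)
  have e_scale: "e k (t c v) = fun_scale t c (e k v)" for k c v by (auto simp: e_def fun_eq_iff fun_scale_def)
  define i where "i = (\<lambda>k x w. g x (e k w))"
  define p where "p = (\<lambda>k x v. f x v k)"
  have subD: "T.subspace (sp (dsum Ns) x)" for x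
    using t.subspace_0 t.subspace_add t.subspace_scale is_rep_subspace[OF N]
    by (intro T.subspaceI) (auto simp: dsum_def fun_scale_def)
  have "biprod s M t Ns i p" unfolding biprod_def
  proof (intro conjI allI impI ballI)
    fix k assume k: "k < length Ns"
    show "rep_hom s M t (Ns ! k) (p k)"
    proof (intro rep_homI linear_betweenI)
      show "p k x v \<in> sp (Ns ! k) x" if "v \<in> sp M x" for x v
        using rep_hom_in[OF hf that] k by (auto simp: dsum_def p_def)
    qed (use k in \<open>auto simp: p_def linear_between_add[OF rep_hom_linear[OF hf]]
      linear_between_scale[OF rep_hom_linear[OF hf]] fun_scale_def rep_hom_tr[OF hf] dsum_def\<close>)
    show "rep_hom t (Ns ! k) s M (i k)"
    proof (intro rep_homI linear_betweenI)
      show "i k x v \<in> sp M x" if "v \<in> sp (Ns ! k) x" for x v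
        using rep_hom_in[OF hg e_in[OF k that]] by (simp add: i_def)
      show "i k x (u + v) = i k x u + i k x v" if "u \<in> sp (Ns ! k) x" "v \<in> sp (Ns ! k) x" for x u v
        by (simp add: i_def e_add linear_between_add[OF rep_hom_linear[OF hg] e_in[OF k that(1)] e_in[OF k that(2)]])
      show "i k x (t c v) = s c (i k x v)" if "v \<in> sp (Ns ! k) x" for x c v
        by (simp add: i_def e_scale linear_between_scale[OF rep_hom_linear[OF hg] e_in[OF k that]])
      show "i k y (tr (Ns ! k) x y v) = tr M x y (i k x v)" if "x \<le> y" "v \<in> sp (Ns ! k) x" for x y v
      proof -
        have "e k (tr (Ns ! k) x y v) = tr (dsum Ns) x y (e k v)"
          using k is_rep_tr_0[OF assms(3) N that(1)] by (auto simp: e_def dsum_def fun_eq_iff)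
        then show ?thesis using rep_hom_tr[OF hg that(1) e_in[OF k that(2)]] by (simp add: i_def)
      qed
    qed
    show "p k x (i l x v) = (if k = l then v else 0)" if "l < length Ns" "v \<in> sp (Ns ! l) x" for l x v
      using fgi[OF e_in[OF that]] by (simp add: p_def i_def e_def)
  next
    fix x v assume v: "v \<in> sp M x"
    have fv: "f x v \<in> sp (dsum Ns) x" by (rule rep_hom_in[OF hf v])
    \<comment> \<open>Members of \<open>dsum Ns\<close> vanish from index \<open>length Ns\<close>
      on, so this finite sum recovers the whole family.\<close>
    have "f x v = (\<Sum>k<length Ns. e k (f x v k))"
      using fv by (auto simp: fun_eq_iff sum_fun_apply e_def dsum_def)
    then have "v = g x (\<Sum>k<length Ns. e k (f x v k))" using gf[OF v] by simp
    also have "\<dots> = (\<Sum>k<length Ns. i k x (p k x v))" unfolding i_def p_def using fv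
      by (intro linear_between_sum[OF T.vector_space_axioms subD rep_hom_linear[OF hg]] e_in) (auto simp: dsum_def)
    finally show "(\<Sum>k<length Ns. i k x (p k x v)) = v" by simp
  qed
  then show ?thesis using that by blast
qed

lemma iso_of_biprod:
  assumes "vector_space s" "is_rep s M" "vector_space t" "biprod s M t Ns i p"
  shows "rep_isomorphic s M (fun_scale t) (dsum Ns)"
proof -
  have hi: "\<And>k. k < length Ns \<Longrightarrow> rep_hom t (Ns ! k) s M (i k)"
    and hp: "\<And>k. k < length Ns \<Longrightarrow> rep_hom s M t (Ns ! k) (p k)"
    and pi: "\<And>k l x v. k < length Ns \<Longrightarrow> l < length Ns \<Longrightarrow> v \<in> sp (Ns ! l) x \<Longrightarrow>
      p k x (i l x v) = (if k = l then v else 0)"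
    and ip: "\<And>x v. v \<in> sp M x \<Longrightarrow> (\<Sum>k<length Ns. i k x (p k x v)) = v"
    using assms(4) by (auto simp: biprod_def)
  interpret s: vector_space s by fact
  interpret t: vector_space t by fact
  define f where "f = (\<lambda>x v k. if k < length Ns then p k x v else 0)"
  define g where "g = (\<lambda>x \<phi>. \<Sum>k<length Ns. i k x (\<phi> k))"
  have hf: "rep_hom s M (fun_scale t) (dsum Ns) f" by (intro rep_homI linear_betweenI)
      (auto simp: f_def dsum_def fun_eq_iff fun_scale_def rep_hom_in[OF hp] rep_hom_tr[OF hp]
        linear_between_add[OF rep_hom_linear[OF hp]] linear_between_scale[OF rep_hom_linear[OF hp]])
  have "bij_betw (f x) (sp M x) (sp (dsum Ns) x)" for x
  proof (rule bij_betw_byWitness[of _ "g x"])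
    show "\<forall>v\<in>sp M x. g x (f x v) = v" by (simp add: f_def g_def ip)
    show "f x ` sp M x \<subseteq> sp (dsum Ns) x" using rep_hom_in[OF hf] by auto
    have gi: "i k x (\<phi> k) \<in> sp M x" if "\<phi> \<in> sp (dsum Ns) x" "k < length Ns" for \<phi> k
      using that by (intro rep_hom_in[OF hi]) (auto simp: dsum_def)
    show "g x ` sp (dsum Ns) x \<subseteq> sp M x"
      using gi by (auto simp: g_def intro!: s.subspace_sum[OF is_rep_subspace[OF assms(2)]])
    show "\<forall>\<phi>\<in>sp (dsum Ns) x. f x (g x \<phi>) = \<phi>"
    proof
      fix \<phi> assume \<phi>: "\<phi> \<in> sp (dsum Ns) x"
      have "p k x (g x \<phi>) = \<phi> k" if k: "k < length Ns" for k
      proof -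
        have "p k x (g x \<phi>) = (\<Sum>l<length Ns. p k x (i l x (\<phi> l)))" unfolding g_def using gi[OF \<phi>]
          by (intro linear_between_sum[OF assms(1) is_rep_subspace[OF assms(2)] rep_hom_linear[OF hp[OF k]]]) auto
        also have "\<dots> = (\<Sum>l<length Ns. if k = l then \<phi> l else 0)"
          using \<phi> k by (intro sum.cong) (auto simp: pi dsum_def)
        finally show ?thesis using k by simp
      qed
      then show "f x (g x \<phi>) = \<phi>" using \<phi> by (auto simp: f_def fun_eq_iff dsum_def)
    qed
  qed
  then show ?thesis unfolding rep_isomorphic_def using hf by blast
qed

text \<open>Summands are exchanged for isomorphic copies on another carrier. The condition on
  \<open>\<phi> k x 0\<close> settles the off-diagonal composites, where \<phi> is applied to
  0.\<close>

lemma biprod_map_iso: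
  assumes "biprod s M t Ns i p" "length Ns' = length Ns"
    and iso: "\<And>k. k < length Ns \<Longrightarrow> iso_pair t (Ns ! k) u (Ns' ! k) (\<phi> k) (\<psi> k)"
    and p0: "\<And>k x. k < length Ns \<Longrightarrow> \<phi> k x 0 = 0"
  shows "biprod s M u Ns' (\<lambda>k x v. i k x (\<psi> k x v)) (\<lambda>k x v. \<phi> k x (p k x v))"
proof -
  have h: "\<And>k. k < length Ns \<Longrightarrow> rep_hom t (Ns ! k) u (Ns' ! k) (\<phi> k)"
    "\<And>k. k < length Ns \<Longrightarrow> rep_hom u (Ns' ! k) t (Ns ! k) (\<psi> k)"
    and inv: "\<And>k x v. k < length Ns \<Longrightarrow> v \<in> sp (Ns ! k) x \<Longrightarrow> \<psi> k x (\<phi> k x v) = v"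
    "\<And>k x v. k < length Ns \<Longrightarrow> v \<in> sp (Ns' ! k) x \<Longrightarrow> \<phi> k x (\<psi> k x v) = v"
    using iso by (auto simp: iso_pair_def)
  have hp: "\<And>k. k < length Ns \<Longrightarrow> rep_hom s M t (Ns ! k) (p k)"
    using assms(1) by (simp add: biprod_def)
  have sum: "(\<Sum>k<length Ns. i k x (\<psi> k x (\<phi> k x (p k x v)))) = v" if "v \<in> sp M x" for x v
  proof -
    have "(\<Sum>k<length Ns. i k x (\<psi> k x (\<phi> k x (p k x v)))) = (\<Sum>k<length Ns. i k x (p k x v))"
      using that by (intro sum.cong) (auto simp: inv rep_hom_in[OF hp])
    then show ?thesis using assms(1) that by (simp add: biprod_def)
  qed
  show ?thesis using assms(1,2) unfolding biprod_def by (auto simp: inv p0 sum rep_hom_in[OF h(2)]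
        intro!: rep_hom_compose[OF _ h(1)] rep_hom_compose[OF h(2)])
qed

subsection \<open>Dimensions and indecomposable decompositions\<close>

text \<open>Bases of the summands at \<open>x\<close>, pushed forward by the inclusions, are
  pairwise disjoint and together form a basis of \<open>sp M x\<close>.\<close>

lemma dim_vec_biprod:
  assumes "vector_space s" "is_rep s M" "vector_space t" "\<forall>N\<in>set Ns. is_rep t N" "biprod s M t Ns i p"
  shows "dim_vec s M x = (\<Sum>k<length Ns. dim_vec t (Ns ! k) x)"
proof -
  interpret s: vector_space s by fact
  interpret t: vector_space t by fact
  let ?n = "length Ns"
  have N: "\<And>k. k < ?n \<Longrightarrow> is_rep t (Ns ! k)" using assms(4) by simp
  have hi: "\<And>k. k < ?n \<Longrightarrow> rep_hom t (Ns ! k) s M (i k)"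
    and hp: "\<And>k. k < ?n \<Longrightarrow> rep_hom s M t (Ns ! k) (p k)"
    and pi: "\<And>k l x v. k < ?n \<Longrightarrow> l < ?n \<Longrightarrow> v \<in> sp (Ns ! l) x \<Longrightarrow>
      p k x (i l x v) = (if k = l then v else 0)"
    and ip: "\<And>x v. v \<in> sp M x \<Longrightarrow> (\<Sum>k<?n. i k x (p k x v)) = v"
    using assms(5) by (auto simp: biprod_def)
  have "\<exists>B. finite B \<and> t.independent B \<and> t.span B = sp (Ns ! k) x" if "k < ?n" for k
    using fin_dim_subspace_basis[OF assms(3) is_rep_fin_dim[OF N[OF that]]] by metis
  then obtain B where B: "\<And>k. k < ?n \<Longrightarrow> finite (B k)" "\<And>k. k < ?n \<Longrightarrow> t.independent (B k)"
    "\<And>k. k < ?n \<Longrightarrow> t.span (B k) = sp (Ns ! k) x" by metis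
  have BN: "b \<in> sp (Ns ! k) x" if "k < ?n" "b \<in> B k" for k b
    using B(3)[OF that(1)] that(2) t.span_base by auto
  have pB: "p k x (i l x b) = (if k = l then b else 0)" if "k < ?n" "l < ?n" "b \<in> B l" for k l b
    by (rule pi[OF that(1,2) BN[OF that(2,3)]])
  have B0: "0 \<notin> B k" if "k < ?n" for k using B(2)[OF that] t.dependent_zero by blast
  have inj: "inj_on (i k x) (B k)" if "k < ?n" for k using pB[OF that that] by (metis inj_onI)
  define E where "E = (\<Union>k<?n. i k x ` B k)"
  \<comment> \<open>\<open>p k x\<close> fixes the basis vectors behind block \<open>k\<close> and
    kills block \<open>l\<close>; a common vector would therefore put 0 into the basis
    \<open>B k\<close>.\<close>
  have disj: "i k x ` B k \<inter> i l x ` B l = {}" if "k < ?n" "l < ?n" "k \<noteq> l" for k l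
    using pB[OF that(1)] B0[OF that(1)] that by (auto dest!: arg_cong[of _ _ "p k x"])
  have fE: "finite E" using B(1) by (simp add: E_def)
  have "card E = (\<Sum>k<?n. card (i k x ` B k))"
    unfolding E_def using B(1) disj by (intro card_UN_disjoint) auto
  also have "\<dots> = (\<Sum>k<?n. dim_vec t (Ns ! k) x)"
  proof (intro sum.cong refl)
    fix k assume "k \<in> {..<?n}"
    then show "card (i k x ` B k) = dim_vec t (Ns ! k) x"
      using card_image[OF inj] t.dim_span_eq_card_independent[OF B(2)] B(3) by (auto simp: dim_vec_def)
  qed
  finally have card: "card E = (\<Sum>k<?n. dim_vec t (Ns ! k) x)" .
  have iM: "i k x b \<in> sp M x" if "k < ?n" "b \<in> B k" for k b using rep_hom_in[OF hi] BN that by blast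
  have EM: "E \<subseteq> sp M x" using iM by (auto simp: E_def)
  have subM: "s.subspace (sp M x)" by (rule is_rep_subspace) fact
  have "s.independent E"
  proof (rule s.independent_if_scalars_zero[OF fE])
    fix f e assume 0: "(\<Sum>e\<in>E. s (f e) e) = 0" and "e \<in> E"
    then obtain k b where k: "k < ?n" "b \<in> B k" "e = i k x b" by (auto simp: E_def)
    note lp = rep_hom_linear[OF hp[OF k(1)], of x]
    \<comment> \<open>Projecting the relation to the \<open>k\<close>-th summand removes all other
      blocks and leaves a relation among the vectors of \<open>B k\<close>.\<close>
    have "0 = p k x (\<Sum>e\<in>E. s (f e) e)"
      unfolding 0 using linear_between_zero[OF lp] s.subspace_0[OF subM] by simp
    also have "\<dots> = (\<Sum>e\<in>E. p k x (s (f e) e))"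
      using EM by (intro linear_between_sum[OF assms(1) subM lp] s.subspace_scale[OF subM]) auto
    also have "\<dots> = (\<Sum>e\<in>E. t (f e) (p k x e))"
      using EM by (intro sum.cong refl linear_between_scale[OF lp]) auto
    also have "\<dots> = (\<Sum>e\<in>i k x ` B k. t (f e) (p k x e))"
      using k pB[OF k(1)] by (intro sum.mono_neutral_right fE) (auto simp: E_def split: if_splits)
    also have "\<dots> = (\<Sum>b\<in>B k. t (f (i k x b)) b)"
      using pB[OF k(1) k(1)] by (subst sum.reindex[OF inj[OF k(1)]]) auto
    finally have "(\<Sum>b\<in>B k. t (f (i k x b)) b) = 0" by simp
    then show "f e = 0"
      using t.independentD[OF B(2)[OF k(1)] B(1)[OF k(1)] subset_refl _ k(2)] k(3) by simp
  qed
  moreover have "sp M x \<subseteq> s.span E"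
  proof
    fix v assume v: "v \<in> sp M x"
    have "i k x w \<in> s.span E" if k: "k < ?n" and w: "w \<in> sp (Ns ! k) x" for k w
    proof -
      have "t.span (B k) \<subseteq> {w \<in> sp (Ns ! k) x. i k x w \<in> s.span E}" using BN[OF k] k
        by (intro t.span_minimal linear_between_vimage_subspace[OF assms(3,1) is_rep_subspace[OF N[OF k]]
          s.subspace_span rep_hom_linear[OF hi[OF k]]]) (auto simp: E_def intro: s.span_base)
      then show ?thesis using w B(3)[OF k] by auto
    qed
    then have "(\<Sum>k<?n. i k x (p k x v)) \<in> s.span E"
      using rep_hom_in[OF hp v] by (intro s.span_sum) auto
    then show "v \<in> s.span E" by (simp add: ip[OF v])
  qed
  ultimately show ?thesis using s.basis_card_eq_dim[OF EM] card by (simp add: dim_vec_def)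
qed

text \<open>Treating an isomorphism as a biproduct with one term yields invariance of dimensions
  from \<open>dim_vec_biprod\<close>.\<close>

lemma biprod_single: "iso_pair s M t N f g \<Longrightarrow> biprod s M t [N] (\<lambda>_. g) (\<lambda>_. f)"
  by (simp add: biprod_def iso_pair_def)

lemma dim_vec_iso:
  assumes "vector_space s" "is_rep s M" "vector_space t" "is_rep t N" "rep_isomorphic s M t N"
  shows "dim_vec s M x = dim_vec t N x"
proof -
  obtain f g where "iso_pair s M t N f g" using rep_isomorphic_iso_pair[OF assms(1,2,5)] .
  from dim_vec_biprod[OF assms(1-3) _ biprod_single[OF this], of x] assms(4) show ?thesis by simp
qed

lemma total_dim_iso:
  assumes "vector_space s" "is_rep s M" "vector_space t" "is_rep t N" "rep_isomorphic s M t N"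
  shows "total_dim s M = total_dim t N"
  unfolding total_dim_def by (intro sum.cong dim_vec_iso[OF assms] refl)

lemma total_dim_biprod:
  assumes "vector_space s" "is_rep s M" "vector_space t" "\<forall>N\<in>set Ns. is_rep t N" "biprod s M t Ns i p"
  shows "total_dim s M = (\<Sum>k<length Ns. total_dim t (Ns ! k))"
  unfolding total_dim_def by (simp add: dim_vec_biprod[OF assms] sum.swap[of _ "{..<length Ns}"])

lemma total_dim_pos:
  assumes "vector_space s" "is_rep s M" "\<not> zero_rep M"
  shows "0 < total_dim s M"
proof (rule ccontr)
  interpret vector_space s by fact
  assume "\<not> 0 < total_dim s M"
  then have 0: "dim (sp M x) = 0" for x by (simp add: total_dim_def dim_vec_def)
  have "sp M x = {0}" for x
  proof -
    obtain B where B: "finite B" "independent B" "span B = sp M x"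
      using fin_dim_subspace_basis[OF assms(1) is_rep_fin_dim[OF assms(2)]] .
    then have "card B = 0" using dim_span_eq_card_independent[OF B(2)] 0[of x] by simp
    then show ?thesis using B by simp
  qed
  then show False using assms(3) by (simp add: zero_rep_def)
qed

lemma zero_rep_iso:
  assumes "vector_space s" "is_rep s M" "vector_space t" "is_rep t N" "rep_isomorphic s M t N" "zero_rep M"
  shows "zero_rep N"
proof -
  obtain f g where "iso_pair s M t N f g" using rep_isomorphic_iso_pair[OF assms(1,2,5)] .
  then have fg: "rep_hom s M t N f" "\<And>x w. w \<in> sp N x \<Longrightarrow> f x (g x w) = w"
    "\<And>x w. w \<in> sp N x \<Longrightarrow> g x w \<in> sp M x" by (auto simp: iso_pair_def rep_hom_in)
  have "w = 0" if "w \<in> sp N x" for w x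
    using fg(2,3)[OF that] assms(6) rep_hom_0[OF assms(1,2) fg(1), of x] by (simp add: zero_rep_def)
  then show ?thesis using is_rep_0[OF assms(3,4)] by (auto simp: zero_rep_def)
qed

lemma indecomposable_iso:
  fixes s :: "'k::field \<Rightarrow> 'v::ab_group_add \<Rightarrow> 'v" and t :: "'k \<Rightarrow> 'w::ab_group_add \<Rightarrow> 'w"
  assumes "vector_space s" "is_rep s M" "vector_space t" "is_rep t N" "rep_isomorphic s M t N"
    and "indecomposable s M"
  shows "indecomposable t N"
proof -
  have "\<not> zero_rep N"
    using zero_rep_iso[OF assms(3,4,1,2) rep_isomorphic_sym[OF assms(1,2,5)]] assms(6)
    by (auto simp: indecomposable_def)
  then show ?thesis
    using assms(6) rep_isomorphic_trans[OF assms(5)] unfolding indecomposable_def by blast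
qed

section \<open>Existence of decompositions into indecomposables\<close>

lemma sum_lessThan_add:
  "(\<Sum>k<n + m. f k) = (\<Sum>k<n. f k) + (\<Sum>k<m. f (n + k) :: 'a::comm_monoid_add)" for n m :: nat
  by (induction m) (simp_all add: add.assoc)

text \<open>Both terms of a two-term biproduct are decomposed further. Composites between pieces of
  different halves vanish since they pass through \<open>p 0\<close> after \<open>i 1\<close> or
  \<open>p 1\<close> after \<open>i 0\<close>.\<close>

lemma biprod_append:
  assumes "vector_space s" "is_rep s M" "vector_space t" "is_rep t X" "is_rep t Y"
    and u: "vector_space u" "\<forall>N\<in>set (Ns1 @ Ns2). is_rep u N"
    and b: "biprod s M t [X, Y] i p" "biprod t X u Ns1 i1 p1" "biprod t Y u Ns2 i2 p2"
  shows "\<exists>i' p'. biprod s M u (Ns1 @ Ns2) i' p'"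
proof -
  let ?n = "length Ns1" and ?m = "length Ns2"
  have h: "rep_hom t X s M (i 0)" "rep_hom t Y s M (i 1)" "rep_hom s M t X (p 0)" "rep_hom s M t Y (p 1)"
    and pi: "\<And>x v. v \<in> sp X x \<Longrightarrow> p 0 x (i 0 x v) = v" "\<And>x v. v \<in> sp X x \<Longrightarrow> p 1 x (i 0 x v) = 0"
      "\<And>x v. v \<in> sp Y x \<Longrightarrow> p 1 x (i 1 x v) = v" "\<And>x v. v \<in> sp Y x \<Longrightarrow> p 0 x (i 1 x v) = 0"
    and ip: "\<And>x v. v \<in> sp M x \<Longrightarrow> i 0 x (p 0 x v) + i 1 x (p 1 x v) = v"
    using b(1) by (auto simp: biprod_def less_Suc_eq numeral_2_eq_2 all_conj_distrib)
  have h1: "\<And>k. k < ?n \<Longrightarrow> rep_hom u (Ns1 ! k) t X (i1 k)" "\<And>k. k < ?n \<Longrightarrow> rep_hom t X u (Ns1 ! k) (p1 k)"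
    and h2: "\<And>k. k < ?m \<Longrightarrow> rep_hom u (Ns2 ! k) t Y (i2 k)" "\<And>k. k < ?m \<Longrightarrow> rep_hom t Y u (Ns2 ! k) (p2 k)"
    and pi1: "\<And>k l x v. k < ?n \<Longrightarrow> l < ?n \<Longrightarrow> v \<in> sp (Ns1 ! l) x \<Longrightarrow> p1 k x (i1 l x v) = (if k = l then v else 0)"
    and pi2: "\<And>k l x v. k < ?m \<Longrightarrow> l < ?m \<Longrightarrow> v \<in> sp (Ns2 ! l) x \<Longrightarrow> p2 k x (i2 l x v) = (if k = l then v else 0)"
    and ip1: "\<And>x v. v \<in> sp X x \<Longrightarrow> (\<Sum>k<?n. i1 k x (p1 k x v)) = v"
    and ip2: "\<And>x v. v \<in> sp Y x \<Longrightarrow> (\<Sum>k<?m. i2 k x (p2 k x v)) = v"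
    using b(2,3) by (auto simp: biprod_def)
  define i' where "i' = (\<lambda>k x v. if k < ?n then i 0 x (i1 k x v) else i 1 x (i2 (k - ?n) x v))"
  define p' where "p' = (\<lambda>k x v. if k < ?n then p1 k x (p 0 x v) else p2 (k - ?n) x (p 1 x v))"
  \<comment> \<open>The mixed composites end as a projection of the second stage applied to
    0.\<close>
  have p10: "p1 k x 0 = 0" if "k < ?n" for k x by (rule rep_hom_0[OF assms(3,4) h1(2)[OF that]])
  have p20: "p2 k x 0 = 0" if "k < ?m" for k x by (rule rep_hom_0[OF assms(3,5) h2(2)[OF that]])
  have "biprod s M u (Ns1 @ Ns2) i' p'" unfolding biprod_def
  proof (intro conjI allI impI ballI)
    fix k assume k: "k < length (Ns1 @ Ns2)"
    show "rep_hom u ((Ns1 @ Ns2) ! k) s M (i' k)"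
    proof (cases "k < ?n")
      case True
      then show ?thesis using rep_hom_compose[OF h1(1)[OF True] h(1)] by (simp add: i'_def nth_append)
    next
      case False
      then have "k - ?n < ?m" using k by auto
      then show ?thesis using False rep_hom_compose[OF h2(1) h(2)] by (simp add: i'_def nth_append)
    qed
    show "rep_hom s M u ((Ns1 @ Ns2) ! k) (p' k)"
    proof (cases "k < ?n")
      case True
      then show ?thesis using rep_hom_compose[OF h(3) h1(2)[OF True]] by (simp add: p'_def nth_append)
    next
      case False
      then have "k - ?n < ?m" using k by auto
      then show ?thesis using False rep_hom_compose[OF h(4) h2(2)] by (simp add: p'_def nth_append)
    qed
    show "p' k x (i' l x v) = (if k = l then v else 0)"
      if l: "l < length (Ns1 @ Ns2)" and v: "v \<in> sp ((Ns1 @ Ns2) ! l) x" for l x v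
    proof (cases "l < ?n")
      case True
      then have v: "v \<in> sp (Ns1 ! l) x" using v by (simp add: nth_append)
      have "i1 l x v \<in> sp X x" by (rule rep_hom_in[OF h1(1)[OF True] v])
      then show ?thesis using True k pi(1,2) pi1[OF _ True v] p20 by (auto simp: p'_def i'_def)
    next
      case False
      then have l': "l - ?n < ?m" and v: "v \<in> sp (Ns2 ! (l - ?n)) x" using v l by (auto simp: nth_append)
      have "i2 (l - ?n) x v \<in> sp Y x" by (rule rep_hom_in[OF h2(1)[OF l'] v])
      moreover have "k - ?n < ?m" if "\<not> k < ?n" using that k by auto
      ultimately show ?thesis using False k pi(3,4) pi2[OF _ l' v] p10 by (auto simp: p'_def i'_def)
    qed
  next
    fix x v assume v: "v \<in> sp M x"
    have X: "p 0 x v \<in> sp X x" and Y: "p 1 x v \<in> sp Y x" using rep_hom_in[OF h(3) v] rep_hom_in[OF h(4) v] by auto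
    have "(\<Sum>k<length (Ns1 @ Ns2). i' k x (p' k x v)) =
        (\<Sum>k<?n. i 0 x (i1 k x (p1 k x (p 0 x v)))) + (\<Sum>k<?m. i 1 x (i2 k x (p2 k x (p 1 x v))))"
      by (simp add: sum_lessThan_add i'_def p'_def)
    also have "(\<Sum>k<?n. i 0 x (i1 k x (p1 k x (p 0 x v)))) = i 0 x (\<Sum>k<?n. i1 k x (p1 k x (p 0 x v)))"
      using X by (intro linear_between_sum[OF assms(3) is_rep_subspace[OF assms(4)] rep_hom_linear[OF h(1)], symmetric])
        (auto intro: rep_hom_in[OF h1(1)] rep_hom_in[OF h1(2)])
    also have "(\<Sum>k<?m. i 1 x (i2 k x (p2 k x (p 1 x v)))) = i 1 x (\<Sum>k<?m. i2 k x (p2 k x (p 1 x v)))"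
      using Y by (intro linear_between_sum[OF assms(3) is_rep_subspace[OF assms(5)] rep_hom_linear[OF h(2)], symmetric])
        (auto intro: rep_hom_in[OF h2(1)] rep_hom_in[OF h2(2)])
    finally show "(\<Sum>k<length (Ns1 @ Ns2). i' k x (p' k x v)) = v"
      using ip1[OF X] ip2[OF Y] ip[OF v] by simp
  qed
  then show ?thesis by blast
qed

lemma ex_biprod_indecomposable:
  fixes N :: "('p::{finite,order}, 'k::field) urep"
  assumes "is_rep uscale N"
  shows "\<exists>Ns i p. (\<forall>L\<in>set Ns. is_rep uscale L \<and> indecomposable uscale L) \<and>
    biprod uscale N uscale Ns i p" using assms
proof (induction "total_dim uscale N" arbitrary: N rule: less_induct)
  case less
  note vs = vector_space_uscale[where 'k='k]
  show ?case
  proof (cases "zero_rep N")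
    case True
    \<comment> \<open>With no summands the two families are never evaluated, and the empty sum 0
      equals every vector of a zero module.\<close>
    then have "biprod uscale N uscale [] undefined undefined" by (simp add: biprod_def zero_rep_def)
    then show ?thesis by (metis list.set(1) empty_iff)
  next
    case nz: False
    show ?thesis
    proof (cases "indecomposable uscale N")
      case True
      have "iso_pair uscale N uscale N (\<lambda>x v. v) (\<lambda>x v. v)" by (simp add: iso_pair_def rep_hom_id)
      from biprod_single[OF this] True less.prems show ?thesis by (metis list.set_cases list.distinct(1) set_ConsD)
    next
      case False
      then obtain X Y :: "('p, 'k) urep" where XY: "is_rep uscale X" "is_rep uscale Y"
          "rep_isomorphic uscale N (fun_scale uscale) (dsum [X, Y])" "\<not> zero_rep X" "\<not> zero_rep Y"
        using nz by (auto simp: indecomposable_def)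
      obtain i p where b: "biprod uscale N uscale [X, Y] i p"
        using biprod_of_iso[OF vs less.prems vs _ XY(3)] XY(1,2) by auto
      have "total_dim uscale N = total_dim uscale X + total_dim uscale Y"
        using total_dim_biprod[OF vs less.prems vs _ b] XY by simp
      then have "total_dim uscale X < total_dim uscale N" "total_dim uscale Y < total_dim uscale N"
        using total_dim_pos[OF vs XY(1,4)] total_dim_pos[OF vs XY(2,5)] by auto
      with less.hyps XY(1,2) obtain Ns1 i1 p1 Ns2 i2 p2 where
        "\<forall>L\<in>set Ns1. is_rep uscale L \<and> indecomposable uscale L" "biprod uscale X uscale Ns1 i1 p1"
        "\<forall>L\<in>set Ns2. is_rep uscale L \<and> indecomposable uscale L" "biprod uscale Y uscale Ns2 i2 p2"
        by metis
      moreover from this have "\<exists>i' p'. biprod uscale N uscale (Ns1 @ Ns2) i' p'"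
        by (intro biprod_append[OF vs less.prems vs XY(1,2) vs _ b]) auto
      moreover have "\<forall>L\<in>set (Ns1 @ Ns2). is_rep uscale L \<and> indecomposable uscale L"
        using calculation by auto
      ultimately show ?thesis by blast
    qed
  qed
qed

text \<open>The induction on dimension has to stay within one type, so it is run on a copy of
  \<open>M\<close> on the standard carrier.\<close>

lemma ex_indec_decomposition:
  fixes s :: "'k::field \<Rightarrow> 'v::ab_group_add \<Rightarrow> 'v" and M :: "('p::{finite,order}, 'v) rep"
  assumes "vector_space s" "is_rep s M"
  obtains Ns where "indec_decomposition s M Ns"
proof -
  obtain N :: "('p, 'k) urep" and f g where N: "is_rep uscale N" "iso_pair s M uscale N f g"
    using ex_urep[OF assms] .
  obtain Ns i p where Ns: "\<forall>L\<in>set Ns. is_rep uscale L \<and> indecomposable uscale L"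
    and b: "biprod uscale N uscale Ns i p"
    using ex_biprod_indecomposable[OF N(1)] by blast
  have "rep_isomorphic s M (fun_scale uscale) (dsum Ns)"
    by (rule rep_isomorphic_trans[OF iso_pair_rep_isomorphic[OF N(2)]
      iso_of_biprod[OF vector_space_uscale N(1) vector_space_uscale b]])
  then show ?thesis using that Ns by (auto simp: indec_decomposition_def)
qed

section \<open>Submodules from homomorphisms, and retracts of indecomposables\<close>

lemma subrep_image:
  assumes "vector_space s" "vector_space t" "rep_hom s M t N f" "subrep s M X"
  shows "subrep t N (\<lambda>x. f x ` X x)"
  unfolding subrep_def
proof (intro conjI allI impI)
  have X: "module.subspace s (X x)" "X x \<subseteq> sp M x" "x \<le> y \<Longrightarrow> tr M x y ` X x \<subseteq> X y" for x y
    using assms(4) by (auto simp: subrep_def)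
  show "module.subspace t (f x ` X x)" for x
    by (rule linear_between_image_subspace[OF assms(1,2) X(1,2) rep_hom_linear[OF assms(3)]])
  show "f x ` X x \<subseteq> sp N x" for x using X(2) rep_hom_in[OF assms(3)] by blast
  show "tr N x y ` f x ` X x \<subseteq> f y ` X y" if "x \<le> y" for x y
  proof -
    have "tr N x y (f x v) = f y (tr M x y v)" if "v \<in> X x" for v
      using rep_hom_tr[OF assms(3) \<open>x \<le> y\<close>, of v] X(2)[of x] that by auto
    then show ?thesis using X(3)[OF that] by (auto simp: image_subset_iff)
  qed
qed

lemma subrep_vimage:
  assumes "vector_space s" "vector_space t" "is_rep s M" "rep_hom s M t N f" "subrep t N Z"
  shows "subrep s M (\<lambda>x. {v \<in> sp M x. f x v \<in> Z x})"
  unfolding subrep_def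
proof (intro conjI allI impI)
  have Z: "module.subspace t (Z x)" "x \<le> y \<Longrightarrow> tr N x y ` Z x \<subseteq> Z y" for x y
    using assms(5) by (auto simp: subrep_def)
  show "module.subspace s {v \<in> sp M x. f x v \<in> Z x}" for x
    by (rule linear_between_vimage_subspace[OF assms(1,2) is_rep_subspace[OF assms(3)] Z(1) rep_hom_linear[OF assms(4)]])
  show "tr M x y ` {v \<in> sp M x. f x v \<in> Z x} \<subseteq> {v \<in> sp M y. f y v \<in> Z y}" if "x \<le> y" for x y
    using Z(2)[OF that] rep_hom_tr[OF assms(4) that] is_rep_tr_in[OF assms(3) that]
    by (auto simp: image_subset_iff)
qed auto

lemma subrep_sp: "is_rep s M \<Longrightarrow> subrep s M (sp M)"
  by (auto simp: subrep_def is_rep_subspace is_rep_tr_in)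

lemma subrep_zero: "vector_space s \<Longrightarrow> is_rep s M \<Longrightarrow> subrep s M (\<lambda>x. {0})"
  by (auto simp: subrep_def is_rep_0 is_rep_tr_0 module.subspace_single_0 module_iff_vector_space)

lemma subrep_im:
  "vector_space s \<Longrightarrow> vector_space t \<Longrightarrow> is_rep s M \<Longrightarrow> rep_hom s M t N f \<Longrightarrow> subrep t N (rep_im M f)"
  unfolding rep_im_def by (rule subrep_image[OF _ _ _ subrep_sp])

lemma subrep_ker:
  assumes "vector_space s" "vector_space t" "is_rep s M" "is_rep t N" "rep_hom s M t N f"
  shows "subrep s M (rep_ker M f)"
  using subrep_vimage[OF assms(1,2,3,5) subrep_zero[OF assms(2,4)]] by (simp add: rep_ker_def)

text \<open>The idempotent \<open>f x (g x v)\<close> splits \<open>N\<close> into the image of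
  \<open>f\<close> and the kernel of \<open>g\<close>. The image is nonzero because \<open>L\<close>
  is, so indecomposability kills the kernel and the idempotent is the identity.\<close>

lemma indecomposable_retract_iso:
  fixes N :: "('p::order, 'k::field) urep" and L :: "('p, 'w::ab_group_add) rep" and t :: "'k \<Rightarrow> 'w \<Rightarrow> 'w"
  assumes "is_rep uscale N" "indecomposable uscale N" "vector_space t" "is_rep t L" "\<not> zero_rep L"
    and f: "rep_hom t L uscale N f" and g: "rep_hom uscale N t L g"
    and gf: "\<And>x v. v \<in> sp L x \<Longrightarrow> g x (f x v) = v"
  shows "iso_pair uscale N t L g f"
proof -
  note vs = vector_space_uscale[where 'k='k]
  define X where "X = N\<lparr>sp := rep_im L f\<rparr>"
  define Y where "Y = N\<lparr>sp := rep_ker N g\<rparr>"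
  have X: "is_rep uscale X" unfolding X_def
    by (rule is_rep_restrict[OF vs assms(1) subrep_im[OF assms(3) vs assms(4) f]])
  have Y: "is_rep uscale Y" unfolding Y_def
    by (rule is_rep_restrict[OF vs assms(1) subrep_ker[OF vs assms(3,1,4) g]])
  have fg: "rep_hom uscale N uscale N (\<lambda>x v. f x (g x v))" by (rule rep_hom_compose[OF g f])
  have N0: "\<And>x. 0 \<in> sp N x" by (rule is_rep_0[OF vs assms(1)])
  have gd: "g x (v - f x (g x v)) = 0" if "v \<in> sp N x" for x v
    using linear_between_diff[OF vs is_rep_subspace[OF assms(1)] rep_hom_linear[OF g] that rep_hom_in[OF fg that]]
      gf[OF rep_hom_in[OF g that]] by simp
  have d: "rep_hom uscale N uscale N (\<lambda>x v. v - f x (g x v))"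
    by (rule rep_hom_diff[OF vs assms(1) rep_hom_id fg])
  \<comment> \<open>Projections onto the two parts: the idempotent and its complement. Both parts
    lie in the carrier of \<open>N\<close>, so both inclusions are the identity function.\<close>
  define p where "p = (\<lambda>(k::nat) x v. if k = 0 then f x (g x v) else v - f x (g x v))"
  have sub: "rep_im L f x \<subseteq> sp N x" "rep_ker N g x \<subseteq> sp N x" for x
    using rep_hom_in[OF f] by (auto simp: rep_im_def rep_ker_def)
  have hX: "rep_hom uscale X uscale N (\<lambda>x v. v)" "rep_hom uscale Y uscale N (\<lambda>x v. v)"
    using sub[THEN subsetD] by (auto simp: X_def Y_def intro!: rep_homI linear_betweenI)
  have hp: "rep_hom uscale N uscale X (p 0)" "rep_hom uscale N uscale Y (p (Suc 0))"
    using fg d rep_hom_in[OF d] rep_hom_in[OF g]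
    by (auto simp: p_def X_def Y_def rep_hom_def linear_between_def rep_im_def rep_ker_def gd image_subset_iff)
  have f0: "f x 0 = 0" for x by (rule rep_hom_0[OF assms(3,4) f])
  have pX: "f x (g x v) = v" if "v \<in> sp X x" for x v using that gf by (auto simp: X_def rep_im_def)
  have pY: "f x (g x v) = 0" if "v \<in> sp Y x" for x v using that f0 by (auto simp: Y_def rep_ker_def)
  have "biprod uscale N uscale [X, Y] (\<lambda>k x v. v) p"
    using hX hp pX pY by (auto simp: biprod_def less_Suc_eq numeral_2_eq_2) (auto simp: p_def)
  then have "rep_isomorphic uscale N (fun_scale uscale) (dsum [X, Y])"
    by (rule iso_of_biprod[OF vs assms(1) vs])
  then have "zero_rep X \<or> zero_rep Y" using assms(2) X Y by (auto simp: indecomposable_def)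
  moreover have "\<not> zero_rep X"
  proof
    assume "zero_rep X"
    then have "f x v = 0" if "v \<in> sp L x" for x v
      using that by (auto simp: zero_rep_def X_def rep_im_def)
    then have "v = 0" if "v \<in> sp L x" for x v
      using that gf[of v x] rep_hom_0[OF vs assms(1) g, of x] by auto
    then show False using assms(5) is_rep_0[OF assms(3,4)] by (auto simp: zero_rep_def)
  qed
  ultimately have Y0: "zero_rep Y" by simp
  have "f x (g x v) = v" if "v \<in> sp N x" for x v
  proof -
    have "v - f x (g x v) \<in> sp Y x"
      using rep_hom_in[OF d that] gd[OF that] by (simp add: Y_def rep_ker_def)
    then show ?thesis using Y0 by (simp add: zero_rep_def)
  qed
  then show ?thesis using f g gf by (simp add: iso_pair_def)
qed

subsection \<open>Multiplicities of interval modules\<close>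

lemma sp_interval_rep: "sp (interval_rep I) x = (if x \<in> I then UNIV else {0})"
  by (simp add: interval_rep_def)

lemma tr_interval_rep: "tr (interval_rep I) x y v = (if x \<in> I \<and> y \<in> I then v else 0)"
  by (simp add: interval_rep_def)

lemma interval_nonempty: "I \<in> intervals \<Longrightarrow> \<exists>x. x \<in> I"
proof -
  assume "I \<in> intervals"
  then have "I \<noteq> {}" unfolding intervals_def poset_interval_def mem_Collect_eq by (rule conjunct1)
  then show ?thesis by blast
qed

lemma interval_convex: "I \<in> intervals \<Longrightarrow> x \<in> I \<Longrightarrow> y \<in> I \<Longrightarrow> x \<le> z \<Longrightarrow> z \<le> y \<Longrightarrow> z \<in> I"
  unfolding intervals_def poset_interval_def mem_Collect_eq by blast

lemma interval_connected:
  "I \<in> intervals \<Longrightarrow> x \<in> I \<Longrightarrow> y \<in> I \<Longrightarrow> (x, y) \<in> {(a, b). a \<in> I \<and> b \<in> I \<and> (a \<le> b \<or> b \<le> a)}\<^sup>*"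
  unfolding intervals_def poset_interval_def mem_Collect_eq by blast

lemma fin_dim_subspace_field: "fin_dim_subspace (*) (UNIV :: 'k::field set)"
proof -
  have m: "module ((*) :: 'k \<Rightarrow> 'k \<Rightarrow> 'k)" by (simp add: module_iff_vector_space vector_space_field)
  have "module.span (*) {1 :: 'k} = UNIV" using module.span_singleton[OF m, of 1] by simp
  then show ?thesis using module.subspace_UNIV[OF m] by (metis fin_dim_subspace_def finite.emptyI finite.insertI)
qed

lemma fin_dim_subspace_zero:
  assumes "vector_space s" shows "fin_dim_subspace s {0}"
proof -
  have m: "module s" using assms by (simp add: module_iff_vector_space)
  show ?thesis using module.span_empty[OF m] module.subspace_single_0[OF m]
    by (metis fin_dim_subspace_def finite.emptyI)
qed

lemma is_rep_interval_rep:
  assumes "I \<in> intervals"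
  shows "is_rep ((*) :: 'k::field \<Rightarrow> 'k \<Rightarrow> 'k) (interval_rep I)"
proof -
  have "fin_dim_subspace (*) (sp (interval_rep I) x :: 'k set)" for x
    by (simp add: sp_interval_rep fin_dim_subspace_field fin_dim_subspace_zero[OF vector_space_field])
  moreover have "linear_between (*) (sp (interval_rep I) x) (*) (sp (interval_rep I) y :: 'k set)
      (tr (interval_rep I) x y)" for x y
    by (rule linear_betweenI) (auto simp: sp_interval_rep tr_interval_rep)
  ultimately show ?thesis unfolding is_rep_def
  proof (intro conjI allI impI ballI)
    show "tr (interval_rep I) x x v = v" if "v \<in> sp (interval_rep I) x" for x and v :: 'k
      using that by (simp add: sp_interval_rep tr_interval_rep split: if_splits)
    show "tr (interval_rep I) x z v = tr (interval_rep I) y z (tr (interval_rep I) x y v)"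
      if "x \<le> y \<and> y \<le> z" for x y z and v :: 'k
      using that interval_convex[OF assms, of x z y] by (simp add: tr_interval_rep)
  qed
qed

lemma interval_rep_not_zero: "I \<in> intervals \<Longrightarrow> \<not> zero_rep (interval_rep I :: ('p::order, 'k::field) rep)"
proof
  assume I: "I \<in> intervals" and z: "zero_rep (interval_rep I :: ('p, 'k) rep)"
  from I obtain x where x: "x \<in> I" using interval_nonempty by blast
  have "sp (interval_rep I) x = {0 :: 'k}" using z unfolding zero_rep_def by blast
  then have "(1 :: 'k) \<in> {0}" using x by (metis sp_interval_rep UNIV_I)
  then show False by simp
qed

text \<open>An isomorphism matches supports: there is no bijection between \<open>{0}\<close> and a
  field, where 0 and 1 differ.\<close>

lemma interval_rep_iso_imp_eq:
  fixes I J :: "'p::order set"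
  assumes "I \<in> intervals" "J \<in> intervals"
    and "rep_isomorphic (*) (interval_rep I :: ('p, 'k::field) rep) (*) (interval_rep J :: ('p, 'k) rep)"
  shows "I = J"
proof -
  obtain f where f: "\<And>x. bij_betw (f x) (sp (interval_rep I :: ('p, 'k) rep) x) (sp (interval_rep J :: ('p, 'k) rep) x)"
    using assms(3) by (auto simp: rep_isomorphic_def)
  have "x \<in> I \<longleftrightarrow> x \<in> J" for x
  proof (cases "x \<in> I"; cases "x \<in> J")
    assume "x \<in> I" "x \<notin> J"
    then have "bij_betw (f x) (UNIV :: 'k set) {0 :: 'k}" using f[of x] by (simp add: sp_interval_rep)
    then have "inj (f x)" "f x 0 = 0" "f x 1 = 0" unfolding bij_betw_def by blast+
    then have "(0 :: 'k) = 1" by (metis injD)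
    then show ?thesis by simp
  next
    assume "x \<notin> I" "x \<in> J"
    then have "bij_betw (f x) {0 :: 'k} (UNIV :: 'k set)" using f[of x] by (simp add: sp_interval_rep)
    then have "UNIV = {f x 0}" by (simp add: bij_betw_def)
    then have "(0 :: 'k) = 1" by (metis UNIV_I singletonD)
    then show ?thesis by simp
  qed auto
  then show ?thesis by blast
qed

text \<open>At a vertex of \<open>I\<close> an endomorphism is multiplication by
  \<open>h x 1\<close>. Structure maps inside \<open>I\<close> are identities, so this number agrees
  at comparable vertices and connectedness spreads it over \<open>I\<close>.\<close>

lemma interval_rep_endo_scalar:
  assumes "I \<in> intervals" and h: "rep_hom (*) (interval_rep I) (*) (interval_rep I) h"
  obtains c :: "'k::field" where "\<And>x v. v \<in> sp (interval_rep I) x \<Longrightarrow> h x v = c * v"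
proof -
  obtain x0 where x0: "x0 \<in> I" using interval_nonempty[OF assms(1)] by blast
  have step: "h y 1 = h x 1" if "x \<in> I" "y \<in> I" "x \<le> y" for x y
    using rep_hom_tr[OF h that(3), of 1] that by (simp add: sp_interval_rep tr_interval_rep)
  have const: "h x 1 = h x0 1" if "x \<in> I" for x
  proof -
    have "(x0, x) \<in> {(a, b). a \<in> I \<and> b \<in> I \<and> (a \<le> b \<or> b \<le> a)}\<^sup>*"
      by (rule interval_connected[OF assms(1) x0 that])
    \<comment> \<open>Each link of the chain may go up or down; \<open>step\<close> covers both
      directions by symmetry of equality.\<close>
    then show ?thesis by (induction rule: rtrancl_induct) (auto dest: step)
  qed
  have "h x v = h x0 1 * v" if "v \<in> sp (interval_rep I) x" for x v
  proof (cases "x \<in> I")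
    case True
    then have "h x (v * 1) = v * h x 1"
      by (intro linear_between_scale[OF rep_hom_linear[OF h]]) (simp add: sp_interval_rep)
    then show ?thesis using const[OF True] by simp
  next
    case False
    then show ?thesis using that rep_hom_0[OF vector_space_field is_rep_interval_rep[OF assms(1)] h]
      by (simp add: sp_interval_rep)
  qed
  then show ?thesis using that by blast
qed

text \<open>The idempotent projecting onto the summand \<open>X\<close> is a scalar
  \<open>c\<close>. If \<open>c = 0\<close> it kills \<open>X\<close>; otherwise it is injective,
  but it vanishes on \<open>Y\<close>, so \<open>Y\<close> is zero.\<close>

lemma indecomposable_interval_rep:
  assumes "I \<in> intervals"
  shows "indecomposable (*) (interval_rep I :: ('p::order, 'k::field) rep)"
proof -
  note vs = vector_space_uscale[where 'k='k] and vf = vector_space_field[where 'k='k]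
  let ?L = "interval_rep I :: ('p, 'k) rep"
  note L = is_rep_interval_rep[OF assms, where 'k='k]
  have "zero_rep X \<or> zero_rep Y"
    if XY: "is_rep uscale X" "is_rep uscale Y" "rep_isomorphic (*) ?L (fun_scale uscale) (dsum [X, Y])"
    for X Y :: "('p, 'k) urep"
  proof -
    obtain i p where b: "biprod (*) ?L uscale [X, Y] i p"
      using biprod_of_iso[OF vf L vs _ XY(3)] XY(1,2) by auto
    have h: "rep_hom uscale X (*) ?L (i 0)" "rep_hom uscale Y (*) ?L (i 1)"
        "rep_hom (*) ?L uscale X (p 0)" "rep_hom (*) ?L uscale Y (p 1)"
      and pi: "\<And>x v. v \<in> sp X x \<Longrightarrow> p 0 x (i 0 x v) = v" "\<And>x v. v \<in> sp Y x \<Longrightarrow> p 1 x (i 1 x v) = v"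
        "\<And>x v. v \<in> sp Y x \<Longrightarrow> p 0 x (i 1 x v) = 0"
      using b by (auto simp: biprod_def less_Suc_eq numeral_2_eq_2 all_conj_distrib)
    have e: "rep_hom (*) ?L (*) ?L (\<lambda>x v. i 0 x (p 0 x v))" by (rule rep_hom_compose[OF h(3,1)])
    obtain c where c: "\<And>x v. v \<in> sp ?L x \<Longrightarrow> i 0 x (p 0 x v) = c * v"
      using interval_rep_endo_scalar[OF assms e] by blast
    have z: "i 0 x 0 = 0" "p 0 x 0 = 0" "p 1 x 0 = 0" for x
      by (rule rep_hom_0[OF vs XY(1) h(1)] rep_hom_0[OF vf L h(3)] rep_hom_0[OF vf L h(4)])+
    show ?thesis
    proof (cases "c = 0")
      case True
      have "v = 0" if "v \<in> sp X x" for v x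
        using c[OF rep_hom_in[OF h(1) that]] pi(1)[OF that] z True by simp
      then show ?thesis using is_rep_0[OF vs XY(1)] by (auto simp: zero_rep_def)
    next
      case False
      have "v = 0" if "v \<in> sp Y x" for v x
        using c[OF rep_hom_in[OF h(2) that]] pi(2,3)[OF that] z False by simp
      then show ?thesis using is_rep_0[OF vs XY(2)] by (auto simp: zero_rep_def)
    qed
  qed
  then show ?thesis using interval_rep_not_zero[OF assms] by (auto simp: indecomposable_def)
qed

text \<open>The composite is a scalar, nonzero by evaluation at one vertex; dividing by it turns
  \<open>interval_rep I\<close> into a retract of the indecomposable \<open>N\<close>.\<close>

lemma interval_rep_factor_iso:
  fixes N :: "('p::order, 'k::field) urep"
  assumes "I \<in> intervals" "is_rep uscale N" "indecomposable uscale N"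
    and f: "rep_hom (*) (interval_rep I) uscale N f" and g: "rep_hom uscale N (*) (interval_rep I) g"
    and x: "x \<in> I" "g x (f x 1) \<noteq> 0"
  shows "rep_isomorphic uscale N (*) (interval_rep I :: ('p, 'k) rep)"
proof -
  note vf = vector_space_field[where 'k='k] and L = is_rep_interval_rep[OF assms(1), where 'k='k]
  obtain c where c: "\<And>x v. v \<in> sp (interval_rep I) x \<Longrightarrow> g x (f x v) = c * v"
    using interval_rep_endo_scalar[OF assms(1) rep_hom_compose[OF f g]] by blast
  have "c \<noteq> 0" using c[of 1 x] x by (simp add: sp_interval_rep)
  have g': "rep_hom uscale N (*) (interval_rep I) (\<lambda>x v. inverse c * g x v)"
    by (rule rep_hom_scale[OF vf L g])
  have "iso_pair uscale N (*) (interval_rep I) (\<lambda>x v. inverse c * g x v) f" using c \<open>c \<noteq> 0\<close>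
    by (intro indecomposable_retract_iso[OF assms(2,3) vf L interval_rep_not_zero[OF assms(1)] f g']) auto
  then show ?thesis by (rule iso_pair_rep_isomorphic)
qed

text \<open>The rank bound: an identity matrix of size \<open>n\<close> cannot factor through a
  space of dimension \<open>card K\<close>. The rows of \<alpha> are functionals dual to the columns
  of \<beta>, so those columns are independent in the span of \<open>card K\<close> unit
  vectors.\<close>

lemma identity_factorization_card:
  fixes \<alpha> \<beta> :: "nat \<Rightarrow> nat \<Rightarrow> 'k::field"
  assumes "finite K"
    and ab: "\<And>a b. a < n \<Longrightarrow> b < n \<Longrightarrow> (\<Sum>k\<in>K. \<alpha> a k * \<beta> k b) = (if a = b then 1 else 0)"
  shows "n \<le> card K"
proof -
  interpret vector_space "uscale :: 'k \<Rightarrow> _" by (rule vector_space_uscale)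
  define w where "w = (\<lambda>b k. if k \<in> K then \<beta> k b else 0)"
  define \<phi> where "\<phi> = (\<lambda>a (v :: nat \<Rightarrow> 'k). \<Sum>k\<in>K. \<alpha> a k * v k)"
  define e where "e = (\<lambda>k j :: nat. if j = k then 1 else (0 :: 'k))"
  have \<phi>w: "\<phi> a (w b) = (if a = b then 1 else 0)" if "a < n" "b < n" for a b
    using ab[OF that] by (simp add: \<phi>_def w_def)
  have lin: "\<phi> a (\<Sum>v\<in>S. fun_scale (*) (c v) v) = (\<Sum>v\<in>S. c v * \<phi> a v)" for a S c
    by (simp add: \<phi>_def sum_fun_apply fun_scale_def sum_distrib_left mult.left_commute sum.swap[of _ K])
  have inj: "inj_on w {..<n}"
  proof (rule inj_onI)
    fix a b assume "a \<in> {..<n}" "b \<in> {..<n}" "w a = w b"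
    then show "a = b" using \<phi>w[of a a] \<phi>w[of a b] by (auto split: if_splits)
  qed
  have "independent (w ` {..<n})"
  proof (rule independent_if_scalars_zero)
    fix c v assume 0: "(\<Sum>v\<in>w ` {..<n}. fun_scale (*) (c v) v) = 0" and "v \<in> w ` {..<n}"
    then obtain a where a: "a < n" "v = w a" by auto
    have "0 = \<phi> a (\<Sum>v\<in>w ` {..<n}. fun_scale (*) (c v) v)" unfolding 0 by (simp add: \<phi>_def)
    also have "\<dots> = (\<Sum>v\<in>w ` {..<n}. c v * \<phi> a v)" by (rule lin)
    also have "\<dots> = (\<Sum>b<n. c (w b) * \<phi> a (w b))" by (simp add: sum.reindex[OF inj])
    also have "\<dots> = (\<Sum>b<n. if a = b then c (w b) else 0)" using a by (intro sum.cong) (auto simp: \<phi>w)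
    also have "\<dots> = c v" using a by simp
    finally show "c v = 0" by simp
  qed simp
  moreover have "w ` {..<n} \<subseteq> span (e ` K)"
  proof
    fix v assume "v \<in> w ` {..<n}"
    then obtain b where b: "v = w b" by auto
    have "v = (\<Sum>k\<in>K. fun_scale (*) (\<beta> k b) (e k))" using assms(1)
      by (auto simp: b w_def fun_eq_iff sum_fun_apply fun_scale_def e_def if_distrib cong: if_cong)
    moreover have "(\<Sum>k\<in>K. fun_scale (*) (\<beta> k b) (e k)) \<in> span (e ` K)"
      by (intro span_sum span_scale span_base) auto
    ultimately show "v \<in> span (e ` K)" by (simp only:)
  qed
  ultimately have "card (w ` {..<n}) \<le> card (e ` K)"
    using independent_span_bound[of "e ` K"] assms(1) by blast
  then show ?thesis using card_image[OF inj] card_image_le[OF assms(1), of e] by simp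
qed

text \<open>The multiplicity of an interval module is the largest size of such a system, a number
  that does not refer to any decomposition.\<close>

definition dual_system where
  "dual_system s M I (n::nat) \<longleftrightarrow>
     (\<exists>f g. (\<forall>a<n. rep_hom (*) (interval_rep I) s M (f a) \<and> rep_hom s M (*) (interval_rep I) (g a)) \<and>
        (\<forall>a<n. \<forall>b<n. \<forall>x\<in>I. g a x (f b x 1) = (if a = b then 1 else 0)))"

text \<open>At any vertex of \<open>I\<close>, a dual system factors an identity matrix through the
  summands isomorphic to the interval module, which bounds its size. Conversely the inclusions and
  projections of these summands form a dual system.\<close>

lemma dual_system_iff:
  fixes s :: "'k::field \<Rightarrow> 'v::ab_group_add \<Rightarrow> 'v" and M :: "('p::order, 'v) rep"
  assumes "vector_space s" "is_rep s M" "I \<in> intervals" "indec_decomposition s M Ns"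
  shows "dual_system s M I n \<longleftrightarrow>
    n \<le> length (filter (\<lambda>N. rep_isomorphic uscale N (*) (interval_rep I :: ('p, 'k) rep)) Ns)"
proof -
  note vs = vector_space_uscale[where 'k='k] and vf = vector_space_field[where 'k='k]
  let ?L = "interval_rep I :: ('p, 'k) rep"
  note L = is_rep_interval_rep[OF assms(3), where 'k='k]
  let ?n = "length Ns"
  define K where "K = {k. k < ?n \<and> rep_isomorphic uscale (Ns ! k) (*) ?L}"
  have fK: "finite K" by (simp add: K_def)
  have cK: "length (filter (\<lambda>N. rep_isomorphic uscale N (*) ?L) Ns) = card K"
    by (simp add: length_filter_conv_card K_def)
  have N: "\<forall>N\<in>set Ns. is_rep uscale N" and ind: "\<And>k. k < ?n \<Longrightarrow> indecomposable uscale (Ns ! k)"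
    and iso: "rep_isomorphic s M (fun_scale uscale) (dsum Ns)"
    using assms(4) by (auto simp: indec_decomposition_def)
  have Nk: "\<And>k. k < ?n \<Longrightarrow> is_rep uscale (Ns ! k)" using N by simp
  obtain i p where b: "biprod s M uscale Ns i p" using biprod_of_iso[OF assms(1,2) vs N iso] .
  then have hi: "\<And>k. k < ?n \<Longrightarrow> rep_hom uscale (Ns ! k) s M (i k)"
    and hp: "\<And>k. k < ?n \<Longrightarrow> rep_hom s M uscale (Ns ! k) (p k)"
    and pi: "\<And>k l x v. k < ?n \<Longrightarrow> l < ?n \<Longrightarrow> v \<in> sp (Ns ! l) x \<Longrightarrow>
      p k x (i l x v) = (if k = l then v else 0)"
    and ip: "\<And>x v. v \<in> sp M x \<Longrightarrow> (\<Sum>k<?n. i k x (p k x v)) = v"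
    by (auto simp: biprod_def)
  have "\<exists>\<phi> \<psi>. iso_pair uscale (Ns ! k) (*) ?L \<phi> \<psi>" if "k \<in> K" for k
    using rep_isomorphic_iso_pair[OF vs Nk, of k _ ?L] that by (auto simp: K_def) blast
  then obtain \<phi> \<psi> where "\<And>k. k \<in> K \<Longrightarrow> iso_pair uscale (Ns ! k) (*) ?L (\<phi> k) (\<psi> k)" by metis
  then have h\<phi>: "\<And>k. k \<in> K \<Longrightarrow> rep_hom uscale (Ns ! k) (*) ?L (\<phi> k)"
    and h\<psi>: "\<And>k. k \<in> K \<Longrightarrow> rep_hom (*) ?L uscale (Ns ! k) (\<psi> k)"
    and \<psi>\<phi>: "\<And>k x v. k \<in> K \<Longrightarrow> v \<in> sp (Ns ! k) x \<Longrightarrow> \<psi> k x (\<phi> k x v) = v"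
    and \<phi>\<psi>: "\<And>k x v. k \<in> K \<Longrightarrow> v \<in> sp ?L x \<Longrightarrow> \<phi> k x (\<psi> k x v) = v"
    by (auto simp: iso_pair_def)
  have KN: "k < ?n" if "k \<in> K" for k using that by (simp add: K_def)
  have one: "1 \<in> sp ?L x" if "x \<in> I" for x using that by (simp add: sp_interval_rep)
  show ?thesis unfolding cK
  proof
    assume "dual_system s M I n"
    then obtain f g where fg: "\<forall>a<n. rep_hom (*) ?L s M (f a) \<and> rep_hom s M (*) ?L (g a)"
      and gf': "\<forall>a<n. \<forall>b<n. \<forall>x\<in>I. g a x (f b x 1) = (if a = b then 1 else 0)"
      unfolding dual_system_def by blast
    have f: "\<And>a. a < n \<Longrightarrow> rep_hom (*) ?L s M (f a)" and g: "\<And>a. a < n \<Longrightarrow> rep_hom s M (*) ?L (g a)"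
      and gf: "\<And>a b x. a < n \<Longrightarrow> b < n \<Longrightarrow> x \<in> I \<Longrightarrow> g a x (f b x 1) = (if a = b then 1 else 0)"
      using fg gf' by simp_all
    obtain x where x: "x \<in> I" using interval_nonempty[OF assms(3)] by blast
    \<comment> \<open>The two factors: \<alpha> is the scalar of interval module to
      \<open>k\<close>-th summand to \<open>M\<close> to interval module along \<open>g a\<close>,
      and \<beta> the scalar obtained along \<open>f b\<close> in the same way.\<close>
    define \<alpha> where "\<alpha> = (\<lambda>a k. g a x (i k x (\<psi> k x 1)))"
    define \<beta> where "\<beta> = (\<lambda>k b. \<phi> k x (p k x (f b x 1)))"
    show "n \<le> card K"
    proof (rule identity_factorization_card[OF fK])
      fix a b assume ab: "a < n" "b < n"
      note fb = rep_hom_in[OF f[OF ab(2)] one[OF x]]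
      have ipM: "i k x (p k x (f b x 1)) \<in> sp M x" if "k < ?n" for k
        using rep_hom_in[OF hi[OF that] rep_hom_in[OF hp[OF that] fb]] .
      have "(if a = b then 1 else 0) = g a x (f b x 1)" using gf[OF ab x] by simp
      also have "f b x 1 = (\<Sum>k<?n. i k x (p k x (f b x 1)))" using ip[OF fb] by simp
      also have "g a x \<dots> = (\<Sum>k<?n. g a x (i k x (p k x (f b x 1))))"
        using ipM by (intro linear_between_sum[OF assms(1) is_rep_subspace[OF assms(2)] rep_hom_linear[OF g[OF ab(1)]]]) auto
      also have "\<dots> = (\<Sum>k\<in>K. g a x (i k x (p k x (f b x 1))))"
      proof (rule sum.mono_neutral_right)
        \<comment> \<open>A nonzero term would be a nonzero composite of interval module,
          \<open>k\<close>-th summand and interval module, which places \<open>k\<close> in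
          \<open>K\<close>.\<close>
        show "\<forall>k\<in>{..<?n} - K. g a x (i k x (p k x (f b x 1))) = 0"
        proof (rule ballI, rule ccontr)
          fix k assume k: "k \<in> {..<?n} - K" and nz: "g a x (i k x (p k x (f b x 1))) \<noteq> 0"
          then have k': "k < ?n" by simp
          have "rep_isomorphic uscale (Ns ! k) (*) ?L"
            by (rule interval_rep_factor_iso[OF assms(3) Nk[OF k'] ind[OF k']
              rep_hom_compose[OF f[OF ab(2)] hp[OF k']] rep_hom_compose[OF hi[OF k'] g[OF ab(1)]] x nz])
          then show False using k by (simp add: K_def)
        qed
      qed (auto simp: K_def)
      also have "\<dots> = (\<Sum>k\<in>K. \<alpha> a k * \<beta> k b)"
      proof (rule sum.cong[OF refl])
        fix k assume k: "k \<in> K"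
        \<comment> \<open>Once the vector in the \<open>k\<close>-th summand is written as
          \<open>\<psi> k x (\<beta> k b * 1)\<close>, linearity of this endomorphism pulls the
          factor \<open>\<beta> k b\<close> out.\<close>
        have h: "rep_hom (*) ?L (*) ?L (\<lambda>x v. g a x (i k x (\<psi> k x v)))"
          by (rule rep_hom_compose[OF rep_hom_compose[OF h\<psi>[OF k] hi[OF KN[OF k]]] g[OF ab(1)]])
        have "p k x (f b x 1) = \<psi> k x (\<beta> k b * 1)"
          using \<psi>\<phi>[OF k rep_hom_in[OF hp[OF KN[OF k]] fb]] by (simp add: \<beta>_def)
        then show "g a x (i k x (p k x (f b x 1))) = \<alpha> a k * \<beta> k b"
          using linear_between_scale[OF rep_hom_linear[OF h] one[OF x], of "\<beta> k b"]
          by (simp add: \<alpha>_def mult.commute)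
      qed
      finally show "(\<Sum>k\<in>K. \<alpha> a k * \<beta> k b) = (if a = b then 1 else 0)" by simp
    qed
  next
    assume n: "n \<le> card K"
    \<comment> \<open>An enumeration of \<open>K\<close>; its first \<open>n\<close> members supply
      the maps of the system.\<close>
    obtain h where h: "bij_betw h {0..<card K} K" using ex_bij_betw_nat_finite[OF fK] by blast
    have hK: "h a \<in> K" if "a < n" for a using that n h by (auto simp: bij_betw_def)
    have hinj: "h a = h b \<longleftrightarrow> a = b" if "a < n" "b < n" for a b
      using that n h by (auto simp: bij_betw_def inj_on_def)
    define f where "f = (\<lambda>a x v. i (h a) x (\<psi> (h a) x v))"
    define g where "g = (\<lambda>a x v. \<phi> (h a) x (p (h a) x v))"
    have "rep_hom (*) ?L s M (f a)" "rep_hom s M (*) ?L (g a)" if "a < n" for a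
      unfolding f_def g_def
      by (rule rep_hom_compose[OF h\<psi>[OF hK[OF that]] hi[OF KN[OF hK[OF that]]]]
        rep_hom_compose[OF hp[OF KN[OF hK[OF that]]] h\<phi>[OF hK[OF that]]])+
    moreover have "g a x (f b x 1) = (if a = b then 1 else 0)" if "a < n" "b < n" "x \<in> I" for a b x
    proof -
      have b: "\<psi> (h b) x 1 \<in> sp (Ns ! h b) x" by (rule rep_hom_in[OF h\<psi>[OF hK[OF that(2)]] one[OF that(3)]])
      have "p (h a) x (i (h b) x (\<psi> (h b) x 1)) = (if a = b then \<psi> (h b) x 1 else 0)"
        using pi[OF KN[OF hK[OF that(1)]] KN[OF hK[OF that(2)]] b] hinj[OF that(1,2)] by simp
      then show ?thesis using \<phi>\<psi>[OF hK[OF that(2)] one[OF that(3)]]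
          rep_hom_0[OF vs Nk[OF KN[OF hK[OF that(1)]]] h\<phi>[OF hK[OF that(1)]], of x]
        by (simp add: f_def g_def)
    qed
    ultimately show "dual_system s M I n" unfolding dual_system_def by blast
  qed
qed

text \<open>For every decomposition, \<open>dual_system s M I n\<close> holds exactly for
  \<open>n\<close> up to the count. Counts from two decompositions therefore bound each other, which
  gives the uniqueness required by \<open>THE\<close>.\<close>

lemma interval_mult_eq:
  fixes s :: "'k::field \<Rightarrow> 'v::ab_group_add \<Rightarrow> 'v" and M :: "('p::order, 'v) rep"
  assumes "vector_space s" "is_rep s M" "I \<in> intervals" "indec_decomposition s M Ns"
  shows "interval_mult s M I =
    length (filter (\<lambda>N. rep_isomorphic uscale N (*) (interval_rep I :: ('p, 'k) rep)) Ns)"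
  unfolding multiplicity_in_def
proof (rule the_equality)
  fix m assume "\<exists>Ns. indec_decomposition s M Ns \<and>
    m = length (filter (\<lambda>N. rep_isomorphic uscale N (*) (interval_rep I :: ('p, 'k) rep)) Ns)"
  then obtain Ns' where "indec_decomposition s M Ns'"
    "m = length (filter (\<lambda>N. rep_isomorphic uscale N (*) (interval_rep I :: ('p, 'k) rep)) Ns')" by blast
  then show "m = length (filter (\<lambda>N. rep_isomorphic uscale N (*) (interval_rep I :: ('p, 'k) rep)) Ns)"
    using dual_system_iff[OF assms(1-3)] assms(4) by (metis le_antisym order_refl)
qed (use assms(4) in blast)

text \<open>Exchanging summations turns a sum weighted by multiplicities into one over the summands
  of a single decomposition, where dimensions can be compared term by term.\<close>

lemma sum_interval_mult:
  fixes s :: "'k::field \<Rightarrow> 'v::ab_group_add \<Rightarrow> 'v" and M :: "('p::{finite,order}, 'v) rep"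
  assumes "vector_space s" "is_rep s M" "indec_decomposition s M Ns"
  shows "(\<Sum>I\<in>intervals. interval_mult s M I * w I) =
    (\<Sum>k<length Ns. \<Sum>I\<in>intervals. if rep_isomorphic uscale (Ns ! k) (*) (interval_rep I :: ('p, 'k) rep) then w I else 0)"
proof -
  have "(\<Sum>I\<in>intervals. interval_mult s M I * w I) =
    (\<Sum>I\<in>intervals. \<Sum>k<length Ns. if rep_isomorphic uscale (Ns ! k) (*) (interval_rep I :: ('p, 'k) rep) then w I else 0)"
    by (intro sum.cong refl)
      (simp add: interval_mult_eq[OF assms(1,2) _ assms(3)] length_filter_conv_card sum.If_cases
        lessThan_def Int_def)
  then show ?thesis by (simp add: sum.swap[of _ "{..<length Ns}"])
qed

lemma sum_iso_intervals:
  fixes N :: "('p::{finite,order}, 'k::field) urep"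
  assumes "is_rep uscale N" "I \<in> intervals" "rep_isomorphic uscale N (*) (interval_rep I :: ('p, 'k) rep)"
  shows "(\<Sum>J\<in>intervals. if rep_isomorphic uscale N (*) (interval_rep J :: ('p, 'k) rep) then w J else 0) = w I"
proof -
  have "rep_isomorphic uscale N (*) (interval_rep J :: ('p, 'k) rep) \<longleftrightarrow> J = I" if "J \<in> intervals" for J
    using interval_rep_iso_imp_eq[OF that assms(2)] assms(3)
      rep_isomorphic_trans[OF rep_isomorphic_sym[OF vector_space_uscale assms(1)] assms(3)] by blast
  then have "(\<Sum>J\<in>intervals. if rep_isomorphic uscale N (*) (interval_rep J :: ('p, 'k) rep) then w J else 0) =
    (\<Sum>J\<in>intervals. if J = I then w J else 0)" by (intro sum.cong) auto
  also have "\<dots> = w I" using assms(2) by (simp add: sum.delta)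
  finally show ?thesis .
qed

subsection \<open>Projective covers and injective envelopes\<close>

lemma finite_order_induct:
  fixes x :: "'p::{finite,order}"
  assumes "\<And>x. (\<And>y. y < x \<Longrightarrow> P y) \<Longrightarrow> P x"
  shows "P x"
proof (induction x rule: measure_induct_rule[of "\<lambda>x. card {..<x}"])
  case (less x)
  have "card {..<y} < card {..<x}" if "y < x" for y using that by (intro psubset_card_mono) auto
  then show ?case using less assms by blast
qed

lemma superfluousI:
  assumes "\<And>X. subrep s M X \<Longrightarrow> (\<And>x v. v \<in> sp M x \<Longrightarrow> \<exists>a\<in>X x. \<exists>b\<in>K x. v = a + b) \<Longrightarrow>
    (\<And>x v. v \<in> sp M x \<Longrightarrow> v \<in> X x)"
  shows "superfluous s M K"
  unfolding superfluous_def
proof (intro allI impI ext subset_antisym)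
  fix X x assume X: "subrep s M X \<and> (\<forall>x. X x + K x = sp M x)"
  show "X x \<subseteq> sp M x" using X by (auto simp: subrep_def)
  have "\<exists>a\<in>X x. \<exists>b\<in>K x. v = a + b" if "v \<in> sp M x" for x v using X that by (metis set_plus_elim)
  then show "sp M x \<subseteq> X x" using assms[of X] X by blast
qed

lemma superfluousD:
  assumes "vector_space s" "is_rep s M" "superfluous s M K" "subrep s M X"
    and "\<And>x. K x \<subseteq> sp M x" "\<And>x v. v \<in> sp M x \<Longrightarrow> \<exists>a\<in>X x. \<exists>b\<in>K x. v = a + b"
  shows "X = sp M"
proof -
  interpret vector_space s by fact
  have "X x + K x = sp M x" for x
  proof
    have "X x \<subseteq> sp M x" using assms(4) by (auto simp: subrep_def)
    then show "X x + K x \<subseteq> sp M x" using assms(5)[of x]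
      by (auto elim!: set_plus_elim intro!: subspace_add[OF is_rep_subspace[OF assms(2)]])
    show "sp M x \<subseteq> X x + K x" using assms(6) by (auto intro: set_plus_intro)
  qed
  then show ?thesis using assms(3,4) by (simp add: superfluous_def)
qed

lemma essentialI:
  assumes "\<And>X. subrep s M X \<Longrightarrow> (\<And>x v. v \<in> X x \<Longrightarrow> v \<in> K x \<Longrightarrow> v = 0) \<Longrightarrow>
    (\<And>x v. v \<in> X x \<Longrightarrow> v = 0)"
    and "vector_space s"
  shows "essential s M K"
  unfolding essential_def
proof (intro allI impI ext)
  interpret vector_space s by fact
  fix X x assume X: "subrep s M X \<and> (\<forall>x. X x \<inter> K x = {0})"
  then have "0 \<in> X x" by (auto simp: subrep_def subspace_0)
  then show "X x = {0}" using assms(1)[of X] X by blast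
qed

text \<open>\<open>essential\<close> asks for intersections equal to \<open>{0}\<close>, so
  membership of 0 in \<open>K\<close> has to be supplied together with the triviality of common
  vectors.\<close>

lemma essentialD:
  assumes "vector_space s" "essential s M K" "subrep s M X" "\<And>x. 0 \<in> K x"
    and "\<And>x v. v \<in> X x \<Longrightarrow> v \<in> K x \<Longrightarrow> v = 0" and "v \<in> X x"
  shows "v = 0"
proof -
  interpret vector_space s by fact
  have "X x \<inter> K x = {0}" for x using assms(3-5) by (auto simp: subrep_def subspace_0)
  then have "X = (\<lambda>x. {0})" using assms(2,3) by (simp add: essential_def)
  then show ?thesis using assms(6) by simp
qed

section \<open>Projectives and injectives built vertex by vertex\<close>

definition single where "single y v = (\<lambda>z. if z = y then v else 0)"

text \<open>These are \<open>\<Oplus>\<^sub>y P\<^sub>y \<otimes> C y\<close> and \<open>\<Oplus>\<^sub>y Q\<^sub>y \<otimes> C y\<close> for the indecomposable projective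
  \<open>P\<^sub>y\<close> and injective \<open>Q\<^sub>y\<close> at \<open>y\<close>, so homs out of (into) them are families of linear maps out
  of (into) the spaces \<open>C y\<close>.\<close>

definition free_rep :: "('p::order \<Rightarrow> 'v::zero set) \<Rightarrow> ('p, 'p \<Rightarrow> 'v) rep" where
  "free_rep C = \<lparr>sp = (\<lambda>x. {\<phi>. \<forall>y. \<phi> y \<in> (if y \<le> x then C y else {0})}), tr = (\<lambda>x y \<phi>. \<phi>)\<rparr>"

definition cofree_rep :: "('p::order \<Rightarrow> 'v::zero set) \<Rightarrow> ('p, 'p \<Rightarrow> 'v) rep" where
  "cofree_rep C = \<lparr>sp = (\<lambda>x. {\<phi>. \<forall>y. \<phi> y \<in> (if x \<le> y then C y else {0})}),
     tr = (\<lambda>x x' \<phi> y. if x' \<le> y then \<phi> y else 0)\<rparr>"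

lemma sp_free_rep: "\<phi> \<in> sp (free_rep C) x \<longleftrightarrow> (\<forall>y. if y \<le> x then \<phi> y \<in> C y else \<phi> y = 0)"
  by (simp add: free_rep_def)

lemma tr_free_rep: "tr (free_rep C) x y \<phi> = \<phi>"
  by (simp add: free_rep_def)

lemma sp_cofree_rep: "\<phi> \<in> sp (cofree_rep C) x \<longleftrightarrow> (\<forall>y. if x \<le> y then \<phi> y \<in> C y else \<phi> y = 0)"
  by (simp add: cofree_rep_def)

lemma tr_cofree_rep: "tr (cofree_rep C) x x' \<phi> y = (if x' \<le> y then \<phi> y else 0)"
  by (simp add: cofree_rep_def)

lemma is_rep_free_rep:
  fixes C :: "'p::{finite,order} \<Rightarrow> 'v::ab_group_add set"
  assumes "vector_space s" "\<And>y. fin_dim_subspace s (C y)"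
  shows "is_rep (fun_scale s) (free_rep C)"
  unfolding is_rep_def
proof (intro conjI allI impI ballI)
  interpret vector_space s by fact
  have 0: "0 \<in> C y" for y using fin_dim_subspace_subspace[OF assms(2)] by (rule subspace_0)
  show "fin_dim_subspace (fun_scale s) (sp (free_rep C) x)" for x
    using fin_dim_subspace_functions[OF assms(1), of "\<lambda>y. if y \<le> x then C y else {0}"]
      assms(2) fin_dim_subspace_zero[OF assms(1)] by (simp add: free_rep_def)
  show "linear_between (fun_scale s) (sp (free_rep C) x) (fun_scale s) (sp (free_rep C) y) (tr (free_rep C) x y)"
    if "x \<le> y" for x y
  proof (rule linear_betweenI)
    fix \<phi> assume \<phi>: "\<phi> \<in> sp (free_rep C) x"
    have "if z \<le> y then \<phi> z \<in> C z else \<phi> z = 0" for z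
      using \<phi>[unfolded sp_free_rep, rule_format, of z] 0[of z] that order_trans[of z x y] by (auto split: if_splits)
    then show "tr (free_rep C) x y \<phi> \<in> sp (free_rep C) y" by (simp add: sp_free_rep tr_free_rep)
  qed (simp_all add: tr_free_rep)
qed (simp_all add: tr_free_rep)

lemma is_rep_cofree_rep:
  fixes C :: "'p::{finite,order} \<Rightarrow> 'v::ab_group_add set"
  assumes "vector_space s" "\<And>y. fin_dim_subspace s (C y)"
  shows "is_rep (fun_scale s) (cofree_rep C)"
  unfolding is_rep_def
proof (intro conjI allI impI ballI)
  interpret vector_space s by fact
  show "fin_dim_subspace (fun_scale s) (sp (cofree_rep C) x)" for x
    using fin_dim_subspace_functions[OF assms(1), of "\<lambda>y. if x \<le> y then C y else {0}"]
      assms(2) fin_dim_subspace_zero[OF assms(1)] by (simp add: cofree_rep_def)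
  show "linear_between (fun_scale s) (sp (cofree_rep C) x) (fun_scale s) (sp (cofree_rep C) y) (tr (cofree_rep C) x y)"
    if "x \<le> y" for x y
  proof (rule linear_betweenI)
    fix \<phi> assume \<phi>: "\<phi> \<in> sp (cofree_rep C) x"
    have "y \<le> z \<Longrightarrow> \<phi> z \<in> C z" for z
      using \<phi>[unfolded sp_cofree_rep, rule_format, of z] order_trans[OF that, of z] by auto
    then show "tr (cofree_rep C) x y \<phi> \<in> sp (cofree_rep C) y" by (simp add: sp_cofree_rep tr_cofree_rep)
  qed (auto simp: tr_cofree_rep fun_eq_iff fun_scale_def)
  show "tr (cofree_rep C) x x \<phi> = \<phi>" if "\<phi> \<in> sp (cofree_rep C) x" for x \<phi>
    using that[unfolded sp_cofree_rep, rule_format] by (auto simp: tr_cofree_rep fun_eq_iff split: if_splits)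
  show "tr (cofree_rep C) x z \<phi> = tr (cofree_rep C) y z (tr (cofree_rep C) x y \<phi>)"
    if "x \<le> y \<and> y \<le> z" for x y z \<phi> using that by (auto simp: tr_cofree_rep fun_eq_iff)
qed

lemma single_in_free_rep:
  assumes "v \<in> C y" "\<And>z. 0 \<in> C z" "y \<le> x"
  shows "single y v \<in> sp (free_rep C) x"
  using assms by (auto simp: sp_free_rep single_def)

lemma single_linear: "linear_between s C (fun_scale s) UNIV (single y)" if "vector_space s"
proof -
  interpret vector_space s by fact
  show ?thesis by (intro linear_betweenI) (auto simp: single_def fun_eq_iff fun_scale_def)
qed

text \<open>The universal property: a generator in \<open>C y\<close> may be sent anywhere in
  \<open>sp X y\<close>, and the structure maps of \<open>X\<close> dictate its image at every
  \<open>x\<close> above \<open>y\<close>.\<close>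

lemma free_rep_hom:
  fixes C :: "'p::{finite,order} \<Rightarrow> 'v::ab_group_add set"
  assumes "vector_space s" "\<And>y. fin_dim_subspace s (C y)" "vector_space t" "is_rep t X"
    and u: "\<And>y. linear_between s (C y) t (sp X y) (u y)"
  shows "rep_hom (fun_scale s) (free_rep C) t X (\<lambda>x \<phi>. \<Sum>y\<in>{..x}. tr X y x (u y (\<phi> y)))"
proof (rule rep_homI)
  interpret s: vector_space s by fact
  have 0: "0 \<in> C y" for y using fin_dim_subspace_subspace[OF assms(2)] by (rule s.subspace_0)
  show "linear_between (fun_scale s) (sp (free_rep C) x) t (sp X x) (\<lambda>\<phi>. \<Sum>y\<in>{..x}. tr X y x (u y (\<phi> y)))" for x
  proof (rule linear_between_sum_fun[OF assms(3) is_rep_subspace[OF assms(4)]])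
    fix y assume y: "y \<in> {..x}"
    have "linear_between (fun_scale s) (sp (free_rep C) x) s (C y) (\<lambda>\<phi>. \<phi> y)"
      using y by (intro linear_betweenI) (auto simp: sp_free_rep fun_scale_def split: if_splits)
    then show "linear_between (fun_scale s) (sp (free_rep C) x) t (sp X x) (\<lambda>\<phi>. tr X y x (u y (\<phi> y)))"
      using y by (intro linear_between_compose[OF linear_between_compose[OF _ u] is_rep_linear[OF assms(4)]]) auto
  qed
  fix x x' \<phi> assume le: "x \<le> x'" and \<phi>: "\<phi> \<in> sp (free_rep C) x"
  have u_in: "u y (\<phi> y) \<in> sp X y" if "y \<le> x" for y
    using that \<phi> by (intro linear_between_in[OF u]) (auto simp: sp_free_rep dest: spec[of _ y])
  \<comment> \<open>Coordinates not below \<open>x\<close> are 0 in \<phi>, so passing to the larger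
    down-set of \<open>x'\<close> adds no terms.\<close>
  have "(\<Sum>y\<in>{..x'}. tr X y x' (u y (\<phi> y))) = (\<Sum>y\<in>{..x}. tr X y x' (u y (\<phi> y)))"
  proof (rule sum.mono_neutral_right)
    show "\<forall>y\<in>{..x'} - {..x}. tr X y x' (u y (\<phi> y)) = 0"
    proof
      fix y assume y: "y \<in> {..x'} - {..x}"
      then have "\<phi> y = 0" using \<phi> by (auto simp: sp_free_rep dest: spec[of _ y])
      then show "tr X y x' (u y (\<phi> y)) = 0"
        using y linear_between_zero[OF u 0] is_rep_tr_0[OF assms(3,4)] by simp
    qed
  qed (use le in auto)
  also have "\<dots> = (\<Sum>y\<in>{..x}. tr X x x' (tr X y x (u y (\<phi> y))))"
    using u_in le is_rep_tr_trans[OF assms(4)] by (intro sum.cong) auto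
  also have "\<dots> = tr X x x' (\<Sum>y\<in>{..x}. tr X y x (u y (\<phi> y)))" using u_in is_rep_tr_in[OF assms(4)]
    by (intro linear_between_sum[OF assms(3) is_rep_subspace[OF assms(4)] is_rep_linear[OF assms(4) le], symmetric]) auto
  finally show "(\<Sum>y\<in>{..x'}. tr X y x' (u y (tr (free_rep C) x x' \<phi> y))) =
      tr X x x' (\<Sum>y\<in>{..x}. tr X y x (u y (\<phi> y)))" by (simp add: tr_free_rep)
qed

lemma free_rep_expand:
  fixes C :: "'p::{finite,order} \<Rightarrow> 'v::ab_group_add set"
  assumes "\<phi> \<in> sp (free_rep C) x"
  shows "\<phi> = (\<Sum>y\<in>{..x}. single y (\<phi> y))"
proof
  fix z
  have "(\<Sum>y\<in>{..x}. single y (\<phi> y)) z = (\<Sum>y\<in>{..x}. if z = y then \<phi> y else 0)"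
    by (simp add: sum_fun_apply single_def)
  also have "\<dots> = \<phi> z" using assms by (auto simp: sp_free_rep dest: spec[of _ z])
  finally show "\<phi> z = (\<Sum>y\<in>{..x}. single y (\<phi> y)) z" by simp
qed

lemma free_rep_hom_eq:
  fixes C :: "'p::{finite,order} \<Rightarrow> 'v::ab_group_add set"
  assumes "vector_space s" "\<And>y. fin_dim_subspace s (C y)"
    and f: "rep_hom (fun_scale s) (free_rep C) t Y f" and \<phi>: "\<phi> \<in> sp (free_rep C) x"
  shows "f x \<phi> = (\<Sum>y\<in>{..x}. tr Y y x (f y (single y (\<phi> y))))"
proof -
  interpret s: vector_space s by fact
  have 0: "0 \<in> C y" for y using fin_dim_subspace_subspace[OF assms(2)] by (rule s.subspace_0)
  have C: "\<phi> y \<in> C y" if "y \<le> x" for y using \<phi> that by (auto simp: sp_free_rep dest: spec[of _ y])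
  have "f x \<phi> = f x (\<Sum>y\<in>{..x}. single y (\<phi> y))" using free_rep_expand[OF \<phi>] by simp
  also have "\<dots> = (\<Sum>y\<in>{..x}. f x (single y (\<phi> y)))"
    by (intro linear_between_sum[OF vector_space_fun_scale[OF assms(1)] is_rep_subspace[OF is_rep_free_rep[OF assms(1,2)]]
      rep_hom_linear[OF f]] single_in_free_rep C 0) auto
  also have "\<dots> = (\<Sum>y\<in>{..x}. tr Y y x (f y (single y (\<phi> y))))"
  proof (intro sum.cong refl)
    fix y assume "y \<in> {..x}"
    then show "f x (single y (\<phi> y)) = tr Y y x (f y (single y (\<phi> y)))"
      using rep_hom_tr[OF f, of y x "single y (\<phi> y)"] single_in_free_rep[of "\<phi> y" C y y, OF C 0 order_refl]
      by (simp add: tr_free_rep)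
  qed
  finally show ?thesis .
qed

text \<open>Linear sections of \<open>g\<close> exist at each vertex but need not commute with the
  structure maps. They are used only to lift generators; \<open>free_rep_hom\<close> extends these
  lifts to a homomorphism, and both sides agree because they agree on generators.\<close>

lemma rep_projective_free_rep:
  fixes C :: "'p::{finite,order} \<Rightarrow> 'v::ab_group_add set" and s :: "'k::field \<Rightarrow> 'v \<Rightarrow> 'v"
  assumes "vector_space s" "\<And>y. fin_dim_subspace s (C y)"
  shows "rep_projective (fun_scale s) (free_rep C)"
  unfolding rep_projective_def
proof (intro allI impI)
  fix X Y :: "('p, 'k) urep" and g f
  assume "is_rep uscale X \<and> is_rep uscale Y \<and> rep_hom uscale X uscale Y g \<and> rep_im X g = sp Y \<and>
    rep_hom (fun_scale s) (free_rep C) uscale Y f"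
  then have X: "is_rep uscale X" and Y: "is_rep uscale Y" and g: "rep_hom uscale X uscale Y g"
    and im: "\<And>x. g x ` sp X x = sp Y x" and f: "rep_hom (fun_scale s) (free_rep C) uscale Y f"
    by (auto simp: rep_im_def dest: fun_cong)
  note vs = vector_space_uscale[where 'k='k]
  interpret s: vector_space s by fact
  have 0: "0 \<in> C y" for y using fin_dim_subspace_subspace[OF assms(2)] by (rule s.subspace_0)
  have "\<exists>h. linear_between uscale (sp Y x) uscale (sp X x) h \<and> (\<forall>w\<in>sp Y x. g x (h w) = w)" for x
    using linear_between_section[OF vs vs is_rep_subspace[OF X] is_rep_subspace[OF Y] rep_hom_linear[OF g] im] by metis
  then obtain \<sigma> where \<sigma>: "\<And>x. linear_between uscale (sp Y x) uscale (sp X x) (\<sigma> x)"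
    "\<And>x w. w \<in> sp Y x \<Longrightarrow> g x (\<sigma> x w) = w" by metis
  have fs: "linear_between s (C y) uscale (sp Y y) (\<lambda>v. f y (single y v))" for y
    by (rule linear_between_compose[OF linear_between_mono[OF single_linear[OF assms(1)]] rep_hom_linear[OF f]])
      (auto intro: single_in_free_rep 0)
  define u where "u = (\<lambda>y v. \<sigma> y (f y (single y v)))"
  have u: "linear_between s (C y) uscale (sp X y) (u y)" for y
    unfolding u_def by (rule linear_between_compose[OF fs \<sigma>(1)])
  define h where "h = (\<lambda>x \<phi>. \<Sum>y\<in>{..x}. tr X y x (u y (\<phi> y)))"
  have "rep_hom (fun_scale s) (free_rep C) uscale X h"
    unfolding h_def by (rule free_rep_hom[OF assms vs X u])
  moreover have "g x (h x \<phi>) = f x \<phi>" if \<phi>: "\<phi> \<in> sp (free_rep C) x" for x \<phi>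
  proof -
    have C: "\<phi> y \<in> C y" if "y \<le> x" for y using \<phi> that by (auto simp: sp_free_rep dest: spec[of _ y])
    have u_in: "u y (\<phi> y) \<in> sp X y" if "y \<le> x" for y by (rule linear_between_in[OF u C[OF that]])
    have "g x (h x \<phi>) = (\<Sum>y\<in>{..x}. g x (tr X y x (u y (\<phi> y))))"
      unfolding h_def using u_in is_rep_tr_in[OF X]
      by (intro linear_between_sum[OF vs is_rep_subspace[OF X] rep_hom_linear[OF g]]) auto
    also have "\<dots> = (\<Sum>y\<in>{..x}. tr Y y x (f y (single y (\<phi> y))))"
    proof (intro sum.cong refl)
      fix y assume "y \<in> {..x}"
      then have y: "y \<le> x" by simp
      show "g x (tr X y x (u y (\<phi> y))) = tr Y y x (f y (single y (\<phi> y)))"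
        using rep_hom_tr[OF g y u_in[OF y]] \<sigma>(2)[OF linear_between_in[OF fs C[OF y]]] by (simp add: u_def)
    qed
    also have "\<dots> = f x \<phi>" by (rule free_rep_hom_eq[OF assms f \<phi>, symmetric])
    finally show ?thesis .
  qed
  ultimately show "\<exists>h. rep_hom (fun_scale s) (free_rep C) uscale X h \<and>
    (\<forall>x. \<forall>v\<in>sp (free_rep C) x. g x (h x v) = f x v)" by blast
qed

text \<open>The dual universal property: the coordinate at \<open>y\<close> is found by first moving
  to \<open>y\<close> and then applying \<open>u y\<close>.\<close>

lemma cofree_rep_hom:
  fixes C :: "'p::{finite,order} \<Rightarrow> 'v::ab_group_add set"
  assumes "vector_space s" "is_rep t X" and u: "\<And>y. linear_between t (sp X y) s (C y) (u y)"
  shows "rep_hom t X (fun_scale s) (cofree_rep C) (\<lambda>x v y. if x \<le> y then u y (tr X x y v) else 0)"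
proof (intro rep_homI linear_betweenI)
  interpret vector_space s by fact
  show "(\<lambda>y. if x \<le> y then u y (tr X x y v) else 0) \<in> sp (cofree_rep C) x" if "v \<in> sp X x" for x v
    using linear_between_in[OF u is_rep_tr_in[OF assms(2) _ that]] by (auto simp: sp_cofree_rep)
  show "(\<lambda>y. if x \<le> y then u y (tr X x y (v + w)) else 0) =
      (\<lambda>y. if x \<le> y then u y (tr X x y v) else 0) + (\<lambda>y. if x \<le> y then u y (tr X x y w) else 0)"
    if "v \<in> sp X x" "w \<in> sp X x" for x v w
    using that by (auto simp: fun_eq_iff linear_between_add[OF is_rep_linear[OF assms(2)]]
      linear_between_add[OF u] is_rep_tr_in[OF assms(2)])
  show "(\<lambda>y. if x \<le> y then u y (tr X x y (t c v)) else 0) =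
      fun_scale s c (\<lambda>y. if x \<le> y then u y (tr X x y v) else 0)"
    if "v \<in> sp X x" for x c v
    using that by (auto simp: fun_eq_iff fun_scale_def linear_between_scale[OF is_rep_linear[OF assms(2)]]
      linear_between_scale[OF u] is_rep_tr_in[OF assms(2)])
  show "(\<lambda>z. if y \<le> z then u z (tr X y z (tr X x y v)) else 0) =
      tr (cofree_rep C) x y (\<lambda>y. if x \<le> y then u y (tr X x y v) else 0)"
    if "x \<le> y" "v \<in> sp X x" for x y v
    using that by (auto simp: fun_eq_iff tr_cofree_rep is_rep_tr_trans[OF assms(2)] intro: order_trans)
qed

text \<open>Dual to the free case: left inverses \<open>l\<close> of \<open>g\<close> are linear but
  not natural, so of \<open>f y (l y w)\<close> only the coordinate at \<open>y\<close> itself is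
  kept. These coordinates determine a homomorphism into the cofree module.\<close>

lemma rep_injective_cofree_rep:
  fixes C :: "'p::{finite,order} \<Rightarrow> 'v::ab_group_add set" and s :: "'k::field \<Rightarrow> 'v \<Rightarrow> 'v"
  assumes "vector_space s" "\<And>y. fin_dim_subspace s (C y)"
  shows "rep_injective (fun_scale s) (cofree_rep C)"
  unfolding rep_injective_def
proof (intro allI impI)
  fix X Y :: "('p, 'k) urep" and g f
  assume "is_rep uscale X \<and> is_rep uscale Y \<and> rep_hom uscale X uscale Y g \<and> rep_inj X g \<and>
    rep_hom uscale X (fun_scale s) (cofree_rep C) f"
  then have X: "is_rep uscale X" and Y: "is_rep uscale Y" and g: "rep_hom uscale X uscale Y g"
    and inj: "\<And>x. inj_on (g x) (sp X x)" and f: "rep_hom uscale X (fun_scale s) (cofree_rep C) f"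
    by (auto simp: rep_inj_def)
  note vs = vector_space_uscale[where 'k='k]
  have "\<exists>h. linear_between uscale (sp Y x) uscale (sp X x) h \<and> (\<forall>v\<in>sp X x. h (g x v) = v)" for x
    using linear_between_left_inverse[OF vs vs is_rep_subspace[OF X] is_rep_subspace[OF Y] rep_hom_linear[OF g] inj] by metis
  then obtain l where l: "\<And>x. linear_between uscale (sp Y x) uscale (sp X x) (l x)"
    "\<And>x v. v \<in> sp X x \<Longrightarrow> l x (g x v) = v" by metis
  have ev: "linear_between (fun_scale s) (sp (cofree_rep C) y) s (C y) (\<lambda>\<phi>. \<phi> y)" for y
    by (intro linear_betweenI) (auto simp: sp_cofree_rep fun_scale_def dest: spec[of _ y])
  define u where "u = (\<lambda>y w. f y (l y w) y)"
  have u: "linear_between uscale (sp Y y) s (C y) (u y)" for y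
    unfolding u_def by (rule linear_between_compose[OF linear_between_compose[OF l(1) rep_hom_linear[OF f]] ev])
  define h where "h = (\<lambda>x w y. if x \<le> y then u y (tr Y x y w) else 0)"
  have "rep_hom uscale Y (fun_scale s) (cofree_rep C) h"
    unfolding h_def by (rule cofree_rep_hom[OF assms(1) Y u])
  moreover have "h x (g x v) = f x v" if v: "v \<in> sp X x" for x v
  proof
    fix y
    show "h x (g x v) y = f x v y"
    proof (cases "x \<le> y")
      case True
      have "h x (g x v) y = f y (tr X x y v) y"
        using True rep_hom_tr[OF g True v, symmetric] l(2)[OF is_rep_tr_in[OF X True v]] by (simp add: h_def u_def)
      also have "\<dots> = f x v y" using rep_hom_tr[OF f True v] by (simp add: tr_cofree_rep)
      finally show ?thesis .
    next
      case False
      then show ?thesis using rep_hom_in[OF f v] by (auto simp: h_def sp_cofree_rep dest: spec[of _ y])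
    qed
  qed
  ultimately show "\<exists>h. rep_hom uscale Y (fun_scale s) (cofree_rep C) h \<and>
    (\<forall>x. \<forall>v\<in>sp X x. h x (g x v) = f x v)" by blast
qed

lemma rep_projective_iso:
  fixes s :: "'k::field \<Rightarrow> 'v::ab_group_add \<Rightarrow> 'v"
  assumes "rep_projective s P" "iso_pair s P t P' \<phi> \<psi>"
  shows "rep_projective t P'"
  unfolding rep_projective_def
proof (intro allI impI)
  have \<phi>: "rep_hom s P t P' \<phi>" and \<psi>: "rep_hom t P' s P \<psi>"
    and \<phi>\<psi>: "\<And>x v. v \<in> sp P' x \<Longrightarrow> \<phi> x (\<psi> x v) = v"
    using assms(2) by (auto simp: iso_pair_def)
  fix X Y :: "(_, 'k) urep" and g f
  assume a: "is_rep uscale X \<and> is_rep uscale Y \<and> rep_hom uscale X uscale Y g \<and> rep_im X g = sp Y \<and>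
    rep_hom t P' uscale Y f"
  then have "rep_hom s P uscale Y (\<lambda>x v. f x (\<phi> x v))" by (blast intro: rep_hom_compose[OF \<phi>])
  then obtain h where h: "rep_hom s P uscale X h" "\<And>x v. v \<in> sp P x \<Longrightarrow> g x (h x v) = f x (\<phi> x v)"
    using assms(1) a unfolding rep_projective_def by blast
  have "g x (h x (\<psi> x v)) = f x v" if "v \<in> sp P' x" for x v
    using h(2)[OF rep_hom_in[OF \<psi> that]] \<phi>\<psi>[OF that] by simp
  then show "\<exists>h. rep_hom t P' uscale X h \<and> (\<forall>x. \<forall>v\<in>sp P' x. g x (h x v) = f x v)"
    using rep_hom_compose[OF \<psi> h(1)] by blast
qed

lemma rep_injective_iso:
  fixes s :: "'k::field \<Rightarrow> 'v::ab_group_add \<Rightarrow> 'v"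
  assumes "rep_injective s Q" "iso_pair s Q t Q' \<phi> \<psi>"
  shows "rep_injective t Q'"
  unfolding rep_injective_def
proof (intro allI impI)
  have \<phi>: "rep_hom s Q t Q' \<phi>" and \<psi>: "rep_hom t Q' s Q \<psi>"
    and \<phi>\<psi>: "\<And>x v. v \<in> sp Q' x \<Longrightarrow> \<phi> x (\<psi> x v) = v"
    using assms(2) by (auto simp: iso_pair_def)
  fix X Y :: "(_, 'k) urep" and g f
  assume a: "is_rep uscale X \<and> is_rep uscale Y \<and> rep_hom uscale X uscale Y g \<and> rep_inj X g \<and>
    rep_hom uscale X t Q' f"
  then have f: "rep_hom uscale X t Q' f" by blast
  from a have "rep_hom uscale X s Q (\<lambda>x v. \<psi> x (f x v))" by (blast intro: rep_hom_compose[OF _ \<psi>])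
  then obtain h where h: "rep_hom uscale Y s Q h" "\<And>x v. v \<in> sp X x \<Longrightarrow> h x (g x v) = \<psi> x (f x v)"
    using assms(1) a unfolding rep_injective_def by blast
  have "\<phi> x (h x (g x v)) = f x v" if "v \<in> sp X x" for x v
    using h(2)[OF that] \<phi>\<psi>[OF rep_hom_in[OF f that]] by simp
  then show "\<exists>h. rep_hom uscale Y t Q' h \<and> (\<forall>x. \<forall>v\<in>sp X x. h x (g x v) = f x v)"
    using rep_hom_compose[OF h(1) \<phi>] by blast
qed

lemma superfluous_iso:
  assumes "vector_space s" "vector_space t" "is_rep s P" "iso_pair s P t P' \<phi> \<psi>"
    and "superfluous s P (rep_ker P e)"
  shows "superfluous t P' (rep_ker P' (\<lambda>x v. e x (\<psi> x v)))"
proof (rule superfluousI)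
  have \<phi>: "rep_hom s P t P' \<phi>" and \<psi>: "rep_hom t P' s P \<psi>"
    and \<phi>\<psi>: "\<And>x v. v \<in> sp P' x \<Longrightarrow> \<phi> x (\<psi> x v) = v" and \<psi>\<phi>: "\<And>x v. v \<in> sp P x \<Longrightarrow> \<psi> x (\<phi> x v) = v"
    using assms(4) by (auto simp: iso_pair_def)
  fix X x w
  assume X: "subrep t P' X" and w: "w \<in> sp P' x"
    and sum: "\<And>x v. v \<in> sp P' x \<Longrightarrow> \<exists>a\<in>X x. \<exists>b\<in>rep_ker P' (\<lambda>x v. e x (\<psi> x v)) x. v = a + b"
  have XP: "X x \<subseteq> sp P' x" for x using X by (auto simp: subrep_def)
  have "(\<lambda>x. \<psi> x ` X x) = sp P"
  proof (rule superfluousD[OF assms(1,3,5) subrep_image[OF assms(2,1) \<psi> X]])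
    show "\<exists>a\<in>\<psi> x ` X x. \<exists>b\<in>rep_ker P e x. v = a + b" if v: "v \<in> sp P x" for x v
    proof -
      obtain a b where ab: "a \<in> X x" "b \<in> rep_ker P' (\<lambda>x v. e x (\<psi> x v)) x" "\<phi> x v = a + b"
        using sum[OF rep_hom_in[OF \<phi> v]] by blast
      have "a \<in> sp P' x" "b \<in> sp P' x" "e x (\<psi> x b) = 0" using ab XP by (auto simp: rep_ker_def)
      then have "v = \<psi> x a + \<psi> x b" "\<psi> x b \<in> rep_ker P e x"
        using \<psi>\<phi>[OF v] ab(3) linear_between_add[OF rep_hom_linear[OF \<psi>]] rep_hom_in[OF \<psi>]
        by (auto simp: rep_ker_def)
      then show ?thesis using ab(1) by blast
    qed
  qed (auto simp: rep_ker_def)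
  then have "\<psi> x w \<in> \<psi> x ` X x" using rep_hom_in[OF \<psi> w] by (metis (no_types))
  then obtain a where "a \<in> X x" "\<psi> x w = \<psi> x a" by blast
  moreover from this have "\<phi> x (\<psi> x a) = a" using XP \<phi>\<psi> by blast
  ultimately show "w \<in> X x" using \<phi>\<psi>[OF w] by simp
qed

lemma essential_iso:
  assumes "vector_space s" "vector_space t" "is_rep s Q" "is_rep t Q'" "iso_pair s Q t Q' \<phi> \<psi>"
    and "\<And>x. 0 \<in> K x" "\<And>x. K x \<subseteq> sp Q x" "essential s Q K"
  shows "essential t Q' (\<lambda>x. \<phi> x ` K x)"
proof (rule essentialI[OF _ assms(2)])
  have \<phi>: "rep_hom s Q t Q' \<phi>" and \<psi>: "rep_hom t Q' s Q \<psi>"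
    and \<phi>\<psi>: "\<And>x v. v \<in> sp Q' x \<Longrightarrow> \<phi> x (\<psi> x v) = v"
    using assms(5) by (auto simp: iso_pair_def)
  fix X x w
  assume X: "subrep t Q' X" and w: "w \<in> X x"
    and int: "\<And>x v. v \<in> X x \<Longrightarrow> v \<in> \<phi> x ` K x \<Longrightarrow> v = 0"
  have XQ: "X x \<subseteq> sp Q' x" for x using X by (auto simp: subrep_def)
  have z: "\<psi> x 0 = 0" "\<phi> x 0 = 0" for x by (rule rep_hom_0[OF assms(2,4) \<psi>] rep_hom_0[OF assms(1,3) \<phi>])+
  have "\<psi> x w = 0"
  proof (rule essentialD[OF assms(1,8) subrep_image[OF assms(2,1) \<psi> X] assms(6)])
    show "v = 0" if v: "v \<in> \<psi> x ` X x" "v \<in> K x" for x v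
    proof -
      obtain a where a: "a \<in> X x" "v = \<psi> x a" using v(1) by blast
      moreover have "\<phi> x (\<psi> x a) = a" using a(1) XQ \<phi>\<psi> by blast
      ultimately have "a = \<phi> x v" by simp
      then show ?thesis using int[OF a(1)] v(2) a(2) z by auto
    qed
  qed (use w in auto)
  then show "w = 0" using \<phi>\<psi>[of w x] XQ w z by auto
qed

text \<open>The cover is the free module on a complement of the radical inside \<open>N\<close>.
  Such a complement lifts the top of \<open>N\<close>, so the generators are just enough to reach
  everything.\<close>

lemma ex_projective_cover:
  fixes s :: "'k::field \<Rightarrow> 'v::ab_group_add \<Rightarrow> 'v" and N :: "('p::{finite,order}, 'v) rep"
  assumes "vector_space s" "is_rep s N"
  shows "\<exists>(P :: ('p, 'k) urep) e. is_rep uscale P \<and> rep_projective uscale P \<and> rep_hom uscale P s N e \<and>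
    rep_im P e = sp N \<and> superfluous uscale P (rep_ker P e)"
proof -
  interpret s: vector_space s by fact
  note vF = vector_space_fun_scale[OF assms(1)]
  interpret F: vector_space "fun_scale s" by (rule vF)
  note N = is_rep_subspace[OF assms(2)]
  \<comment> \<open>The radical at \<open>x\<close>: what arrives from strictly smaller
    vertices.\<close>
  define R where "R = (\<lambda>x. s.span (\<Union>y\<in>{..<x}. tr N y x ` sp N y))"
  have RN: "R x \<subseteq> sp N x" for x
    unfolding R_def using is_rep_tr_in[OF assms(2)] by (intro s.span_minimal N) auto
  have "\<exists>r. Vector_Spaces.linear s s r \<and> (\<forall>u\<in>R x. r u = u) \<and> range r \<subseteq> R x" for x
    using subspace_retraction[OF assms(1), of "R x"] by (metis R_def s.subspace_span)
  then obtain r where r: "\<And>x. Vector_Spaces.linear s s (r x)" "\<And>x u. u \<in> R x \<Longrightarrow> r x u = u"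
    "\<And>x. range (r x) \<subseteq> R x" by metis
  have rl: "linear_between s (sp N x) s (sp N x) (r x)" for x
    using r(3) RN by (intro linear_between_if_linear r(1)) blast
  \<comment> \<open>The kernel of the retraction onto \<open>R x\<close> is a complement of
    \<open>R x\<close> in \<open>sp N x\<close>.\<close>
  define C where "C = (\<lambda>x. {v \<in> sp N x. r x v = 0})"
  have CN: "C x \<subseteq> sp N x" for x by (auto simp: C_def)
  have C: "fin_dim_subspace s (C x)" for x unfolding C_def
    by (intro fin_dim_subspace_subset[OF assms(1) is_rep_fin_dim[OF assms(2)]]
      linear_between_kernel_subspace[OF assms(1,1) N rl]) auto
  have C0: "0 \<in> C x" for x using fin_dim_subspace_subspace[OF C] by (rule s.subspace_0)
  have CR: "v = 0" if "v \<in> C x" "v \<in> R x" for v x using that r(2) by (auto simp: C_def)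
  let ?P = "free_rep C"
  have P: "is_rep (fun_scale s) ?P" by (rule is_rep_free_rep[OF assms(1) C])
  define e where "e = (\<lambda>x \<phi>. \<Sum>y\<in>{..x}. tr N y x (\<phi> y))"
  have lid: "linear_between s (C y) s (sp N y) (\<lambda>v. v)" for y
    using CN by (intro linear_betweenI) auto
  have e: "rep_hom (fun_scale s) ?P s N e"
    unfolding e_def by (rule free_rep_hom[OF assms(1) C assms(1,2) lid])
  have e_single: "e x (single x v) = v" if "v \<in> C x" for x v
  proof -
    have "e x (single x v) = (\<Sum>y\<in>{..x}. if y = x then v else 0)"
      unfolding e_def using is_rep_tr_refl[OF assms(2) subsetD[OF CN that]] is_rep_tr_0[OF assms(1,2)]
      by (intro sum.cong) (auto simp: single_def)
    then show ?thesis by simp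
  qed
  \<comment> \<open>Induction up the poset: \<open>R x\<close> is reached because its sources below
    \<open>x\<close> are, and \<open>C x\<close> is reached by the generators placed at
    \<open>x\<close>.\<close>
  have surj: "sp N x \<subseteq> e x ` sp ?P x" for x
  proof (induction x rule: finite_order_induct)
    case (1 x)
    have sub: "s.subspace (e x ` sp ?P x)"
      by (rule linear_between_image_subspace[OF vF assms(1) is_rep_subspace[OF P] subset_refl rep_hom_linear[OF e]])
    have "tr N y x w \<in> e x ` sp ?P x" if yw: "y < x" "w \<in> sp N y" for y w
    proof -
      obtain \<phi> where \<phi>: "\<phi> \<in> sp ?P y" "w = e y \<phi>" using 1[OF yw(1)] yw(2) by blast
      have "tr N y x w = e x (tr ?P y x \<phi>)" using rep_hom_tr[OF e _ \<phi>(1), of x] yw(1) \<phi>(2) by simp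
      then show ?thesis using is_rep_tr_in[OF P _ \<phi>(1), of x] yw(1) by auto
    qed
    then have Rim: "R x \<subseteq> e x ` sp ?P x" unfolding R_def by (intro s.span_minimal sub) auto
    show ?case
    proof
      fix v assume v: "v \<in> sp N x"
      have rv: "r x v \<in> R x" using r(3) by blast
      have "r x (v - r x v) = 0"
        using linear_between_diff[OF assms(1) N rl v subsetD[OF RN rv]] r(2)[OF rv] by simp
      then have c: "v - r x v \<in> C x" using s.subspace_diff[OF N v subsetD[OF RN rv]] by (simp add: C_def)
      then have "v - r x v \<in> e x ` sp ?P x"
        using e_single[OF c] single_in_free_rep[of "v - r x v" C x x, OF c C0 order_refl]
        by (intro image_eqI[of _ _ "single x (v - r x v)"]) auto
      then have "(v - r x v) + r x v \<in> e x ` sp ?P x" using rv Rim by (intro s.subspace_add[OF sub]) auto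
      then show "v \<in> e x ` sp ?P x" by simp
    qed
  qed
  have im: "rep_im ?P e = sp N" using surj rep_hom_in[OF e] by (auto simp: rep_im_def fun_eq_iff)
  have sup: "superfluous (fun_scale s) ?P (rep_ker ?P e)"
  proof (rule superfluousI)
    fix X x \<phi>
    assume X: "subrep (fun_scale s) ?P X" and \<phi>: "\<phi> \<in> sp ?P x"
      and sum: "\<And>x v. v \<in> sp ?P x \<Longrightarrow> \<exists>a\<in>X x. \<exists>b\<in>rep_ker ?P e x. v = a + b"
    have Xs: "F.subspace (X x)" for x using X by (auto simp: subrep_def)
    have "sp ?P x \<subseteq> X x" for x
    proof (induction x rule: finite_order_induct)
      case (1 x)
      show ?case
      proof
        fix \<phi> assume "\<phi> \<in> sp ?P x"
        then obtain a b where ab: "a \<in> X x" "b \<in> sp ?P x" "e x b = 0" "\<phi> = a + b"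
          using sum unfolding rep_ker_def by blast
        have bC: "b y \<in> C y" if "y \<le> x" for y using ab(2) that by (auto simp: sp_free_rep dest: spec[of _ y])
        \<comment> \<open>As \<open>e x b = 0\<close>, the coordinate \<open>b x\<close> is minus a
          sum of vectors arriving from below. It also lies in the complement \<open>C x\<close>, so
          it is 0. The other coordinates of \<open>b\<close> live at smaller vertices, where the
          induction has already put them into \<open>X\<close>.\<close>
        have "b x \<in> R x"
        proof -
          have "0 = (\<Sum>y\<in>insert x {..<x}. tr N y x (b y))"
          proof -
            have "insert x {..<x} = {..x}" by (auto simp: le_less)
            then show ?thesis using ab(3) by (simp add: e_def)
          qed
          also have "\<dots> = b x + (\<Sum>y\<in>{..<x}. tr N y x (b y))"
            using is_rep_tr_refl[OF assms(2), of "b x" x] bC[of x] CN[of x] by auto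
          finally have "b x = - (\<Sum>y\<in>{..<x}. tr N y x (b y))" by (simp add: eq_neg_iff_add_eq_0)
          moreover have "(\<Sum>y\<in>{..<x}. tr N y x (b y)) \<in> R x" unfolding R_def
          proof (rule s.span_sum, rule s.span_base)
            fix y assume y: "y \<in> {..<x}"
            then have "b y \<in> sp N y" by (intro subsetD[OF CN bC]) simp
            then show "tr N y x (b y) \<in> (\<Union>y\<in>{..<x}. tr N y x ` sp N y)" using y by blast
          qed
          ultimately show ?thesis unfolding R_def by (simp add: s.span_neg)
        qed
        then have "b x = 0" using CR bC by blast
        have "single y (b y) \<in> X x" if "y \<le> x" for y
        proof (cases "y = x")
          case True
          have "single y (b y) = 0" using True \<open>b x = 0\<close> by (auto simp: single_def)
          then show ?thesis using F.subspace_0[OF Xs] by simp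
        next
          case False
          then have "y < x" using that by simp
          then have "single y (b y) \<in> X y"
            using 1 single_in_free_rep[of "b y" C y y, OF bC[OF that] C0 order_refl] by blast
          moreover have "tr ?P y x ` X y \<subseteq> X x" using X that by (auto simp: subrep_def)
          ultimately show ?thesis by (auto simp: tr_free_rep)
        qed
        then have "b \<in> X x" by (subst free_rep_expand[OF ab(2)]) (intro F.subspace_sum[OF Xs], auto)
        then show "\<phi> \<in> X x" using ab F.subspace_add[OF Xs] by blast
      qed
    qed
    then show "\<phi> \<in> X x" using \<phi> by blast
  qed
  obtain P' :: "('p, 'k) urep" and \<phi> \<psi> where P': "is_rep uscale P'" and iso: "iso_pair (fun_scale s) ?P uscale P' \<phi> \<psi>"
    using ex_urep[OF vF P] .
  then have \<phi>: "rep_hom (fun_scale s) ?P uscale P' \<phi>" and \<psi>: "rep_hom uscale P' (fun_scale s) ?P \<psi>"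
    and \<psi>\<phi>: "\<And>x v. v \<in> sp ?P x \<Longrightarrow> \<psi> x (\<phi> x v) = v"
    by (auto simp: iso_pair_def)
  let ?e = "\<lambda>x v. e x (\<psi> x v)"
  have hom: "rep_hom uscale P' s N ?e" by (rule rep_hom_compose[OF \<psi> e])
  have "rep_im P' ?e x = sp N x" for x
  proof
    show "rep_im P' ?e x \<subseteq> sp N x" using rep_hom_in[OF hom] by (auto simp: rep_im_def)
    show "sp N x \<subseteq> rep_im P' ?e x"
    proof
      fix v assume "v \<in> sp N x"
      then obtain w where "w \<in> sp ?P x" "v = e x w" using surj by blast
      then have "\<phi> x w \<in> sp P' x" "v = ?e x (\<phi> x w)" using rep_hom_in[OF \<phi>] \<psi>\<phi> by auto
      then show "v \<in> rep_im P' ?e x" unfolding rep_im_def by (intro image_eqI)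
    qed
  qed
  then have "rep_im P' ?e = sp N" by (rule ext)
  then show ?thesis using P' hom rep_projective_iso[OF rep_projective_free_rep[OF assms(1) C] iso]
      superfluous_iso[OF vF vector_space_uscale P iso sup] by blast
qed

text \<open>The envelope is the cofree module on the socle. The map into it records, for each
  \<open>y\<close> above \<open>x\<close>, the socle part of the image at \<open>y\<close>, read off
  by a linear retraction \<open>r y\<close>.\<close>

lemma ex_injective_envelope:
  fixes s :: "'k::field \<Rightarrow> 'v::ab_group_add \<Rightarrow> 'v" and N :: "('p::{finite,order}, 'v) rep"
  assumes "vector_space s" "is_rep s N"
  shows "\<exists>(Q :: ('p, 'k) urep) e. is_rep uscale Q \<and> rep_injective uscale Q \<and> rep_hom s N uscale Q e \<and>
    rep_inj N e \<and> essential uscale Q (rep_im N e)"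
proof -
  interpret s: vector_space s by fact
  note vF = vector_space_fun_scale[OF assms(1)]
  interpret F: vector_space "fun_scale s" by (rule vF)
  note N = is_rep_subspace[OF assms(2)]
  \<comment> \<open>The socle at \<open>x\<close>: vectors killed by every map to a strictly larger
    vertex.\<close>
  define S where "S = (\<lambda>x. {v \<in> sp N x. \<forall>z>x. tr N x z v = 0})"
  have SN: "S x \<subseteq> sp N x" for x by (auto simp: S_def)
  have Ss: "s.subspace (S x)" for x
    using s.subspace_0[OF N] s.subspace_add[OF N] s.subspace_scale[OF N]
      linear_between_add[OF is_rep_linear[OF assms(2)]] linear_between_scale[OF is_rep_linear[OF assms(2)]]
      is_rep_tr_0[OF assms(1,2)] by (intro s.subspaceI) (auto simp: S_def less_imp_le)
  have S: "fin_dim_subspace s (S x)" for x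
    by (rule fin_dim_subspace_subset[OF assms(1) is_rep_fin_dim[OF assms(2)] Ss SN])
  have "\<exists>r. Vector_Spaces.linear s s r \<and> (\<forall>u\<in>S x. r u = u) \<and> range r \<subseteq> S x" for x
    using subspace_retraction[OF assms(1) Ss] by metis
  then obtain r where r: "\<And>x. Vector_Spaces.linear s s (r x)" "\<And>x u. u \<in> S x \<Longrightarrow> r x u = u"
    "\<And>x. range (r x) \<subseteq> S x" by metis
  have rl: "linear_between s (sp N x) s (S x) (r x)" for x
    using r(3) by (intro linear_between_if_linear r(1)) blast
  have r0: "r x 0 = 0" for x by (rule linear_between_zero[OF rl is_rep_0[OF assms]])
  let ?Q = "cofree_rep S"
  have Q: "is_rep (fun_scale s) ?Q" by (rule is_rep_cofree_rep[OF assms(1) S])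
  define e where "e = (\<lambda>x v y. if x \<le> y then r y (tr N x y v) else 0)"
  have e: "rep_hom s N (fun_scale s) ?Q e" unfolding e_def by (rule cofree_rep_hom[OF assms rl])
  have inj: "v = 0" if v: "v \<in> sp N x" "e x v = 0" for x v
  proof (rule ccontr)
    assume "v \<noteq> 0"
    \<comment> \<open>At a maximal vertex that \<open>v\<close> reaches without dying, its image is
      in the socle. There the retraction is the identity, so \<open>e x v\<close> has a nonzero
      coordinate.\<close>
    define A where "A = {y. x \<le> y \<and> tr N x y v \<noteq> 0}"
    have "x \<in> A" using \<open>v \<noteq> 0\<close> is_rep_tr_refl[OF assms(2) v(1)] by (simp add: A_def)
    then obtain y where y: "y \<in> A" "\<And>z. z \<in> A \<Longrightarrow> y \<le> z \<Longrightarrow> y = z"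
      using finite_has_maximal[of A] by auto
    then have xy: "x \<le> y" by (simp add: A_def)
    have "tr N y z (tr N x y v) = 0" if "y < z" for z
      using y(2)[of z] that xy is_rep_tr_trans[OF assms(2) xy _ v(1), of z]
      by (auto simp: A_def less_imp_le intro: order_trans)
    then have "tr N x y v \<in> S y" using is_rep_tr_in[OF assms(2) xy v(1)] by (simp add: S_def)
    then have "e x v y = tr N x y v" using xy r(2) by (simp add: e_def)
    then show False using v(2) y(1) by (simp add: A_def)
  qed
  have ess: "essential (fun_scale s) ?Q (rep_im N e)"
  proof (rule essentialI[OF _ vF])
    fix X x \<phi>
    assume X: "subrep (fun_scale s) ?Q X" and \<phi>: "\<phi> \<in> X x"
      and int: "\<And>x v. v \<in> X x \<Longrightarrow> v \<in> rep_im N e x \<Longrightarrow> v = 0"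
    have \<phi>Q: "\<phi> \<in> sp ?Q x" using X \<phi> by (auto simp: subrep_def)
    show "\<phi> = 0"
    proof (rule ccontr)
      assume "\<phi> \<noteq> 0"
      \<comment> \<open>Moving \<phi> to a maximal vertex \<open>y\<close> of its support leaves
        only the coordinate \<open>\<phi> y\<close>. This lies in \<open>S y\<close>, so the result
        equals \<open>e y (\<phi> y)\<close>: a nonzero vector common to \<open>X\<close> and the
        image of \<open>N\<close>.\<close>
      define A where "A = {y. \<phi> y \<noteq> 0}"
      have "A \<noteq> {}" using \<open>\<phi> \<noteq> 0\<close> by (auto simp: A_def fun_eq_iff)
      then obtain y where y: "y \<in> A" "\<And>z. z \<in> A \<Longrightarrow> y \<le> z \<Longrightarrow> y = z"
        using finite_has_maximal[of A] by auto
      have xy: "x \<le> y" "\<phi> y \<in> S y"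
        using \<phi>Q y(1) by (auto simp: sp_cofree_rep A_def split: if_splits dest: spec[of _ y])
      have tr: "tr ?Q x y \<phi> z = (if z = y then \<phi> y else 0)" for z
        using y by (auto simp: tr_cofree_rep A_def)
      have "e y (\<phi> y) z = (if z = y then \<phi> y else 0)" for z
        using xy(2) is_rep_tr_refl[OF assms(2)] r(2) r0 by (auto simp: e_def S_def less_le)
      then have "tr ?Q x y \<phi> = e y (\<phi> y)" using tr by auto
      then have "tr ?Q x y \<phi> \<in> rep_im N e y" using xy(2) SN by (auto simp: rep_im_def)
      moreover have "tr ?Q x y ` X x \<subseteq> X y" using X xy(1) by (auto simp: subrep_def)
      then have "tr ?Q x y \<phi> \<in> X y" using \<phi> by blast
      ultimately have "tr ?Q x y \<phi> = 0" using int by blast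
      then show False using tr[of y] y(1) by (simp add: A_def)
    qed
  qed
  obtain Q' :: "('p, 'k) urep" and \<phi> \<psi> where Q': "is_rep uscale Q'" and iso: "iso_pair (fun_scale s) ?Q uscale Q' \<phi> \<psi>"
    using ex_urep[OF vF Q] .
  then have \<phi>: "rep_hom (fun_scale s) ?Q uscale Q' \<phi>"
    and \<psi>\<phi>: "\<And>x v. v \<in> sp ?Q x \<Longrightarrow> \<psi> x (\<phi> x v) = v" and \<psi>: "rep_hom uscale Q' (fun_scale s) ?Q \<psi>"
    by (auto simp: iso_pair_def)
  let ?e = "\<lambda>x v. \<phi> x (e x v)"
  have hom: "rep_hom s N uscale Q' ?e" by (rule rep_hom_compose[OF e \<phi>])
  have "rep_inj N ?e" unfolding rep_inj_def
  proof (intro allI linear_between_inj_onI[OF assms(1) N rep_hom_linear[OF hom]])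
    fix x v assume v: "v \<in> sp N x" "?e x v = 0"
    have "e x v = \<psi> x 0" using \<psi>\<phi>[OF rep_hom_in[OF e v(1)]] v(2) by simp
    then show "v = 0" using inj[OF v(1)] rep_hom_0[OF vector_space_uscale Q' \<psi>] by simp
  qed
  moreover have "essential uscale Q' (\<lambda>x. \<phi> x ` rep_im N e x)"
  proof (rule essential_iso[OF vF vector_space_uscale Q Q' iso _ _ ess])
    show "0 \<in> rep_im N e x" for x
      using rep_hom_0[OF assms e, of x] is_rep_0[OF assms] by (auto simp: rep_im_def intro!: rev_image_eqI)
    show "rep_im N e x \<subseteq> sp ?Q x" for x using rep_hom_in[OF e] by (auto simp: rep_im_def)
  qed
  then have "essential uscale Q' (rep_im N ?e)" by (simp add: rep_im_def image_image)
  ultimately show ?thesis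
    using Q' hom rep_injective_iso[OF rep_injective_cofree_rep[OF assms(1) S] iso] by blast
qed

subsection \<open>Minimal resolutions\<close>

lemma rep_hom_restrict_codomain:
  "rep_hom s A t (B\<lparr>sp := X\<rparr>) f \<Longrightarrow> (\<And>x. X x \<subseteq> sp B x) \<Longrightarrow> rep_hom s A t B f"
  by (force simp: rep_hom_def linear_between_def)

lemma rep_hom_into_restrict:
  "rep_hom s A t B f \<Longrightarrow> (\<And>x v. v \<in> sp A x \<Longrightarrow> f x v \<in> X x) \<Longrightarrow> rep_hom s A t (B\<lparr>sp := X\<rparr>) f"
  by (auto simp: rep_hom_def linear_between_def)

lemma ex_min_proj_res:
  fixes s :: "'k::field \<Rightarrow> 'v::ab_group_add \<Rightarrow> 'v" and N :: "('p::{finite,order}, 'v) rep"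
  assumes "vector_space s" "is_rep s N"
  shows "\<exists>P e d. min_proj_res s N P e d"
proof -
  note vs = vector_space_uscale[where 'k='k]
  obtain P0 :: "('p, 'k) urep" and e where P0: "is_rep uscale P0" "rep_projective uscale P0"
    "rep_hom uscale P0 s N e" "rep_im P0 e = sp N" "superfluous uscale P0 (rep_ker P0 e)"
    using ex_projective_cover[OF assms] by blast
  \<comment> \<open>The module hypothesis sits under the existential so that covers can be chosen by
    functions defined on every \<open>K\<close>, as the recursion below requires.\<close>
  have "\<exists>(P :: ('p, 'k) urep) e. is_rep uscale K \<longrightarrow> is_rep uscale P \<and> rep_projective uscale P \<and> rep_hom uscale P uscale K e \<and>
    rep_im P e = sp K \<and> superfluous uscale P (rep_ker P e)" for K :: "('p, 'k) urep"
    using ex_projective_cover[OF vs] by blast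
  then obtain Pc :: "('p, 'k) urep \<Rightarrow> ('p, 'k) urep" and ec where c: "\<And>K. is_rep uscale K \<Longrightarrow> is_rep uscale (Pc K)"
    "\<And>K. is_rep uscale K \<Longrightarrow> rep_projective uscale (Pc K)"
    "\<And>K. is_rep uscale K \<Longrightarrow> rep_hom uscale (Pc K) uscale K (ec K)"
    "\<And>K. is_rep uscale K \<Longrightarrow> rep_im (Pc K) (ec K) = sp K"
    "\<And>K. is_rep uscale K \<Longrightarrow> superfluous uscale (Pc K) (rep_ker (Pc K) (ec K))" by metis
  \<comment> \<open>\<open>K j\<close> is the kernel of the map leaving the \<open>j\<close>-th
    term, with that term's structure maps; its cover is the next term.\<close>
  define K where "K = rec_nat (P0\<lparr>sp := rep_ker P0 e\<rparr>) (\<lambda>_ K. (Pc K)\<lparr>sp := rep_ker (Pc K) (ec K)\<rparr>)"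
  have K0: "K 0 = P0\<lparr>sp := rep_ker P0 e\<rparr>" and KS: "K (Suc j) = (Pc (K j))\<lparr>sp := rep_ker (Pc (K j)) (ec (K j))\<rparr>" for j
    by (simp_all add: K_def)
  have K: "is_rep uscale (K j)" for j
  proof (induction j)
    case 0
    show ?case unfolding K0 by (rule is_rep_restrict[OF vs P0(1) subrep_ker[OF vs assms(1) P0(1) assms(2) P0(3)]])
  next
    case (Suc j)
    show ?case unfolding KS by (rule is_rep_restrict[OF vs c(1)[OF Suc] subrep_ker[OF vs vs c(1)[OF Suc] Suc c(3)[OF Suc]]])
  qed
  define P where "P = case_nat P0 (\<lambda>j. Pc (K j))"
  define d where "d = (\<lambda>j. ec (K j))"
  have P_simps: "P 0 = P0" "P (Suc j) = Pc (K j)" for j by (simp_all add: P_def)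
  have inc: "sp (K j) x \<subseteq> sp (P j) x" and trK: "K j = (P j)\<lparr>sp := sp (K j)\<rparr>" for j x
    by (cases j; simp add: K0 KS P_simps rep_ker_def Collect_mono_iff)+
  have "rep_hom uscale (P (Suc j)) uscale (P j) (d j)" for j
  proof (rule rep_hom_restrict_codomain)
    show "rep_hom uscale (P (Suc j)) uscale ((P j)\<lparr>sp := sp (K j)\<rparr>) (d j)"
      using c(3)[OF K[of j]] trK[of j] by (simp add: P_simps d_def)
  qed (rule inc)
  moreover have "is_rep uscale (P j) \<and> rep_projective uscale (P j)" for j
    by (cases j) (simp_all add: P_simps P0 c K)
  moreover have "rep_im (P (Suc j)) (d j) = sp (K j)" for j by (simp add: P_simps d_def c(4)[OF K])
  moreover have "sp (K 0) = rep_ker (P 0) e" "sp (K (Suc j)) = rep_ker (P (Suc j)) (d j)" for j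
    by (simp_all add: K0 KS P_simps d_def)
  moreover have "superfluous uscale (P (Suc j)) (rep_ker (P (Suc j)) (d j))" for j
    by (simp add: P_simps d_def c(5)[OF K])
  moreover have "rep_hom uscale (P 0) s N e" "rep_im (P 0) e = sp N" "superfluous uscale (P 0) (rep_ker (P 0) e)"
    by (simp_all add: P_simps P0)
  ultimately have "min_proj_res s N P e d" unfolding min_proj_res_def One_nat_def by simp
  then show ?thesis by blast
qed

text \<open>The quotient is modelled by a complement of \<open>X\<close>, with projection the
  identity minus a retraction onto \<open>X\<close>. It stays on the carrier of \<open>Q\<close>,
  which lets it be iterated; cosets would change the type at every stage.\<close>

lemma ex_cokernel:
  fixes s :: "'k::field \<Rightarrow> 'v::ab_group_add \<Rightarrow> 'v" and Q :: "('p::order, 'v) rep"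
  assumes "vector_space s" "is_rep s Q" "subrep s Q X"
  shows "\<exists>C p. is_rep s C \<and> rep_hom s Q s C p \<and> rep_im Q p = sp C \<and> rep_ker Q p = X"
proof -
  interpret vector_space s by fact
  note Q = is_rep_subspace[OF assms(2)]
  have X: "subspace (X x)" "X x \<subseteq> sp Q x" "x \<le> y \<Longrightarrow> tr Q x y ` X x \<subseteq> X y" for x y
    using assms(3) by (auto simp: subrep_def)
  have "\<exists>r. Vector_Spaces.linear s s r \<and> (\<forall>u\<in>X x. r u = u) \<and> range r \<subseteq> X x" for x
    using subspace_retraction[OF assms(1) X(1)] by metis
  then obtain r where r: "\<And>x. Vector_Spaces.linear s s (r x)" "\<And>x u. u \<in> X x \<Longrightarrow> r x u = u"
    "\<And>x. range (r x) \<subseteq> X x" by metis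
  have rX: "r x v \<in> X x" for x v using r(3) by blast
  have rl: "linear_between s (sp Q x) s (sp Q x) (r x)" for x
    using r(3) X(2) by (intro linear_between_if_linear r(1)) blast
  define p where "p = (\<lambda>x v. v - r x v)"
  have pl: "linear_between s (sp Q x) s (sp Q x) (p x)" for x
    unfolding p_def by (rule linear_between_diff_fun[OF assms(1) Q _ rl]) (auto simp: linear_between_def)
  \<comment> \<open>The complement need not be stable under the structure maps of \<open>Q\<close>,
    so each of them is followed by the projection \<open>p\<close>.\<close>
  define C where "C = \<lparr>sp = (\<lambda>x. p x ` sp Q x), tr = (\<lambda>x y v. p y (tr Q x y v))\<rparr>"
  have p0: "p x v = 0 \<longleftrightarrow> v \<in> X x" for x v using r(2)[of v x] rX[of x v] by (auto simp: p_def)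
  have CQ: "p x ` sp Q x \<subseteq> sp Q x" for x using linear_between_in[OF pl] by blast
  have pp: "p x (p x v) = p x v" if "v \<in> sp Q x" for x v
    using linear_between_diff[OF assms(1) Q rl that subsetD[OF X(2) rX], of v] r(2)[OF rX] by (simp add: p_def)
  have ptr: "p y (tr Q x y (p x v)) = p y (tr Q x y v)" if "x \<le> y" "v \<in> sp Q x" for x y v
  proof -
    have rQ: "r x v \<in> sp Q x" using rX X(2) by blast
    have "tr Q x y (r x v) \<in> X y" using X(3)[OF that(1)] rX by blast
    then have "p y (tr Q x y (r x v)) = 0" by (simp add: p0)
    moreover have "tr Q x y (p x v) = tr Q x y v - tr Q x y (r x v)"
      unfolding p_def by (rule linear_between_diff[OF assms(1) Q is_rep_linear[OF assms(2) that(1)] that(2) rQ])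
    ultimately show ?thesis
      using linear_between_diff[OF assms(1) Q pl is_rep_tr_in[OF assms(2) that] is_rep_tr_in[OF assms(2) that(1) rQ]] by simp
  qed
  have hp: "linear_between s (sp Q x) s (sp C x) (p x)" for x
    by (rule linear_between_mono[OF pl]) (auto simp: C_def)
  have "is_rep s C" unfolding is_rep_def
  proof (intro conjI allI impI ballI)
    show "fin_dim_subspace s (sp C x)" for x
      using fin_dim_subspace_image[OF assms(1,1) is_rep_fin_dim[OF assms(2)] Q pl] by (simp add: C_def)
    show "linear_between s (sp C x) s (sp C y) (tr C x y)" if "x \<le> y" for x y
    proof -
      have "sp C x \<subseteq> sp Q x" using CQ by (simp add: C_def)
      then have "linear_between s (sp C x) s (sp Q y) (tr Q x y)"
        using is_rep_tr_in[OF assms(2) that] by (intro linear_between_mono[OF is_rep_linear[OF assms(2) that]]) auto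
      from linear_between_compose[OF this hp[of y]] show ?thesis by (simp add: C_def)
    qed
    show "tr C x x v = v" if "v \<in> sp C x" for x v
      using that pp CQ[of x] is_rep_tr_refl[OF assms(2)] by (auto simp: C_def image_subset_iff)
    show "tr C x z v = tr C y z (tr C x y v)" if "x \<le> y \<and> y \<le> z" "v \<in> sp C x" for x y z v
    proof -
      have v: "v \<in> sp Q x" using that(2) CQ[of x] by (auto simp: C_def)
      then show ?thesis
        using that(1) ptr[of y z "tr Q x y v"] is_rep_tr_in[OF assms(2) _ v] is_rep_tr_trans[OF assms(2) _ _ v]
        by (simp add: C_def)
    qed
  qed
  moreover have "rep_hom s Q s C p" by (rule rep_homI[OF hp]) (simp add: C_def ptr)
  moreover have "rep_im Q p = sp C" by (simp add: rep_im_def C_def)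
  moreover have "rep_ker Q p = X" using X(2) by (auto simp: rep_ker_def p0 fun_eq_iff)
  ultimately show ?thesis by blast
qed

lemma ex_min_inj_cores:
  fixes s :: "'k::field \<Rightarrow> 'v::ab_group_add \<Rightarrow> 'v" and N :: "('p::{finite,order}, 'v) rep"
  assumes "vector_space s" "is_rep s N"
  shows "\<exists>Q e d. min_inj_cores s N Q e d"
proof -
  note vs = vector_space_uscale[where 'k='k]
  obtain Q0 :: "('p, 'k) urep" and e where Q0: "is_rep uscale Q0" "rep_injective uscale Q0"
    "rep_hom s N uscale Q0 e" "rep_inj N e" "essential uscale Q0 (rep_im N e)"
    using ex_injective_envelope[OF assms] by blast
  have "\<exists>(Q :: ('p, 'k) urep) e. is_rep uscale C \<longrightarrow> is_rep uscale Q \<and> rep_injective uscale Q \<and>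
    rep_hom uscale C uscale Q e \<and> rep_inj C e \<and> essential uscale Q (rep_im C e)" for C :: "('p, 'k) urep"
    using ex_injective_envelope[OF vs] by blast
  then obtain Qc :: "('p, 'k) urep \<Rightarrow> ('p, 'k) urep" and ec where c: "\<And>C. is_rep uscale C \<Longrightarrow> is_rep uscale (Qc C)"
    "\<And>C. is_rep uscale C \<Longrightarrow> rep_injective uscale (Qc C)"
    "\<And>C. is_rep uscale C \<Longrightarrow> rep_hom uscale C uscale (Qc C) (ec C)"
    "\<And>C. is_rep uscale C \<Longrightarrow> rep_inj C (ec C)"
    "\<And>C. is_rep uscale C \<Longrightarrow> essential uscale (Qc C) (rep_im C (ec C))" by metis
  have "\<exists>C p. is_rep uscale (fst S) \<and> subrep uscale (fst S) (snd S) \<longrightarrow>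
      is_rep uscale C \<and> rep_hom uscale (fst S) uscale C p \<and> rep_im (fst S) p = sp C \<and> rep_ker (fst S) p = snd S"
    for S :: "('p, 'k) urep \<times> ('p \<Rightarrow> (nat \<Rightarrow> 'k) set)"
    using ex_cokernel[OF vs, of "fst S" "snd S"] by blast
  then obtain cok :: "('p, 'k) urep \<times> ('p \<Rightarrow> (nat \<Rightarrow> 'k) set) \<Rightarrow> ('p, 'k) urep" where
    "\<And>S. \<exists>p. is_rep uscale (fst S) \<and> subrep uscale (fst S) (snd S) \<longrightarrow>
      is_rep uscale (cok S) \<and> rep_hom uscale (fst S) uscale (cok S) p \<and> rep_im (fst S) p = sp (cok S) \<and>
      rep_ker (fst S) p = snd S" by metis
  then obtain pk where
    k': "\<And>S. is_rep uscale (fst S) \<and> subrep uscale (fst S) (snd S) \<longrightarrow>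
      is_rep uscale (cok S) \<and> rep_hom uscale (fst S) uscale (cok S) (pk S) \<and> rep_im (fst S) (pk S) = sp (cok S) \<and>
      rep_ker (fst S) (pk S) = snd S" by metis
  note k = k'[rule_format, THEN conjunct1, OF conjI] k'[rule_format, THEN conjunct2, THEN conjunct1, OF conjI]
    k'[rule_format, THEN conjunct2, THEN conjunct2, THEN conjunct1, OF conjI]
    k'[rule_format, THEN conjunct2, THEN conjunct2, THEN conjunct2, OF conjI]
  \<comment> \<open>The state at stage \<open>j\<close> is the term \<open>Q j\<close> together with
    the image entering it; the next term is the envelope of the cokernel of that image.\<close>
  define S where "S = rec_nat (Q0, rep_im N e) (\<lambda>_ S. (Qc (cok S), rep_im (cok S) (ec (cok S))))"
  have S0: "S 0 = (Q0, rep_im N e)" and SS: "S (Suc j) = (Qc (cok (S j)), rep_im (cok (S j)) (ec (cok (S j))))" for j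
    by (simp_all add: S_def)
  have S: "is_rep uscale (fst (S j)) \<and> subrep uscale (fst (S j)) (snd (S j))" for j
  proof (induction j)
    case 0
    show ?case using Q0(1) subrep_im[OF assms(1) vs assms(2) Q0(3)] by (simp add: S0)
  next
    case (Suc j)
    then have "is_rep uscale (cok (S j))" using k(1) by blast
    then show ?case using c(1) subrep_im[OF vs vs _ c(3)] by (simp add: SS)
  qed
  have C: "is_rep uscale (cok (S j))" for j using S k(1) by blast
  define Q where "Q = (\<lambda>j. fst (S j))"
  define d where "d = (\<lambda>j x v. ec (cok (S j)) x (pk (S j) x v))"
  have hp: "rep_hom uscale (Q j) uscale (cok (S j)) (pk (S j))" for j using S k(2) by (simp add: Q_def)
  have hd: "rep_hom uscale (Q j) uscale (Q (Suc j)) (d j)" for j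
    using rep_hom_compose[OF hp c(3)[OF C]] by (simp add: d_def Q_def SS)
  have ker: "rep_ker (Q j) (d j) = snd (S j)" for j
  proof -
    \<comment> \<open>The differential is the cokernel projection followed by an embedding, so its
      kernel is that of the projection alone.\<close>
    have "ec (cok (S j)) x w = 0 \<longleftrightarrow> w = 0" if "w \<in> sp (cok (S j)) x" for x w
    proof -
      have "inj_on (ec (cok (S j)) x) (sp (cok (S j)) x)" using c(4)[OF C] by (simp add: rep_inj_def)
      then show ?thesis
        using that rep_hom_0[OF vs C c(3)[OF C], of j x] is_rep_0[OF vs C, of j x] by (metis inj_onD)
    qed
    from this[OF rep_hom_in[OF hp]] have "rep_ker (Q j) (d j) = rep_ker (Q j) (pk (S j))"
      unfolding rep_ker_def d_def by (intro ext Collect_cong conj_cong refl)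
    then show ?thesis using k(4) S by (simp add: Q_def)
  qed
  have im: "snd (S (Suc j)) = rep_im (Q j) (d j)" for j
  proof -
    have "rep_im (Q j) (pk (S j)) = sp (cok (S j))" using k(3)[of "S j"] S[of j] by (simp add: Q_def)
    then have sp: "sp (cok (S j)) x = pk (S j) x ` sp (Q j) x" for x by (metis rep_im_def)
    show ?thesis by (simp add: SS rep_im_def sp d_def image_image)
  qed
  have inj: "rep_injective uscale (Q j)" and ess: "essential uscale (Q j) (snd (S j))" for j
    by (cases j; simp add: Q_def S0 SS Q0 c C)+
  have "min_inj_cores s N Q e d" unfolding min_inj_cores_def
  proof (intro conjI allI)
    show "rep_ker (Q 0) (d 0) = rep_im N e" by (simp add: ker S0)
    show "rep_ker (Q (Suc j)) (d (Suc j)) = rep_im (Q j) (d j)" for j by (simp add: ker im)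
    show "essential uscale (Q 0) (rep_im N e)" using Q0(5) by (simp add: Q_def S0)
    show "essential uscale (Q (Suc j)) (rep_im (Q j) (d j))" for j using ess[of "Suc j"] by (simp add: im)
    show "rep_hom s N uscale (Q 0) e" using Q0(3) by (simp add: Q_def S0)
  qed (use S inj hd Q0(4) in \<open>auto simp: Q_def\<close>)
  then show ?thesis by blast
qed

text \<open>\<open>rep_projective\<close> tests only against targets on the standard carrier; a
  target on another carrier is replaced by a copy, and the resulting equation is pulled back through
  the isomorphism.\<close>

lemma rep_projective_lift:
  fixes P X :: "('p::order, 'k::field) urep" and t :: "'k \<Rightarrow> 'w::ab_group_add \<Rightarrow> 'w"
  assumes "rep_projective uscale P" "is_rep uscale X" "vector_space t" "is_rep t Y"
    and g: "rep_hom uscale X t Y g" "rep_im X g = sp Y" and f: "rep_hom uscale P t Y f"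
  obtains h where "rep_hom uscale P uscale X h" "\<And>x v. v \<in> sp P x \<Longrightarrow> g x (h x v) = f x v"
proof -
  obtain Y' :: "('p, 'k) urep" and \<phi> \<psi> where Y': "is_rep uscale Y'" and iso: "iso_pair t Y uscale Y' \<phi> \<psi>"
    using ex_urep[OF assms(3,4)] .
  then have \<phi>: "rep_hom t Y uscale Y' \<phi>" and \<psi>: "rep_hom uscale Y' t Y \<psi>"
    and \<psi>\<phi>: "\<And>x v. v \<in> sp Y x \<Longrightarrow> \<psi> x (\<phi> x v) = v" and \<phi>\<psi>: "\<And>x v. v \<in> sp Y' x \<Longrightarrow> \<phi> x (\<psi> x v) = v"
    by (auto simp: iso_pair_def)
  have im: "rep_im X (\<lambda>x v. \<phi> x (g x v)) = sp Y'"
  proof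
    fix x
    have gx: "g x ` sp X x = sp Y x" using g(2) by (auto simp: rep_im_def dest: fun_cong)
    have "\<phi> x ` sp Y x = sp Y' x"
      using rep_hom_in[OF \<phi>] rep_hom_in[OF \<psi>] \<phi>\<psi> by (auto intro!: image_eqI[of _ _ "\<psi> x _"])
    then show "rep_im X (\<lambda>x v. \<phi> x (g x v)) x = sp Y' x" by (simp add: rep_im_def flip: gx) (simp add: image_image)
  qed
  obtain h where h: "rep_hom uscale P uscale X h" "\<And>x v. v \<in> sp P x \<Longrightarrow> \<phi> x (g x (h x v)) = \<phi> x (f x v)"
    using assms(1) assms(2) Y' rep_hom_compose[OF g(1) \<phi>] im rep_hom_compose[OF f \<phi>]
    unfolding rep_projective_def by blast
  have "g x (h x v) = f x v" if v: "v \<in> sp P x" for x v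
    using h(2)[OF v] \<psi>\<phi>[OF rep_hom_in[OF f v]] \<psi>\<phi>[OF rep_hom_in[OF g(1) rep_hom_in[OF h(1) v]]] by simp
  then show ?thesis using that h(1) by blast
qed

lemma rep_injective_extend:
  fixes Q Y :: "('p::order, 'k::field) urep" and t :: "'k \<Rightarrow> 'w::ab_group_add \<Rightarrow> 'w"
  assumes "rep_injective uscale Q" "is_rep uscale Y" "vector_space t" "is_rep t X"
    and g: "rep_hom t X uscale Y g" "rep_inj X g" and f: "rep_hom t X uscale Q f"
  obtains h where "rep_hom uscale Y uscale Q h" "\<And>x v. v \<in> sp X x \<Longrightarrow> h x (g x v) = f x v"
proof -
  obtain X' :: "('p, 'k) urep" and \<phi> \<psi> where X': "is_rep uscale X'" and iso: "iso_pair t X uscale X' \<phi> \<psi>"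
    using ex_urep[OF assms(3,4)] .
  then have \<phi>: "rep_hom t X uscale X' \<phi>" and \<psi>: "rep_hom uscale X' t X \<psi>"
    and \<psi>\<phi>: "\<And>x v. v \<in> sp X x \<Longrightarrow> \<psi> x (\<phi> x v) = v" and \<phi>\<psi>: "\<And>x v. v \<in> sp X' x \<Longrightarrow> \<phi> x (\<psi> x v) = v"
    by (auto simp: iso_pair_def)
  have "rep_inj X' (\<lambda>x v. g x (\<psi> x v))" unfolding rep_inj_def
  proof (intro allI inj_onI)
    fix x u v assume uv: "u \<in> sp X' x" "v \<in> sp X' x" "g x (\<psi> x u) = g x (\<psi> x v)"
    then have "\<psi> x u = \<psi> x v" using g(2) rep_hom_in[OF \<psi>] by (auto simp: rep_inj_def dest: inj_onD)
    then show "u = v" using \<phi>\<psi> uv by metis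
  qed
  then obtain h where h: "rep_hom uscale Y uscale Q h"
      "\<And>x v. v \<in> sp X' x \<Longrightarrow> h x (g x (\<psi> x v)) = f x (\<psi> x v)"
    using assms(1) assms(2) X' rep_hom_compose[OF \<psi> g(1)] rep_hom_compose[OF \<psi> f]
    unfolding rep_injective_def by blast
  have "h x (g x v) = f x v" if v: "v \<in> sp X x" for x v
    using h(2)[OF rep_hom_in[OF \<phi> v]] \<psi>\<phi>[OF v] by simp
  then show ?thesis using that h(1) by blast
qed

text \<open>The first two steps of the comparison theorem for resolutions; they use projectivity of
  the source terms and exactness of the target.\<close>

lemma min_proj_res_lift:
  fixes s :: "'k::field \<Rightarrow> 'v::ab_group_add \<Rightarrow> 'v" and t :: "'k \<Rightarrow> 'w::ab_group_add \<Rightarrow> 'w"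
  assumes "vector_space s" "is_rep s A" "vector_space t" "is_rep t B" "rep_hom s A t B f"
    and P: "min_proj_res s A P e d" and P': "min_proj_res t B P' e' d'"
  obtains f0 f1 where "rep_hom uscale (P 0) uscale (P' 0) f0" "rep_hom uscale (P (Suc 0)) uscale (P' (Suc 0)) f1"
    "\<And>x v. v \<in> sp (P 0) x \<Longrightarrow> e' x (f0 x v) = f x (e x v)"
    "\<And>x v. v \<in> sp (P (Suc 0)) x \<Longrightarrow> d' 0 x (f1 x v) = f0 x (d 0 x v)"
proof -
  note vs = vector_space_uscale[where 'k='k]
  have p: "\<And>j. is_rep uscale (P j)" "\<And>j. rep_projective uscale (P j)" "rep_hom uscale (P 0) s A e"
    "rep_hom uscale (P (Suc 0)) uscale (P 0) (d 0)" "rep_im (P (Suc 0)) (d 0) = rep_ker (P 0) e"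
    using P by (auto simp: min_proj_res_def)
  have p': "\<And>j. is_rep uscale (P' j)" "rep_hom uscale (P' 0) t B e'" "rep_im (P' 0) e' = sp B"
    "rep_hom uscale (P' (Suc 0)) uscale (P' 0) (d' 0)" "rep_im (P' (Suc 0)) (d' 0) = rep_ker (P' 0) e'"
    using P' by (auto simp: min_proj_res_def)
  obtain f0 where f0: "rep_hom uscale (P 0) uscale (P' 0) f0" "\<And>x v. v \<in> sp (P 0) x \<Longrightarrow> e' x (f0 x v) = f x (e x v)"
    using rep_projective_lift[OF p(2) p'(1) assms(3,4) p'(2,3) rep_hom_compose[OF p(3) assms(5)]] by blast
  \<comment> \<open>By exactness \<open>d' 0\<close> is onto this kernel and \<open>f0\<close> after
    \<open>d 0\<close> lands in it, so the degree 1 lift is another instance of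
    projectivity.\<close>
  define Y where "Y = (P' 0)\<lparr>sp := rep_ker (P' 0) e'\<rparr>"
  have Y: "is_rep uscale Y"
    unfolding Y_def by (rule is_rep_restrict[OF vs p'(1) subrep_ker[OF vs assms(3) p'(1) assms(4) p'(2)]])
  have dY: "rep_hom uscale (P' (Suc 0)) uscale Y (d' 0)"
    unfolding Y_def by (rule rep_hom_into_restrict[OF p'(4)]) (auto simp flip: p'(5) simp: rep_im_def)
  have dYs: "rep_im (P' (Suc 0)) (d' 0) = sp Y" by (simp add: Y_def p'(5))
  have "rep_hom uscale (P (Suc 0)) uscale Y (\<lambda>x v. f0 x (d 0 x v))" unfolding Y_def
  proof (rule rep_hom_into_restrict[OF rep_hom_compose[OF p(4) f0(1)]])
    fix x v assume v: "v \<in> sp (P (Suc 0)) x"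
    have "d 0 x v \<in> rep_ker (P 0) e x" using v by (auto simp flip: p(5) simp: rep_im_def)
    then have "d 0 x v \<in> sp (P 0) x" "e x (d 0 x v) = 0" by (auto simp: rep_ker_def)
    then show "f0 x (d 0 x v) \<in> rep_ker (P' 0) e' x"
      using f0(2) rep_hom_in[OF f0(1)] rep_hom_0[OF assms(1,2,5)] by (simp add: rep_ker_def)
  qed
  then obtain f1 where "rep_hom uscale (P (Suc 0)) uscale (P' (Suc 0)) f1"
    "\<And>x v. v \<in> sp (P (Suc 0)) x \<Longrightarrow> d' 0 x (f1 x v) = f0 x (d 0 x v)"
    using rep_projective_lift[OF p(2) p'(1) vs Y dY dYs] by blast
  then show ?thesis using that f0 by blast
qed

lemma min_proj_res_endo_surj:
  fixes s :: "'k::field \<Rightarrow> 'v::ab_group_add \<Rightarrow> 'v"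
  assumes "vector_space s" "is_rep s A" and P: "min_proj_res s A P e d"
    and h0: "rep_hom uscale (P 0) uscale (P 0) h0" "\<And>x v. v \<in> sp (P 0) x \<Longrightarrow> e x (h0 x v) = e x v"
    and h1: "rep_hom uscale (P (Suc 0)) uscale (P (Suc 0)) h1"
      "\<And>x v. v \<in> sp (P (Suc 0)) x \<Longrightarrow> d 0 x (h1 x v) = h0 x (d 0 x v)"
  shows "rep_im (P 0) h0 = sp (P 0)" "rep_im (P (Suc 0)) h1 = sp (P (Suc 0))"
proof -
  note vs = vector_space_uscale[where 'k='k]
  interpret vector_space "uscale :: 'k \<Rightarrow> _" by (rule vs)
  have p: "\<And>j. is_rep uscale (P j)" "rep_hom uscale (P 0) s A e"
    "rep_hom uscale (P (Suc 0)) uscale (P 0) (d 0)" "rep_im (P (Suc 0)) (d 0) = rep_ker (P 0) e"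
    "superfluous uscale (P 0) (rep_ker (P 0) e)" "superfluous uscale (P (Suc 0)) (rep_ker (P (Suc 0)) (d 0))"
    using P by (auto simp: min_proj_res_def)
  note sub = is_rep_subspace[OF p(1)]
  show im0: "rep_im (P 0) h0 = sp (P 0)"
  proof (rule superfluousD[OF vs p(1,5) subrep_im[OF vs vs p(1) h0(1)]])
    fix x v assume v: "v \<in> sp (P 0) x"
    have hv: "h0 x v \<in> sp (P 0) x" by (rule rep_hom_in[OF h0(1) v])
    have "e x (v - h0 x v) = 0"
      using linear_between_diff[OF vs sub rep_hom_linear[OF p(2)] v hv] h0(2)[OF v] by simp
    then have "v - h0 x v \<in> rep_ker (P 0) e x" using subspace_diff[OF sub v hv] by (simp add: rep_ker_def)
    moreover have "h0 x v \<in> rep_im (P 0) h0 x" using v by (simp add: rep_im_def)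
    ultimately show "\<exists>a\<in>rep_im (P 0) h0 x. \<exists>b\<in>rep_ker (P 0) e x. v = a + b"
      by (metis add_diff_cancel_left' add.commute diff_add_cancel)
  qed (auto simp: rep_ker_def)
  show "rep_im (P (Suc 0)) h1 = sp (P (Suc 0))"
  proof (rule superfluousD[OF vs p(1,6) subrep_im[OF vs vs p(1) h1(1)]])
    fix x v assume v: "v \<in> sp (P (Suc 0)) x"
    have "d 0 x v \<in> rep_im (P (Suc 0)) (d 0) x" using v by (simp add: rep_im_def)
    then have dv: "d 0 x v \<in> sp (P 0) x" "e x (d 0 x v) = 0" by (auto simp: p(4) rep_ker_def)
    then have "d 0 x v \<in> rep_im (P 0) h0 x" by (simp add: im0)
    \<comment> \<open>Surjectivity in degree 0 is used here. The preimage \<open>u\<close> satisfies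
      \<open>e x u = 0\<close> because \<open>h0\<close> respects \<open>e\<close>, so
      \<open>u\<close> comes from some \<open>w\<close> in degree 1, and \<open>v\<close> differs
      from \<open>h1 x w\<close> by a kernel vector.\<close>
    then obtain u where u: "u \<in> sp (P 0) x" "d 0 x v = h0 x u" by (auto simp: rep_im_def)
    then have "u \<in> rep_im (P (Suc 0)) (d 0) x" using h0(2)[OF u(1)] dv by (simp add: p(4) rep_ker_def)
    then obtain w where w: "w \<in> sp (P (Suc 0)) x" "u = d 0 x w" by (auto simp: rep_im_def)
    have hw: "h1 x w \<in> sp (P (Suc 0)) x" by (rule rep_hom_in[OF h1(1) w(1)])
    have "d 0 x (v - h1 x w) = 0"
      using linear_between_diff[OF vs sub rep_hom_linear[OF p(3)] v hw] h1(2)[OF w(1)] u w by simp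
    then have "v - h1 x w \<in> rep_ker (P (Suc 0)) (d 0) x" using subspace_diff[OF sub v hw] by (simp add: rep_ker_def)
    moreover have "h1 x w \<in> rep_im (P (Suc 0)) h1 x" using w(1) by (simp add: rep_im_def)
    ultimately show "\<exists>a\<in>rep_im (P (Suc 0)) h1 x. \<exists>b\<in>rep_ker (P (Suc 0)) (d 0) x. v = a + b"
      by (metis add_diff_cancel_left' add.commute diff_add_cancel)
  qed (auto simp: rep_ker_def)
qed

text \<open>The dual comparison. In degree 1 the map is forced on the image of \<open>d 0\<close>
  and extends to the whole term by injectivity of the target.\<close>

lemma min_inj_cores_extend:
  fixes s :: "'k::field \<Rightarrow> 'v::ab_group_add \<Rightarrow> 'v" and t :: "'k \<Rightarrow> 'w::ab_group_add \<Rightarrow> 'w"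
  assumes "vector_space s" "is_rep s A" "vector_space t" "is_rep t B" "rep_hom s A t B f"
    and Q: "min_inj_cores s A Q e d" and Q': "min_inj_cores t B Q' e' d'"
  obtains f0 f1 where "rep_hom uscale (Q 0) uscale (Q' 0) f0" "rep_hom uscale (Q (Suc 0)) uscale (Q' (Suc 0)) f1"
    "\<And>x v. v \<in> sp A x \<Longrightarrow> f0 x (e x v) = e' x (f x v)"
    "\<And>x v. v \<in> sp (Q 0) x \<Longrightarrow> f1 x (d 0 x v) = d' 0 x (f0 x v)"
proof -
  note vs = vector_space_uscale[where 'k='k]
  interpret vector_space "uscale :: 'k \<Rightarrow> _" by (rule vs)
  have q: "\<And>j. is_rep uscale (Q j)" "rep_hom s A uscale (Q 0) e" "rep_inj A e"
    "rep_hom uscale (Q 0) uscale (Q (Suc 0)) (d 0)" "rep_ker (Q 0) (d 0) = rep_im A e"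
    using Q by (auto simp: min_inj_cores_def)
  have q': "\<And>j. is_rep uscale (Q' j)" "\<And>j. rep_injective uscale (Q' j)" "rep_hom t B uscale (Q' 0) e'"
    "rep_hom uscale (Q' 0) uscale (Q' (Suc 0)) (d' 0)" "rep_ker (Q' 0) (d' 0) = rep_im B e'"
    using Q' by (auto simp: min_inj_cores_def)
  obtain f0 where f0: "rep_hom uscale (Q 0) uscale (Q' 0) f0" "\<And>x v. v \<in> sp A x \<Longrightarrow> f0 x (e x v) = e' x (f x v)"
    using rep_injective_extend[OF q'(2) q(1) assms(1,2) q(2,3) rep_hom_compose[OF assms(5) q'(3)]] by blast
  define X where "X = (Q (Suc 0))\<lparr>sp := rep_im (Q 0) (d 0)\<rparr>"
  have X: "is_rep uscale X"
    unfolding X_def by (rule is_rep_restrict[OF vs q(1) subrep_im[OF vs vs q(1,4)]])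
  have XQ: "sp X x \<subseteq> sp (Q (Suc 0)) x" for x using rep_hom_in[OF q(4)] by (auto simp: X_def rep_im_def)
  have inc: "rep_hom uscale X uscale (Q (Suc 0)) (\<lambda>x v. v)" "rep_inj X (\<lambda>x v. v)"
    using XQ[THEN subsetD] by (auto simp: X_def rep_inj_def intro!: rep_homI linear_betweenI)
  have hf: "rep_hom uscale (Q 0) uscale (Q' (Suc 0)) (\<lambda>x v. d' 0 x (f0 x v))"
    by (rule rep_hom_compose[OF f0(1) q'(4)])
  \<comment> \<open>A vector killed by \<open>d 0\<close> comes from \<open>A\<close>, so
    \<open>f0\<close> carries it into the image of \<open>B\<close>, which \<open>d' 0\<close>
    kills.\<close>
  have ker: "d' 0 x (f0 x v) = 0" if "v \<in> sp (Q 0) x" "d 0 x v = 0" for x v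
  proof -
    have "v \<in> rep_im A e x" using that by (simp add: rep_ker_def flip: q(5))
    then obtain a where a: "a \<in> sp A x" "v = e x a" by (auto simp: rep_im_def)
    then have "f0 x v \<in> rep_im B e' x" using f0(2) rep_hom_in[OF assms(5)] by (simp add: rep_im_def)
    then show ?thesis by (simp add: rep_ker_def flip: q'(5))
  qed
  have wd: "d' 0 x (f0 x u) = d' 0 x (f0 x v)" if "u \<in> sp (Q 0) x" "v \<in> sp (Q 0) x" "d 0 x u = d 0 x v" for x u v
    using ker[OF subspace_diff[OF is_rep_subspace[OF q(1)] that(1,2)]] that
      linear_between_diff[OF vs is_rep_subspace[OF q(1)] rep_hom_linear[OF q(4)] that(1,2)]
      linear_between_diff[OF vs is_rep_subspace[OF q(1)] rep_hom_linear[OF hf] that(1,2)] by simp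
  \<comment> \<open>The induced map on the image of \<open>d 0\<close>, through an arbitrary
    preimage; \<open>wd\<close> makes the value independent of the choice.\<close>
  define g where "g = (\<lambda>x w. d' 0 x (f0 x (SOME v. v \<in> sp (Q 0) x \<and> d 0 x v = w)))"
  have g: "g x (d 0 x v) = d' 0 x (f0 x v)" if "v \<in> sp (Q 0) x" for x v
  proof -
    have "(SOME u. u \<in> sp (Q 0) x \<and> d 0 x u = d 0 x v) \<in> sp (Q 0) x \<and>
        d 0 x (SOME u. u \<in> sp (Q 0) x \<and> d 0 x u = d 0 x v) = d 0 x v"
      by (rule someI[of _ v]) (use that in simp)
    then show ?thesis unfolding g_def using wd that by blast
  qed
  have spX: "w \<in> sp X x \<longleftrightarrow> (\<exists>v\<in>sp (Q 0) x. w = d 0 x v)" for w x by (auto simp: X_def rep_im_def)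
  have "rep_hom uscale X uscale (Q' (Suc 0)) g"
  proof (intro rep_homI linear_betweenI)
    show "g x w \<in> sp (Q' (Suc 0)) x" if "w \<in> sp X x" for x w
      using that g rep_hom_in[OF hf] by (auto simp: spX)
    show "g x (w + w') = g x w + g x w'" if ww: "w \<in> sp X x" "w' \<in> sp X x" for x w w'
    proof -
      obtain v v' where v: "v \<in> sp (Q 0) x" "w = d 0 x v" "v' \<in> sp (Q 0) x" "w' = d 0 x v'"
        using ww unfolding spX by blast
      then have "g x (w + w') = g x (d 0 x (v + v'))"
        by (simp add: linear_between_add[OF rep_hom_linear[OF q(4)]])
      then show ?thesis
        using v g subspace_add[OF is_rep_subspace[OF q(1)] v(1,3)] linear_between_add[OF rep_hom_linear[OF hf] v(1,3)] by simp
    qed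
    show "g x (fun_scale (*) c w) = fun_scale (*) c (g x w)" if w: "w \<in> sp X x" for x c w
    proof -
      obtain v where v: "v \<in> sp (Q 0) x" "w = d 0 x v" using w unfolding spX by blast
      then have "g x (fun_scale (*) c w) = g x (d 0 x (fun_scale (*) c v))"
        by (simp add: linear_between_scale[OF rep_hom_linear[OF q(4)]])
      then show ?thesis
        using v g subspace_scale[OF is_rep_subspace[OF q(1)] v(1)] linear_between_scale[OF rep_hom_linear[OF hf] v(1)] by simp
    qed
    show "g y (tr X x y w) = tr (Q' (Suc 0)) x y (g x w)" if le: "x \<le> y" and w: "w \<in> sp X x" for x y w
    proof -
      obtain v where v: "v \<in> sp (Q 0) x" "w = d 0 x v" using w unfolding spX by blast
      then have "g y (tr X x y w) = g y (d 0 y (tr (Q 0) x y v))"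
        using rep_hom_tr[OF q(4) le v(1)] by (simp add: X_def)
      then show ?thesis using v g is_rep_tr_in[OF q(1) le v(1)] rep_hom_tr[OF hf le v(1)] by simp
    qed
  qed
  then obtain f1 where f1: "rep_hom uscale (Q (Suc 0)) uscale (Q' (Suc 0)) f1" "\<And>x w. w \<in> sp X x \<Longrightarrow> f1 x w = g x w"
    using rep_injective_extend[OF q'(2) q(1) vs X inc] by blast
  have "f1 x (d 0 x v) = d' 0 x (f0 x v)" if "v \<in> sp (Q 0) x" for x v
    using f1(2)[of "d 0 x v" x] g[OF that] that by (auto simp: spX)
  then show ?thesis using that f0 f1(1) by blast
qed

text \<open>The kernel of the endomorphism meets the essential image entering the term only in 0, so
  it is zero.\<close>

lemma min_inj_cores_endo_inj:
  fixes s :: "'k::field \<Rightarrow> 'v::ab_group_add \<Rightarrow> 'v"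
  assumes "vector_space s" "is_rep s A" and Q: "min_inj_cores s A Q e d"
    and h0: "rep_hom uscale (Q 0) uscale (Q 0) h0" "\<And>x v. v \<in> sp A x \<Longrightarrow> h0 x (e x v) = e x v"
    and h1: "rep_hom uscale (Q (Suc 0)) uscale (Q (Suc 0)) h1"
      "\<And>x v. v \<in> sp (Q 0) x \<Longrightarrow> h1 x (d 0 x v) = d 0 x (h0 x v)"
  shows "\<And>x v. v \<in> sp (Q 0) x \<Longrightarrow> h0 x v = 0 \<Longrightarrow> v = 0"
    "\<And>x v. v \<in> sp (Q (Suc 0)) x \<Longrightarrow> h1 x v = 0 \<Longrightarrow> v = 0"
proof -
  note vs = vector_space_uscale[where 'k='k]
  interpret vector_space "uscale :: 'k \<Rightarrow> _" by (rule vs)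
  have q: "\<And>j. is_rep uscale (Q j)" "rep_hom s A uscale (Q 0) e"
    "rep_hom uscale (Q 0) uscale (Q (Suc 0)) (d 0)" "rep_ker (Q 0) (d 0) = rep_im A e"
    "essential uscale (Q 0) (rep_im A e)" "essential uscale (Q (Suc 0)) (rep_im (Q 0) (d 0))"
    using Q by (auto simp: min_inj_cores_def)
  note sub = is_rep_subspace[OF q(1)]
  show inj0: "v = 0" if "v \<in> sp (Q 0) x" "h0 x v = 0" for x v
  proof (rule essentialD[OF vs q(5) subrep_ker[OF vs vs q(1,1) h0(1)]])
    show "0 \<in> rep_im A e x" for x
      using rep_hom_0[OF assms(1,2) q(2), of x] is_rep_0[OF assms(1,2)] by (auto simp: rep_im_def intro!: rev_image_eqI)
    show "v = 0" if "v \<in> rep_ker (Q 0) h0 x" "v \<in> rep_im A e x" for x v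
      using that h0(2) by (auto simp: rep_ker_def rep_im_def)
    show "v \<in> rep_ker (Q 0) h0 x" using that by (simp add: rep_ker_def)
  qed
  show "v = 0" if "v \<in> sp (Q (Suc 0)) x" "h1 x v = 0" for x v
  proof (rule essentialD[OF vs q(6) subrep_ker[OF vs vs q(1,1) h1(1)]])
    show "0 \<in> rep_im (Q 0) (d 0) x" for x
      using rep_hom_0[OF vs q(1,3), of x] is_rep_0[OF vs q(1)] by (auto simp: rep_im_def intro!: rev_image_eqI)
    show "v = 0" if v: "v \<in> rep_ker (Q (Suc 0)) h1 x" "v \<in> rep_im (Q 0) (d 0) x" for x v
    proof -
      obtain u where u: "u \<in> sp (Q 0) x" "v = d 0 x u" using v(2) by (auto simp: rep_im_def)
      have hu: "h0 x u \<in> sp (Q 0) x" by (rule rep_hom_in[OF h0(1) u(1)])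
      \<comment> \<open>So \<open>h0 x u\<close> is some \<open>e x a\<close>, which
        \<open>h0\<close> fixes. Hence \<open>h0\<close> kills \<open>u - e x a\<close>, injectivity
        in degree 0 gives \<open>u = e x a\<close>, and exactness gives
        \<open>v = d 0 x u = 0\<close>.\<close>
      have "d 0 x (h0 x u) = 0" using h1(2)[OF u(1)] u(2) v(1) by (simp add: rep_ker_def)
      then have "h0 x u \<in> rep_im A e x" using hu by (simp add: rep_ker_def flip: q(4))
      then obtain a where a: "a \<in> sp A x" "h0 x u = e x a" by (auto simp: rep_im_def)
      have ea: "e x a \<in> sp (Q 0) x" by (rule rep_hom_in[OF q(2) a(1)])
      have "h0 x (u - e x a) = 0"
        using linear_between_diff[OF vs sub rep_hom_linear[OF h0(1)] u(1) ea] h0(2)[OF a(1)] a(2) by simp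
      then have "u - e x a = 0" by (rule inj0[OF subspace_diff[OF sub u(1) ea]])
      then have "u \<in> rep_ker (Q 0) (d 0) x" using a(1) by (simp add: q(4) rep_im_def)
      then show ?thesis using u(2) by (simp add: rep_ker_def)
    qed
    show "v \<in> rep_ker (Q (Suc 0)) h1 x" using that by (simp add: rep_ker_def)
  qed
qed

subsection \<open>Interval summands and dimensions\<close>

lemma supp_top_rep:
  assumes "vector_space s" "is_rep s M"
  shows "supp (top_rep s M) = {x. \<exists>v\<in>sp M x. v \<notin> rad s M x}"
proof -
  interpret vector_space s by fact
  note M = is_rep_subspace[OF assms(2)]
  have rad_sub: "subspace (rad s M x)" for x
  proof (rule subspaceI)
    have X: "subspace (X x)" if "maximal_subrep s M X" for X
      using that by (auto simp: maximal_subrep_def subrep_def)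
    show "0 \<in> rad s M x" using X subspace_0 subspace_0[OF M] by (auto simp: rad_def)
    show "u + v \<in> rad s M x" if "u \<in> rad s M x" "v \<in> rad s M x" for u v
      using that X subspace_add subspace_add[OF M] by (auto simp: rad_def)
    show "s c u \<in> rad s M x" if "u \<in> rad s M x" for c u
      using that X subspace_scale subspace_scale[OF M] by (auto simp: rad_def)
  qed
  \<comment> \<open>The zero vector of the top is the radical itself, so distinct cosets have to be
    compared with it rather than with the zero of the set type.\<close>
  have coset: "u +o rad s M x = v +o rad s M x \<longleftrightarrow> u - v \<in> rad s M x" for u v x
  proof
    assume "u +o rad s M x = v +o rad s M x"
    moreover have "u + 0 \<in> u +o rad s M x" by (intro set_plus_intro2 subspace_0 rad_sub)
    ultimately show "u - v \<in> rad s M x" by (simp add: set_minus_plus)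
  next
    assume uv: "u - v \<in> rad s M x"
    show "u +o rad s M x = v +o rad s M x"
    proof (intro subset_antisym subsetI)
      fix w assume "w \<in> u +o rad s M x"
      then obtain b where b: "b \<in> rad s M x" "w = u + b" unfolding elt_set_plus_def by blast
      have "v + ((u - v) + b) \<in> v +o rad s M x" by (rule set_plus_intro2[OF subspace_add[OF rad_sub uv b(1)]])
      then show "w \<in> v +o rad s M x" by (simp add: b(2))
    next
      fix w assume "w \<in> v +o rad s M x"
      then obtain b where b: "b \<in> rad s M x" "w = v + b" unfolding elt_set_plus_def by blast
      have "u + (b - (u - v)) \<in> u +o rad s M x" by (rule set_plus_intro2[OF subspace_diff[OF rad_sub b(1) uv]])
      then show "w \<in> u +o rad s M x" by (simp add: b(2) add.commute)
    qed
  qed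
  have spt: "sp (top_rep s M) x = (\<lambda>v. v +o rad s M x) ` sp M x" for x
    by (simp add: top_rep_def quot_rep_def)
  show ?thesis
  proof (rule Collect_eqI[THEN trans[OF supp_def]])
    fix x
    show "(\<exists>u\<in>sp (top_rep s M) x. \<exists>v\<in>sp (top_rep s M) x. u \<noteq> v) \<longleftrightarrow> (\<exists>v\<in>sp M x. v \<notin> rad s M x)"
    proof
      assume "\<exists>u\<in>sp (top_rep s M) x. \<exists>v\<in>sp (top_rep s M) x. u \<noteq> v"
      then obtain u v where "u \<in> sp M x" "v \<in> sp M x" "u +o rad s M x \<noteq> v +o rad s M x"
        unfolding spt by blast
      then show "\<exists>v\<in>sp M x. v \<notin> rad s M x" using subspace_diff[OF M] coset by blast
    next
      assume "\<exists>v\<in>sp M x. v \<notin> rad s M x"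
      then obtain v where v: "v \<in> sp M x" "v \<notin> rad s M x" by blast
      then have "v +o rad s M x \<noteq> 0 +o rad s M x" using coset[of v x 0] by simp
      then show "\<exists>u\<in>sp (top_rep s M) x. \<exists>v\<in>sp (top_rep s M) x. u \<noteq> v"
        using v(1) subspace_0[OF M] unfolding spt by blast
    qed
  qed
qed

text \<open>Maximal submodules pull back along a surjection to maximal submodules, and a vector of
  the radical lies in all of those.\<close>

lemma rad_image_subset:
  assumes "vector_space s" "vector_space t" "is_rep s X" "is_rep t Y"
    and g: "rep_hom s X t Y g" "rep_im X g = sp Y" and v: "v \<in> rad s X x"
  shows "g x v \<in> rad t Y x"
proof -
  interpret s: vector_space s by fact
  have vX: "v \<in> sp X x" using v by (simp add: rad_def)
  have gY: "sp Y x = g x ` sp X x" for x using g(2) by (metis rep_im_def)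
  have "g x v \<in> Z x" if Z: "maximal_subrep t Y Z" for Z
  proof -
    have Zs: "subrep t Y Z" "Z \<noteq> sp Y" and Zm: "\<And>W. subrep t Y W \<Longrightarrow> Z \<le> W \<Longrightarrow> W = Z \<or> W = sp Y"
      using Z by (auto simp: maximal_subrep_def)
    have ZY: "Z x \<subseteq> sp Y x" for x using Zs(1) by (auto simp: subrep_def)
    have Z0: "0 \<in> Z x" for x
      using Zs(1) module.subspace_0[of t] assms(2) by (auto simp: subrep_def module_iff_vector_space)
    define W where "W = (\<lambda>x. {v \<in> sp X x. g x v \<in> Z x})"
    have W: "subrep s X W" unfolding W_def by (rule subrep_vimage[OF assms(1-3) g(1) Zs(1)])
    have gW: "g x ` W x = Z x" for x using ZY[of x] by (auto simp: W_def gY)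
    have "W \<noteq> sp X" using gW gY Zs(2) by (metis ext)
    moreover have "W' = W \<or> W' = sp X" if W': "subrep s X W'" "W \<le> W'" for W'
    proof -
      have WW: "W x \<subseteq> W' x" and WX: "W' x \<subseteq> sp X x" and sub: "s.subspace (W' x)" for x
        using W' by (auto simp: le_fun_def subrep_def)
      have "Z \<le> (\<lambda>x. g x ` W' x)" using WW gW by (metis (no_types, lifting) image_mono le_funI)
      then consider "(\<lambda>x. g x ` W' x) = Z" | "(\<lambda>x. g x ` W' x) = sp Y"
        using Zm[OF subrep_image[OF assms(1,2) g(1) W'(1)]] by blast
      then show ?thesis
      proof cases
        case 1
        then have "g x ` W' x = Z x" for x by metis
        then have "W' x \<subseteq> W x" for x using WX[of x] by (auto simp: W_def)
        then show ?thesis using WW by (metis ext subset_antisym)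
      next
        case 2
        \<comment> \<open>The preimage \<open>W\<close> contains the kernel of \<open>g\<close>. If
          \<open>W'\<close> has full image, each vector differs from one of \<open>W'\<close> by a
          kernel vector and so belongs to \<open>W'\<close>.\<close>
        have "sp X x \<subseteq> W' x" for x
        proof
          fix u assume u: "u \<in> sp X x"
          then have "g x u \<in> g x ` W' x" using 2 gY by (metis image_eqI)
          then obtain w where w: "w \<in> W' x" "g x u = g x w" by blast
          have wX: "w \<in> sp X x" using w(1) WX by blast
          have "g x (u - w) = 0"
            using linear_between_diff[OF assms(1) is_rep_subspace[OF assms(3)] rep_hom_linear[OF g(1)] u wX] w(2) by simp
          then have "u - w \<in> W x"
            using s.subspace_diff[OF is_rep_subspace[OF assms(3)] u wX] Z0 by (simp add: W_def)
          then have "(u - w) + w \<in> W' x" using WW w(1) s.subspace_add[OF sub] by blast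
          then show "u \<in> W' x" by simp
        qed
        then show ?thesis using WX by (metis ext subset_antisym)
      qed
    qed
    ultimately have "maximal_subrep s X W" using W by (simp add: maximal_subrep_def)
    then have "v \<in> W x" using v by (simp add: rad_def)
    then show ?thesis by (simp add: W_def)
  qed
  then show ?thesis using rep_hom_in[OF g(1) vX] by (simp add: rad_def)
qed

lemma supp_top_mono:
  assumes "vector_space s" "vector_space t" "is_rep s X" "is_rep t Y"
    and g: "rep_hom s X t Y g" "rep_im X g = sp Y"
  shows "supp (top_rep t Y) \<subseteq> supp (top_rep s X)"
proof
  fix x assume "x \<in> supp (top_rep t Y)"
  then obtain w where w: "w \<in> sp Y x" "w \<notin> rad t Y x" by (auto simp: supp_top_rep[OF assms(2,4)])
  then obtain v where v: "v \<in> sp X x" "w = g x v" using g(2) by (metis rep_im_def imageE)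
  then have "v \<notin> rad s X x" using rad_image_subset[OF assms] w(2) by blast
  then show "x \<in> supp (top_rep s X)" using v(1) by (auto simp: supp_top_rep[OF assms(1,3)])
qed

text \<open>A submodule of the image is the image of its preimage inside \<open>Z\<close>;
  simplicity leaves only 0 and \<open>Z\<close> for that preimage.\<close>

lemma simple_subrep_image:
  assumes "vector_space s" "vector_space t" "is_rep s X" "is_rep t Y" "rep_hom s X t Y g"
    and inj: "\<And>x v. v \<in> sp X x \<Longrightarrow> g x v = 0 \<Longrightarrow> v = 0" and Z: "simple_subrep s X Z"
  shows "simple_subrep t Y (\<lambda>x. g x ` Z x)"
proof -
  interpret s: vector_space s by fact
  interpret t: vector_space t by fact
  have Zs: "subrep s X Z" "Z \<noteq> (\<lambda>x. {0})" and Zm: "\<And>W. subrep s X W \<Longrightarrow> W \<le> Z \<Longrightarrow> W = (\<lambda>x. {0}) \<or> W = Z"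
    using Z by (auto simp: simple_subrep_def)
  have ZX: "Z x \<subseteq> sp X x" and Zsub: "s.subspace (Z x)" and Ztr: "x \<le> y \<Longrightarrow> tr X x y ` Z x \<subseteq> Z y" for x y
    using Zs(1) by (auto simp: subrep_def)
  have g0: "g x 0 = 0" for x by (rule rep_hom_0[OF assms(1,3,5)])
  have "(\<lambda>x. g x ` Z x) \<noteq> (\<lambda>x. {0})"
  proof
    assume "(\<lambda>x. g x ` Z x) = (\<lambda>x. {0})"
    then have "g x ` Z x = {0}" for x by metis
    then have "v = 0" if "v \<in> Z x" for v x using that ZX inj by blast
    then have "Z x = {0}" for x using s.subspace_0[OF Zsub] by blast
    then show False using Zs(2) by blast
  qed
  moreover have "W = (\<lambda>x. {0}) \<or> W = (\<lambda>x. g x ` Z x)" if W: "subrep t Y W" "W \<le> (\<lambda>x. g x ` Z x)" for W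
  proof -
    have WZ: "W x \<subseteq> g x ` Z x" for x using W(2) by (simp add: le_fun_def)
    have W0: "0 \<in> W x" for x using W(1) t.subspace_0 by (auto simp: subrep_def)
    define W' where "W' = (\<lambda>x. Z x \<inter> {v \<in> sp X x. g x v \<in> W x})"
    have V: "subrep s X (\<lambda>x. {v \<in> sp X x. g x v \<in> W x})" (is "subrep s X ?V")
      by (rule subrep_vimage[OF assms(1-3,5) W(1)])
    have Vsub: "s.subspace (?V x)" for x using V unfolding subrep_def by blast
    have Vtr: "tr X x y ` ?V x \<subseteq> ?V y" if "x \<le> y" for x y
      using V[unfolded subrep_def, THEN conjunct2, rule_format, OF that] .
    have "subrep s X W'" unfolding subrep_def
    proof (intro conjI allI impI)
      show "s.subspace (W' x)" for x unfolding W'_def by (rule s.subspace_inter[OF Zsub Vsub])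
      show "W' x \<subseteq> sp X x" for x unfolding W'_def using ZX by blast
      show "tr X x y ` W' x \<subseteq> W' y" if "x \<le> y" for x y
        using Ztr[OF that] Vtr[OF that] unfolding W'_def image_subset_iff by blast
    qed
    moreover have "W' \<le> Z" by (auto simp: W'_def le_fun_def)
    ultimately consider "W' = (\<lambda>x. {0})" | "W' = Z" using Zm by blast
    then show ?thesis
    proof cases
      case 1
      have "w = 0" if w: "w \<in> W x" for w x
      proof -
        obtain z where z: "z \<in> Z x" "w = g x z" using w WZ by blast
        then have "z \<in> W' x" using ZX w by (auto simp: W'_def)
        moreover have "W' x = {0}" unfolding 1 ..
        ultimately have "z = 0" by blast
        then show ?thesis using z(2) g0 by simp
      qed
      then have "W x = {0}" for x using W0 by blast
      then show ?thesis by blast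
    next
      case 2
      then have "Z x \<subseteq> W' x" for x by simp
      then have "g x ` Z x \<subseteq> W x" for x by (auto simp: W'_def)
      then have "W x = g x ` Z x" for x using WZ by blast
      then show ?thesis by blast
    qed
  qed
  ultimately show ?thesis
    using subrep_image[OF assms(1,2,5) Zs(1)] unfolding simple_subrep_def by blast
qed

text \<open>A span is nonzero as soon as one of its generators is, so simple submodules can be
  examined one at a time.\<close>

lemma supp_soc:
  assumes "vector_space s" "is_rep s M"
  shows "supp (soc s M) = {x. \<exists>Z v. simple_subrep s M Z \<and> v \<in> Z x \<and> v \<noteq> 0}"
proof -
  interpret vector_space s by fact
  have "x \<in> supp (soc s M) \<longleftrightarrow> (\<exists>Z v. simple_subrep s M Z \<and> v \<in> Z x \<and> v \<noteq> 0)" for x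
  proof
    let ?U = "\<Union>X\<in>Collect (simple_subrep s M). X x"
    assume "x \<in> supp (soc s M)"
    then obtain u v where "u \<in> span ?U" "v \<in> span ?U" "u \<noteq> v" by (auto simp: supp_def soc_def)
    then have "\<not> span ?U \<subseteq> {0}" by blast
    then have "\<not> ?U \<subseteq> {0}" using span_minimal[OF _ subspace_single_0] by blast
    then show "\<exists>Z v. simple_subrep s M Z \<and> v \<in> Z x \<and> v \<noteq> 0" by blast
  next
    assume "\<exists>Z v. simple_subrep s M Z \<and> v \<in> Z x \<and> v \<noteq> 0"
    then obtain Z v where "simple_subrep s M Z" "v \<in> Z x" "v \<noteq> 0" by blast
    then have "v \<in> sp (soc s M) x" "0 \<in> sp (soc s M) x" "v \<noteq> 0"
      by (auto simp: soc_def intro!: span_base span_zero)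
    then show "x \<in> supp (soc s M)" unfolding supp_def by blast
  qed
  then show ?thesis by blast
qed

lemma supp_soc_mono:
  assumes "vector_space s" "vector_space t" "is_rep s X" "is_rep t Y" "rep_hom s X t Y g"
    and inj: "\<And>x v. v \<in> sp X x \<Longrightarrow> g x v = 0 \<Longrightarrow> v = 0"
  shows "supp (soc s X) \<subseteq> supp (soc t Y)"
proof
  fix x assume "x \<in> supp (soc s X)"
  then obtain Z v where Z: "simple_subrep s X Z" "v \<in> Z x" "v \<noteq> 0" by (auto simp: supp_soc[OF assms(1,3)])
  have "v \<in> sp X x" using Z(1,2) by (auto simp: simple_subrep_def subrep_def)
  then have "g x v \<in> g x ` Z x" "g x v \<noteq> 0" using Z(2,3) inj by auto
  moreover have "simple_subrep t Y (\<lambda>x. g x ` Z x)"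
    by (rule simple_subrep_image[OF assms(1-5) _ Z(1)]) (rule inj)
  ultimately show "x \<in> supp (soc t Y)" unfolding supp_soc[OF assms(2,4)] by blast
qed

section \<open>Retracts and the terms of minimal resolutions\<close>

lemma proj_term_retract:
  fixes s :: "'k::field \<Rightarrow> 'v::ab_group_add \<Rightarrow> 'v" and t :: "'k \<Rightarrow> 'w::ab_group_add \<Rightarrow> 'w"
    and A :: "('p::{finite,order}, 'v) rep" and M :: "('p, 'w) rep"
  assumes "vector_space s" "is_rep s A" "vector_space t" "is_rep t M"
    and \<iota>: "rep_hom s A t M \<iota>" and \<pi>: "rep_hom t M s A \<pi>" and r: "\<And>x v. v \<in> sp A x \<Longrightarrow> \<pi> x (\<iota> x v) = v"
    and j: "j \<in> {0, 1}"
  shows "supp (top_rep uscale (proj_term s A j)) \<subseteq> supp (top_rep uscale (proj_term t M j))"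
proof -
  note vs = vector_space_uscale[where 'k='k]
  obtain e d where P: "min_proj_res s A (proj_term s A) e d"
    using someI_ex[OF ex_min_proj_res[OF assms(1,2)]] unfolding proj_term_def by blast
  obtain e' d' where P': "min_proj_res t M (proj_term t M) e' d'"
    using someI_ex[OF ex_min_proj_res[OF assms(3,4)]] unfolding proj_term_def by blast
  let ?P = "proj_term s A" and ?P' = "proj_term t M"
  have rep: "is_rep uscale (?P i)" "is_rep uscale (?P' i)"
    and h: "rep_hom uscale (?P 0) s A e" "rep_hom uscale (?P (Suc 0)) uscale (?P 0) (d 0)" for i
    using P P' by (auto simp: min_proj_res_def)
  obtain f0 f1 where f: "rep_hom uscale (?P 0) uscale (?P' 0) f0" "rep_hom uscale (?P (Suc 0)) uscale (?P' (Suc 0)) f1"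
    "\<And>x v. v \<in> sp (?P 0) x \<Longrightarrow> e' x (f0 x v) = \<iota> x (e x v)"
    "\<And>x v. v \<in> sp (?P (Suc 0)) x \<Longrightarrow> d' 0 x (f1 x v) = f0 x (d 0 x v)"
    using min_proj_res_lift[OF assms(1-4) \<iota> P P'] by blast
  obtain g0 g1 where g: "rep_hom uscale (?P' 0) uscale (?P 0) g0" "rep_hom uscale (?P' (Suc 0)) uscale (?P (Suc 0)) g1"
    "\<And>x v. v \<in> sp (?P' 0) x \<Longrightarrow> e x (g0 x v) = \<pi> x (e' x v)"
    "\<And>x v. v \<in> sp (?P' (Suc 0)) x \<Longrightarrow> d 0 x (g1 x v) = g0 x (d' 0 x v)"
    using min_proj_res_lift[OF assms(3,4,1,2) \<pi> P' P] by blast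
  have e0: "e x (g0 x (f0 x v)) = e x v" if "v \<in> sp (?P 0) x" for x v
    using f(3)[OF that] g(3)[OF rep_hom_in[OF f(1) that]] r[OF rep_hom_in[OF h(1) that]] by simp
  have e1: "d 0 x (g1 x (f1 x v)) = g0 x (f0 x (d 0 x v))" if "v \<in> sp (?P (Suc 0)) x" for x v
    using f(4)[OF that] g(4)[OF rep_hom_in[OF f(2) that]] by simp
  have h0: "rep_hom uscale (?P 0) uscale (?P 0) (\<lambda>x v. g0 x (f0 x v))" by (rule rep_hom_compose[OF f(1) g(1)])
  have h1: "rep_hom uscale (?P (Suc 0)) uscale (?P (Suc 0)) (\<lambda>x v. g1 x (f1 x v))"
    by (rule rep_hom_compose[OF f(2) g(2)])
  have surj: "rep_im (?P 0) (\<lambda>x v. g0 x (f0 x v)) = sp (?P 0)"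
    "rep_im (?P (Suc 0)) (\<lambda>x v. g1 x (f1 x v)) = sp (?P (Suc 0))"
    by (rule min_proj_res_endo_surj[OF assms(1,2) P h0 _ h1]; simp add: e0 e1)+
  \<comment> \<open>If the composite is onto then so is its second map; this is the surjection from
    the term of \<open>M\<close> to the term of \<open>A\<close>.\<close>
  have im: "rep_im (?P' i) g' = sp (?P i)"
    if "rep_hom uscale (?P i) uscale (?P' i) f'" "rep_hom uscale (?P' i) uscale (?P i) g'"
      "rep_im (?P i) (\<lambda>x v. g' x (f' x v)) = sp (?P i)" for f' g' i
  proof
    fix x
    show "rep_im (?P' i) g' x = sp (?P i) x"
      using rep_hom_in[OF that(1)] rep_hom_in[OF that(2)] fun_cong[OF that(3), of x]
      unfolding rep_im_def by blast
  qed
  have "supp (top_rep uscale (?P 0)) \<subseteq> supp (top_rep uscale (?P' 0))"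
    by (rule supp_top_mono[OF vs vs rep(2,1) g(1) im[OF f(1) g(1) surj(1)]])
  moreover have "supp (top_rep uscale (?P (Suc 0))) \<subseteq> supp (top_rep uscale (?P' (Suc 0)))"
    by (rule supp_top_mono[OF vs vs rep(2,1) g(2) im[OF f(2) g(2) surj(2)]])
  ultimately show ?thesis using j by auto
qed

lemma inj_term_retract:
  fixes s :: "'k::field \<Rightarrow> 'v::ab_group_add \<Rightarrow> 'v" and t :: "'k \<Rightarrow> 'w::ab_group_add \<Rightarrow> 'w"
    and A :: "('p::{finite,order}, 'v) rep" and M :: "('p, 'w) rep"
  assumes "vector_space s" "is_rep s A" "vector_space t" "is_rep t M"
    and \<iota>: "rep_hom s A t M \<iota>" and \<pi>: "rep_hom t M s A \<pi>" and r: "\<And>x v. v \<in> sp A x \<Longrightarrow> \<pi> x (\<iota> x v) = v"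
    and j: "j \<in> {0, 1}"
  shows "supp (soc uscale (inj_term s A j)) \<subseteq> supp (soc uscale (inj_term t M j))"
proof -
  note vs = vector_space_uscale[where 'k='k]
  obtain e d where Q: "min_inj_cores s A (inj_term s A) e d"
    using someI_ex[OF ex_min_inj_cores[OF assms(1,2)]] unfolding inj_term_def by blast
  obtain e' d' where Q': "min_inj_cores t M (inj_term t M) e' d'"
    using someI_ex[OF ex_min_inj_cores[OF assms(3,4)]] unfolding inj_term_def by blast
  let ?Q = "inj_term s A" and ?Q' = "inj_term t M"
  have rep: "is_rep uscale (?Q i)" "is_rep uscale (?Q' i)"
    and h: "rep_hom uscale (?Q 0) uscale (?Q (Suc 0)) (d 0)" for i
    using Q Q' by (auto simp: min_inj_cores_def)
  obtain f0 f1 where f: "rep_hom uscale (?Q 0) uscale (?Q' 0) f0" "rep_hom uscale (?Q (Suc 0)) uscale (?Q' (Suc 0)) f1"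
    "\<And>x v. v \<in> sp A x \<Longrightarrow> f0 x (e x v) = e' x (\<iota> x v)"
    "\<And>x v. v \<in> sp (?Q 0) x \<Longrightarrow> f1 x (d 0 x v) = d' 0 x (f0 x v)"
    using min_inj_cores_extend[OF assms(1-4) \<iota> Q Q'] by blast
  obtain g0 g1 where g: "rep_hom uscale (?Q' 0) uscale (?Q 0) g0" "rep_hom uscale (?Q' (Suc 0)) uscale (?Q (Suc 0)) g1"
    "\<And>x v. v \<in> sp M x \<Longrightarrow> g0 x (e' x v) = e x (\<pi> x v)"
    "\<And>x v. v \<in> sp (?Q' 0) x \<Longrightarrow> g1 x (d' 0 x v) = d 0 x (g0 x v)"
    using min_inj_cores_extend[OF assms(3,4,1,2) \<pi> Q' Q] by blast
  have e0: "g0 x (f0 x (e x v)) = e x v" if "v \<in> sp A x" for x v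
    using f(3)[OF that] g(3)[OF rep_hom_in[OF \<iota> that]] r[OF that] by simp
  have e1: "g1 x (f1 x (d 0 x v)) = d 0 x (g0 x (f0 x v))" if "v \<in> sp (?Q 0) x" for x v
    using f(4)[OF that] g(4)[OF rep_hom_in[OF f(1) that]] by simp
  have h0: "rep_hom uscale (?Q 0) uscale (?Q 0) (\<lambda>x v. g0 x (f0 x v))" by (rule rep_hom_compose[OF f(1) g(1)])
  have h1: "rep_hom uscale (?Q (Suc 0)) uscale (?Q (Suc 0)) (\<lambda>x v. g1 x (f1 x v))"
    by (rule rep_hom_compose[OF f(2) g(2)])
  have inj: "v \<in> sp (?Q 0) x \<Longrightarrow> g0 x (f0 x v) = 0 \<Longrightarrow> v = 0"
    "v \<in> sp (?Q (Suc 0)) x \<Longrightarrow> g1 x (f1 x v) = 0 \<Longrightarrow> v = 0" for x v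
    by (rule min_inj_cores_endo_inj[OF assms(1,2) Q h0 _ h1]; simp add: e0 e1)+
  have "supp (soc uscale (?Q 0)) \<subseteq> supp (soc uscale (?Q' 0))"
  proof (rule supp_soc_mono[OF vs vs rep f(1)])
    show "v = 0" if "v \<in> sp (?Q 0) x" "f0 x v = 0" for x v
      using inj(1)[OF that(1)] that(2) rep_hom_0[OF vs rep(2) g(1)] by simp
  qed
  moreover have "supp (soc uscale (?Q (Suc 0))) \<subseteq> supp (soc uscale (?Q' (Suc 0)))"
  proof (rule supp_soc_mono[OF vs vs rep f(2)])
    show "v = 0" if "v \<in> sp (?Q (Suc 0)) x" "f1 x v = 0" for x v
      using inj(2)[OF that(1)] that(2) rep_hom_0[OF vs rep(2) g(2)] by simp
  qed
  ultimately show ?thesis using j by auto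
qed

lemma interval_mult_nonzero_crt1:
  fixes s :: "'k::field \<Rightarrow> 'v::ab_group_add \<Rightarrow> 'v" and M :: "('p::{finite,order}, 'v) rep"
  assumes "vector_space s" "is_rep s M" "I \<in> intervals" "interval_mult s M I \<noteq> 0"
  shows "I \<in> crt1 s M"
proof -
  note vf = vector_space_field[where 'k='k] and L = is_rep_interval_rep[OF assms(3), where 'k='k]
    and vs = vector_space_uscale[where 'k='k]
  obtain Ns where Ns: "indec_decomposition s M Ns" using ex_indec_decomposition[OF assms(1,2)] .
  \<comment> \<open>Positive multiplicity amounts to a dual system of size 1. The maps of such a
    system present the interval module as a retract of \<open>M\<close>.\<close>
  have "dual_system s M I 1" using assms(4)
    by (intro iffD2[OF dual_system_iff[OF assms(1-3) Ns]]) (simp add: interval_mult_eq[OF assms(1-3) Ns] Suc_le_eq)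
  then obtain f g where "rep_hom (*) (interval_rep I) s M (f 0)" "rep_hom s M (*) (interval_rep I) (g 0)"
    and gf: "\<And>x. x \<in> I \<Longrightarrow> g (0::nat) x (f (0::nat) x 1) = (1 :: 'k)"
    unfolding dual_system_def by auto
  note f = this(1) and g = this(2)
  note fg = rep_hom_compose[OF f g]
  have r: "g 0 x (f 0 x v) = v" if "v \<in> sp (interval_rep I) x" for x v
  proof (cases "x \<in> I")
    case True
    then have "g 0 x (f 0 x (v * 1)) = v * g 0 x (f 0 x 1)"
      by (intro linear_between_scale[OF rep_hom_linear[OF fg]]) (simp add: sp_interval_rep)
    then show ?thesis using gf[OF True] by simp
  next
    case False
    then show ?thesis using that rep_hom_0[OF vf L fg, of x] by (simp add: sp_interval_rep)
  qed
  show ?thesis unfolding crt1_def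
    using assms(3) proj_term_retract[OF vf L assms(1,2) f g r] inj_term_retract[OF vf L assms(1,2) f g r] by blast
qed

text \<open>The weights are arbitrary, so the same statement serves the dimension at each vertex and
  the total dimension.\<close>

lemma sum_crt1_eq:
  fixes s :: "'k::field \<Rightarrow> 'v::ab_group_add \<Rightarrow> 'v" and M :: "('p::{finite,order}, 'v) rep"
  assumes "vector_space s" "is_rep s M"
  shows "(\<Sum>I\<in>intervals. interval_mult s M I * w I) = (\<Sum>I\<in>crt1 s M. interval_mult s M I * w I)"
proof (rule sum.mono_neutral_right)
  show "crt1 s M \<subseteq> intervals" unfolding crt1_def by blast
  show "\<forall>I\<in>intervals - crt1 s M. interval_mult s M I * w I = 0"
    using interval_mult_nonzero_crt1[OF assms] by (metis DiffE mult_zero_left)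
qed simp

text \<open>The interval summands live on \<open>'k\<close>, whereas
  \<open>indec_decomposition\<close> asks for modules on \<open>nat \<Rightarrow> 'k\<close>; each
  is replaced by a chosen copy \<open>U I\<close>.\<close>

lemma interval_decomposable_imp_decomposition:
  fixes s :: "'k::field \<Rightarrow> 'v::ab_group_add \<Rightarrow> 'v" and M :: "('p::{finite,order}, 'v) rep"
  assumes "vector_space s" "is_rep s M" "interval_decomposable s M"
  obtains Ns where "indec_decomposition s M Ns"
    "\<And>N. N \<in> set Ns \<Longrightarrow> \<exists>I\<in>intervals. rep_isomorphic uscale N (*) (interval_rep I :: ('p, 'k) rep)"
proof -
  note vf = vector_space_field[where 'k='k] and vs = vector_space_uscale[where 'k='k]
  obtain Is where Is: "set Is \<subseteq> intervals" "rep_isomorphic s M uscale (dsum (map interval_rep Is))"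
    using assms(3) by (auto simp: interval_decomposable_def)
  let ?Ls = "map interval_rep Is :: ('p, 'k) rep list"
  have I: "I \<in> intervals" if "I \<in> set Is" for I using that Is(1) by blast
  obtain i p where b: "biprod s M (*) ?Ls i p"
    using biprod_of_iso[OF assms(1,2) vf _ Is(2)] is_rep_interval_rep I by (metis (no_types, lifting) imageE list.set_map)
  have "\<exists>(U :: ('p, 'k) urep) f g. is_rep uscale U \<and> iso_pair (*) (interval_rep I) uscale U f g" if "I \<in> intervals" for I
    using ex_urep[OF vf is_rep_interval_rep[OF that]] by metis
  then obtain U :: "'p set \<Rightarrow> ('p, 'k) urep" and \<phi> \<psi> where U: "\<And>I. I \<in> intervals \<Longrightarrow> is_rep uscale (U I)"
    "\<And>I. I \<in> intervals \<Longrightarrow> iso_pair (*) (interval_rep I) uscale (U I) (\<phi> I) (\<psi> I)" by metis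
  have "biprod s M uscale (map U Is) (\<lambda>k x v. i k x (\<psi> (Is ! k) x v)) (\<lambda>k x v. \<phi> (Is ! k) x (p k x v))"
  proof (rule biprod_map_iso[OF b])
    fix k assume "k < length ?Ls"
    then have k: "k < length Is" "Is ! k \<in> intervals" using I by auto
    show iso: "iso_pair (*) (?Ls ! k) uscale (map U Is ! k) (\<phi> (Is ! k)) (\<psi> (Is ! k))"
      using U(2)[OF k(2)] k(1) by simp
    show "\<phi> (Is ! k) x 0 = 0" for x
      using rep_hom_0[OF vf is_rep_interval_rep[OF k(2)]] U(2)[OF k(2)] unfolding iso_pair_def by blast
  qed simp
  then have "rep_isomorphic s M (fun_scale uscale) (dsum (map U Is))"
    by (rule iso_of_biprod[OF assms(1,2) vs])
  moreover have iso: "rep_isomorphic (*) (interval_rep I :: ('p, 'k) rep) uscale (U I)" if "I \<in> intervals" for I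
    by (rule iso_pair_rep_isomorphic[OF U(2)[OF that]])
  moreover have "indecomposable uscale (U I)" if "I \<in> intervals" for I
    by (rule indecomposable_iso[OF vf is_rep_interval_rep[OF that] vs U(1)[OF that] iso[OF that]
      indecomposable_interval_rep[OF that]])
  ultimately have "indec_decomposition s M (map U Is)"
    using U(1) I by (auto simp: indec_decomposition_def)
  then show ?thesis
  proof (rule that)
    fix N assume "N \<in> set (map U Is)"
    then obtain J where J: "J \<in> intervals" "N = U J" using I by auto
    show "\<exists>I\<in>intervals. rep_isomorphic uscale N (*) (interval_rep I :: ('p, 'k) rep)"
      using rep_isomorphic_sym[OF vf is_rep_interval_rep[OF J(1)] iso[OF J(1)]] J by blast
  qed
qed

lemma dim_vec_interval_decomposable:
  fixes s :: "'k::field \<Rightarrow> 'v::ab_group_add \<Rightarrow> 'v" and M :: "('p::{finite,order}, 'v) rep"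
  assumes "vector_space s" "is_rep s M" "interval_decomposable s M"
  shows "dim_vec s M x = (\<Sum>I\<in>intervals. interval_mult s M I * dim_vec ((*) :: 'k \<Rightarrow> 'k \<Rightarrow> 'k) (interval_rep I) x)"
proof -
  note vf = vector_space_field[where 'k='k] and vs = vector_space_uscale[where 'k='k]
  obtain Ns where Ns: "indec_decomposition s M Ns"
    "\<And>N. N \<in> set Ns \<Longrightarrow> \<exists>I\<in>intervals. rep_isomorphic uscale N (*) (interval_rep I :: ('p, 'k) rep)"
    using interval_decomposable_imp_decomposition[OF assms] by blast
  have N: "\<forall>N\<in>set Ns. is_rep uscale N" and iso: "rep_isomorphic s M (fun_scale uscale) (dsum Ns)"
    using Ns(1) by (auto simp: indec_decomposition_def)
  obtain i p where b: "biprod s M uscale Ns i p" using biprod_of_iso[OF assms(1,2) vs N iso] .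
  have "dim_vec s M x = (\<Sum>k<length Ns. dim_vec uscale (Ns ! k) x)" by (rule dim_vec_biprod[OF assms(1,2) vs N b])
  also have "\<dots> = (\<Sum>k<length Ns. \<Sum>I\<in>intervals. if rep_isomorphic uscale (Ns ! k) (*) (interval_rep I :: ('p, 'k) rep)
      then dim_vec ((*) :: 'k \<Rightarrow> 'k \<Rightarrow> 'k) (interval_rep I) x else 0)"
  proof (intro sum.cong refl)
    fix k assume "k \<in> {..<length Ns}"
    then have k: "Ns ! k \<in> set Ns" by simp
    then obtain I where I: "I \<in> intervals" "rep_isomorphic uscale (Ns ! k) (*) (interval_rep I :: ('p, 'k) rep)"
      using Ns(2) by blast
    have Nk: "is_rep uscale (Ns ! k)" using N k by blast
    show "dim_vec uscale (Ns ! k) x = (\<Sum>I\<in>intervals. if rep_isomorphic uscale (Ns ! k) (*) (interval_rep I :: ('p, 'k) rep)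
      then dim_vec ((*) :: 'k \<Rightarrow> 'k \<Rightarrow> 'k) (interval_rep I) x else 0)"
      unfolding sum_iso_intervals[OF Nk I] by (rule dim_vec_iso[OF vs Nk vf is_rep_interval_rep[OF I(1)] I(2)])
  qed
  also have "\<dots> = (\<Sum>I\<in>intervals. interval_mult s M I * dim_vec ((*) :: 'k \<Rightarrow> 'k \<Rightarrow> 'k) (interval_rep I) x)"
    by (rule sum_interval_mult[OF assms(1,2) Ns(1), symmetric])
  finally show ?thesis .
qed

text \<open>The right-hand side adds the dimensions of the interval summands of one decomposition.
  Any other summand has positive dimension and would make that sum too small.\<close>

lemma interval_decomposable_if_total_dim:
  fixes s :: "'k::field \<Rightarrow> 'v::ab_group_add \<Rightarrow> 'v" and M :: "('p::{finite,order}, 'v) rep"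
  assumes "vector_space s" "is_rep s M"
    and dim: "total_dim s M = (\<Sum>I\<in>intervals. interval_mult s M I * total_dim ((*) :: 'k \<Rightarrow> 'k \<Rightarrow> 'k) (interval_rep I))"
  shows "interval_decomposable s M"
proof -
  note vf = vector_space_field[where 'k='k] and vs = vector_space_uscale[where 'k='k]
  obtain Ns where Ns: "indec_decomposition s M Ns" using ex_indec_decomposition[OF assms(1,2)] .
  have N: "\<forall>N\<in>set Ns. is_rep uscale N" and ind: "\<And>N. N \<in> set Ns \<Longrightarrow> indecomposable uscale N"
    and iso: "rep_isomorphic s M (fun_scale uscale) (dsum Ns)"
    using Ns by (auto simp: indec_decomposition_def)
  obtain i p where b: "biprod s M uscale Ns i p" using biprod_of_iso[OF assms(1,2) vs N iso] .
  \<comment> \<open>The share of the \<open>k\<close>-th summand in the right-hand side: its total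
    dimension if it is an interval module, and 0 otherwise.\<close>
  define q where "q k = (\<Sum>I\<in>intervals. if rep_isomorphic uscale (Ns ! k) (*) (interval_rep I :: ('p, 'k) rep)
      then total_dim ((*) :: 'k \<Rightarrow> 'k \<Rightarrow> 'k) (interval_rep I) else 0)" for k
  have q: "q k = total_dim uscale (Ns ! k)"
    if "k < length Ns" "I \<in> intervals" "rep_isomorphic uscale (Ns ! k) (*) (interval_rep I :: ('p, 'k) rep)" for k I
  proof -
    have Nk: "is_rep uscale (Ns ! k)" using N that(1) by simp
    show ?thesis unfolding q_def sum_iso_intervals[OF Nk that(2,3)]
      by (rule total_dim_iso[OF vs Nk vf is_rep_interval_rep[OF that(2)] that(3), symmetric])
  qed
  have ex: "\<exists>I\<in>intervals. rep_isomorphic uscale (Ns ! k) (*) (interval_rep I :: ('p, 'k) rep)" if k: "k < length Ns" for k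
  proof (rule ccontr)
    assume no: "\<not> ?thesis"
    have le: "q l \<le> total_dim uscale (Ns ! l)" if "l < length Ns" for l
    proof (cases "\<exists>I\<in>intervals. rep_isomorphic uscale (Ns ! l) (*) (interval_rep I :: ('p, 'k) rep)")
      case True
      then show ?thesis using q[OF that] by auto
    next
      case False
      then have "q l = 0" unfolding q_def by (intro sum.neutral) auto
      then show ?thesis by simp
    qed
    have "q k = 0" unfolding q_def using no by (intro sum.neutral) auto
    moreover have "is_rep uscale (Ns ! k)" "\<not> zero_rep (Ns ! k)"
      using N ind[of "Ns ! k"] k by (auto simp: indecomposable_def)
    ultimately have "q k < total_dim uscale (Ns ! k)" using total_dim_pos[OF vs] by simp
    then have "(\<Sum>k<length Ns. q k) < (\<Sum>k<length Ns. total_dim uscale (Ns ! k))"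
      using le k by (intro sum_strict_mono_ex1) auto
    also have "\<dots> = total_dim s M" by (rule total_dim_biprod[OF assms(1,2) vs N b, symmetric])
    also have "\<dots> = (\<Sum>k<length Ns. q k)"
      unfolding dim q_def by (rule sum_interval_mult[OF assms(1,2) Ns])
    finally show False by simp
  qed
  then obtain J where J: "\<And>k. k < length Ns \<Longrightarrow> J k \<in> intervals"
    "\<And>k. k < length Ns \<Longrightarrow> rep_isomorphic uscale (Ns ! k) (*) (interval_rep (J k) :: ('p, 'k) rep)" by metis
  have "\<exists>f g. iso_pair uscale (Ns ! k) (*) (interval_rep (J k) :: ('p, 'k) rep) f g" if "k < length Ns" for k
    using rep_isomorphic_iso_pair[OF vs _ J(2)[OF that]] N that by (metis nth_mem)
  then obtain \<phi> \<psi> where \<phi>: "\<And>k. k < length Ns \<Longrightarrow> iso_pair uscale (Ns ! k) (*) (interval_rep (J k) :: ('p, 'k) rep) (\<phi> k) (\<psi> k)"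
    by metis
  define Is where "Is = map J [0..<length Ns]"
  have "biprod s M (*) (map interval_rep Is :: ('p, 'k) rep list) (\<lambda>k x v. i k x (\<psi> k x v)) (\<lambda>k x v. \<phi> k x (p k x v))"
  proof (rule biprod_map_iso[OF b])
    fix k assume k: "k < length Ns"
    show "iso_pair uscale (Ns ! k) (*) (map interval_rep Is ! k :: ('p, 'k) rep) (\<phi> k) (\<psi> k)"
      using \<phi>[OF k] k by (simp add: Is_def)
    show "\<phi> k x 0 = 0" for x
      using rep_hom_0[OF vs, of "Ns ! k"] N k \<phi>[OF k] unfolding iso_pair_def by (metis nth_mem)
  qed (simp add: Is_def)
  then have "rep_isomorphic s M uscale (dsum (map interval_rep Is))"
    by (rule iso_of_biprod[OF assms(1,2) vf])
  moreover have "set Is \<subseteq> intervals" using J(1) by (auto simp: Is_def)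
  ultimately show ?thesis unfolding interval_decomposable_def by blast
qed

theorem lemma3p55:
  fixes s :: "'k::field \<Rightarrow> 'v::ab_group_add \<Rightarrow> 'v"
    and M :: "('p::{finite, order}, 'v) rep"
  assumes "vector_space s"
    and "is_rep s M"
  shows
    "(interval_decomposable s M
      \<longleftrightarrow>
      (dim_vec s M = (\<lambda>x. \<Sum>I\<in>intervals. interval_mult s M I * dim_vec ((*) :: 'k \<Rightarrow> 'k \<Rightarrow> 'k) (interval_rep I) x) \<and>
       (\<lambda>x. \<Sum>I\<in>intervals. interval_mult s M I * dim_vec ((*) :: 'k \<Rightarrow> 'k \<Rightarrow> 'k) (interval_rep I) x)
         = (\<lambda>x. \<Sum>I\<in>crt1 s M. interval_mult s M I * dim_vec ((*) :: 'k \<Rightarrow> 'k \<Rightarrow> 'k) (interval_rep I) x)))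
     \<and>
     ((dim_vec s M = (\<lambda>x. \<Sum>I\<in>intervals. interval_mult s M I * dim_vec ((*) :: 'k \<Rightarrow> 'k \<Rightarrow> 'k) (interval_rep I) x) \<and>
       (\<lambda>x. \<Sum>I\<in>intervals. interval_mult s M I * dim_vec ((*) :: 'k \<Rightarrow> 'k \<Rightarrow> 'k) (interval_rep I) x)
         = (\<lambda>x. \<Sum>I\<in>crt1 s M. interval_mult s M I * dim_vec ((*) :: 'k \<Rightarrow> 'k \<Rightarrow> 'k) (interval_rep I) x))
      \<longleftrightarrow>
      (total_dim s M = (\<Sum>I\<in>intervals. interval_mult s M I * total_dim ((*) :: 'k \<Rightarrow> 'k \<Rightarrow> 'k) (interval_rep I)) \<and>
       (\<Sum>I\<in>intervals. interval_mult s M I * total_dim ((*) :: 'k \<Rightarrow> 'k \<Rightarrow> 'k) (interval_rep I))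
         = (\<Sum>I\<in>crt1 s M. interval_mult s M I * total_dim ((*) :: 'k \<Rightarrow> 'k \<Rightarrow> 'k) (interval_rep I))))"
    (is "(?D \<longleftrightarrow> ?vec \<and> ?vec_crt) \<and> (_ \<longleftrightarrow> ?tot \<and> ?tot_crt)")
proof -
  \<comment> \<open>Both restrictions to \<open>crt1\<close> hold for every \<open>M\<close>, which
    leaves a cycle of three implications between interval-decomposability and the two unrestricted
    equalities.\<close>
  have crt: ?vec_crt ?tot_crt using sum_crt1_eq[OF assms] by auto
  have "?D \<Longrightarrow> ?vec" using dim_vec_interval_decomposable[OF assms] by (intro ext)
  moreover have "?vec \<Longrightarrow> ?tot"
    unfolding total_dim_def by (simp add: sum_distrib_left sum.swap[of _ intervals])
  moreover have "?tot \<Longrightarrow> ?D" by (rule interval_decomposable_if_total_dim[OF assms])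
  ultimately show ?thesis using crt by blast
qed

end
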